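(* Let $n\in\mathbb{N}$ and let $\mathbf a_1,\dots,\mathbf a_n,\mathbf b_1,\dots,\mathbf b_n\in\mathfrak R_{\mathbb D}$. Let $\mathbf P\in\mathfrak R^{n\times n}$ be the matrix with $(i,j)$ entry $(1-\mathbf b_i\mathbf b_j^* )(1-\mathbf a_i\mathbf a_j^* )^{-1}$, let $\mathbf A=\mathrm{diag}(\mathbf a_1^*,\dots,\mathbf a_n^* )\in\mathfrak R^{n\times n}$, let $$\mathbf C=\begin{pmatrix}1&1&\cdots&1\\ \mathbf b_1^*&\mathbf b_2^*&\cdots&\mathbf b_n^*\end{pmatrix}\in\mathfrak R^{2\times n},\qquad J=\begin{pmatrix}1&0\\0&-1\end{pmatrix}.$$ Assume that $\mathbf P>0$, and for $\lambda\in\mathbb D$ put $$\mathbf\Theta(\lambda)=I_2-(1-\lambda)\,\mathbf C(I_n-\lambda\mathbf A)^{-1}\mathbf P^{-1}(I_n-\mathbf A^* )^{-1}\mathbf C^*J=\begin{pmatrix}\mathbf a(\lambda)&\mathbf b(\lambda)\\ \mathbf c(\lambda)&\mathbf d(\lambda)\end{pmatrix}\in\mathfrak R^{2\times 2}.$$ Then the linear fractional transformation $$\mathbf g\mapsto T_{\mathbf\Theta}(\mathbf g),\qquad T_{\mathbf\Theta}(\mathbf g)(\lambda)=\bigl(\mathbf a(\lambda)\mathbf g(\lambda)+\mathbf b(\lambda)\bigr)\bigl(\mathbf c(\lambda)\mathbf g(\lambda)+\mathbf d(\lambda)\bigr)^{-1},\quad \lambda\in\mathbb D,$$ is a one-to-one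 correspondence between the elements $\mathbf g\in S_{\mathfrak R}$ and the functions $\mathbf f\in S_{\mathfrak R}$ satisfying $\mathbf f(\mathbf a_i)=\mathbf b_i$ for $i=1,\dots,n$.
   Context: Let $\ell$ be the set of sequences $\alpha=(\alpha_1,\alpha_2,\dots)$ of non-negative integers with only finitely many non-zero entries, $z^\alpha=\prod_j z_j^{\alpha_j}$ and $(2\mathbb N)^{\alpha}=\prod_{j\ge1}(2j)^{\alpha_j}$. For $k\in\mathbb N=\{1,2,\dots\}$ let $\mathcal H_k'$ be the Hilbert space of formal power series $F=\sum_{\alpha\in\ell}f_\alpha z^\alpha$ in the countably many variables $z_1,z_2,\dots$, $f_\alpha\in\mathbb C$, with $\|F\|_k'=\bigl(\sum_{\alpha}|f_\alpha|^2(2\mathbb N)^{-k\alpha}\bigr)^{1/2}<\infty$. Let $\mathfrak R=\bigcup_{k\ge1}\mathcal H_k'$, a commutative ring under the usual addition and multiplication of power series (the image under the Hermite transform $H_\alpha\mapsto z^\alpha$ of the Kondratiev space $S_{-1}$ of stochastic distributions with the Wick product). Its topology is that of the inductive limit of the $\mathcal H_k'$, equivalently the strong dual of the countably normed nuclear space $S_1=\bigcap_k\mathcal H_k$, where $\mathcal H_k$ has norm $\bigl(\sum_\alpha(\alpha!)^2|f_\alpha|^2(2\mathbb N)^{k\alpha}\bigr)^{1/2}$. For $\mathbf r=\sum_\alpha r_\alpha z^\alpha\in\mathfrak R$ write $\mathscr I(\mathbf r)=\mathbf r(0)=r_{(0,0,\dots)}\in\mathbb C$ and $\mathbf r^*=\sum_\alpha\overline{r_\alpha}z^\alpha$.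 The adjoint of a matrix over $\mathfrak R$ is obtained by transposing and applying $*$ to each entry. An element $\mathbf r\in\mathfrak R$ is invertible in $\mathfrak R$ if and only if $\mathbf r(0)\ne0$, and a square matrix over $\mathfrak R$ is invertible if and only if its determinant is. A matrix $\mathbf M\in\mathfrak R^{n\times n}$ is strictly positive, written $\mathbf M>0$, if $\mathbf M=\mathbf G\mathbf G^*$ for some invertible $\mathbf G\in\mathfrak R^{n\times n}$. $\mathbb D$ is the open unit disk of $\mathbb C$ and $\mathfrak R_{\mathbb D}=\{\mathbf r\in\mathfrak R:\mathscr I(\mathbf r)\in\mathbb D\}$. For $\Omega\subset\mathbb C$ open, a function $\mathbf f:\Omega\to\mathfrak R$ is analytic if it is continuous and locally admits a power series expansion with coefficients in one of the spaces $\mathcal H_p'$ (and convergent there; $p$ may depend on the point). If $\mathscr I(\mathbf r)\in\Omega$ and $\mathbf f(\zeta)=\sum_{m\ge0}\mathbf f_m(\zeta-\mathscr I(\mathbf r))^m$ is the Taylor expansion around $\mathscr I(\mathbf r)$, the evaluation of $\mathbf f$ at $\mathbf r$ is $\mathbf f(\mathbf r)=\sum_{m\ge0}\mathbf f_m(\mathbf r-\mathscr I(\mathbf r))^m$, a series that converges in some $\mathcal H_q'$. A (scalar) Schur function is an analytic function $f:\mathbb D\to\mathbb C$ with $|f|\le1$ on $\mathbb D$. $S_{\mathfrak R}$ denotes the set of analytic functions $\mathbf f:\mathbb D\to\mathfrak R$ such that $\lambda\mapsto\mathscr I(\mathbf f(\lambda))$ is a Schur function. *)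

theory Defs
  imports "HOL-Analysis.Analysis" "HOL-Library.Poly_Mapping"
begin

section \<open>The ring of power series\<close>

text \<open>Multi-indices are elements of \<^typ>\<open>nat \<Rightarrow>\<^sub>0 nat\<close>. Variables are numbered from 0 here, so the
  index \<open>j\<close> stands for $z_{j+1}$ and its weight is \<open>2 (j + 1)\<close>.\<close>

definition two_N :: "(nat \<Rightarrow>\<^sub>0 nat) \<Rightarrow> real" where
  "two_N \<alpha> = (\<Prod>j\<in>Poly_Mapping.keys \<alpha>. (2 * real (Suc j)) ^ Poly_Mapping.lookup \<alpha> j)"

definition in_hspace :: "nat \<Rightarrow> ((nat \<Rightarrow>\<^sub>0 nat) \<Rightarrow> complex) \<Rightarrow> bool" where
  "in_hspace k f \<longleftrightarrow> (\<lambda>\<alpha>. (cmod (f \<alpha>))\<^sup>2 / two_N \<alpha> ^ k) summable_on UNIV"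

lemma two_N_superset:
  assumes "finite J" "Poly_Mapping.keys \<alpha> \<subseteq> J"
  shows "two_N \<alpha> = (\<Prod>j\<in>J. (2 * real (Suc j)) ^ Poly_Mapping.lookup \<alpha> j)"
  unfolding two_N_def
  by (rule prod.mono_neutral_left) (use assms in \<open>auto simp: in_keys_iff\<close>)

lemma two_N_ge_1: "two_N \<alpha> \<ge> 1"
  unfolding two_N_def by (intro prod_ge_1 one_le_power) auto

lemma two_N_pos: "two_N \<alpha> > 0"
  using two_N_ge_1[of \<alpha>] by linarith

lemma two_N_nonneg [simp]: "two_N \<alpha> \<ge> 0"
  using two_N_ge_1[of \<alpha>] by linarith

lemma two_N_0 [simp]: "two_N 0 = 1"
  by (simp add: two_N_def)

lemma two_N_add: "two_N (\<alpha> + \<beta>) = two_N \<alpha> * two_N \<beta>"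
proof -
  let ?J = "Poly_Mapping.keys \<alpha> \<union> Poly_Mapping.keys \<beta>"
  have "two_N (\<alpha> + \<beta>) = (\<Prod>j\<in>?J. (2 * real (Suc j)) ^ Poly_Mapping.lookup (\<alpha> + \<beta>) j)"
    by (rule two_N_superset) (use Poly_Mapping.keys_add[of \<alpha> \<beta>] in auto)
  also have "\<dots> = (\<Prod>j\<in>?J. (2 * real (Suc j)) ^ Poly_Mapping.lookup \<alpha> j) *
                  (\<Prod>j\<in>?J. (2 * real (Suc j)) ^ Poly_Mapping.lookup \<beta> j)"
    by (simp add: lookup_add power_add prod.distrib)
  also have "\<dots> = two_N \<alpha> * two_N \<beta>"
    by (simp add: two_N_superset[of ?J \<alpha>] two_N_superset[of ?J \<beta>])
  finally show ?thesis .
qed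

lemma finite_add_pairs: "finite {(\<beta>, \<gamma>). \<beta> + \<gamma> = (\<alpha> :: nat \<Rightarrow>\<^sub>0 nat)}"
  and card_add_pairs: "real (card {(\<beta>, \<gamma>). \<beta> + \<gamma> = (\<alpha> :: nat \<Rightarrow>\<^sub>0 nat)}) \<le> two_N \<alpha>"
proof -
  let ?S = "{(\<beta>, \<gamma>). \<beta> + \<gamma> = \<alpha>}"
  let ?K = "Poly_Mapping.keys \<alpha>"
  let ?T = "\<Pi>\<^sub>E j\<in>?K. {..Poly_Mapping.lookup \<alpha> j}"
  let ?h = "\<lambda>(\<beta>, \<gamma> :: nat \<Rightarrow>\<^sub>0 nat). restrict (Poly_Mapping.lookup \<beta>) ?K"
  have zero: "Poly_Mapping.lookup \<beta> j = 0" if "\<beta> + \<gamma> = \<alpha>" "j \<notin> ?K" for \<beta> \<gamma> j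
  proof -
    have "Poly_Mapping.lookup \<alpha> j = 0" using that by (simp add: in_keys_iff)
    thus ?thesis using that(1) by (auto simp: lookup_add)
  qed
  have inj: "inj_on ?h ?S"
  proof (rule inj_onI, clarify)
    fix \<beta> \<gamma> \<beta>' \<gamma>' assume *: "\<alpha> = \<beta> + \<gamma>" "\<beta>' + \<gamma>' = \<beta> + \<gamma>"
      "restrict (Poly_Mapping.lookup \<beta>) (Poly_Mapping.keys (\<beta> + \<gamma>)) =
       restrict (Poly_Mapping.lookup \<beta>') (Poly_Mapping.keys (\<beta> + \<gamma>))"
    have "Poly_Mapping.lookup \<beta> j = Poly_Mapping.lookup \<beta>' j" for j
    proof (cases "j \<in> ?K")
      case True
      thus ?thesis using *(1) fun_cong[OF *(3), of j] by (simp add: restrict_def)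
    next
      case False
      thus ?thesis using zero[of \<beta> \<gamma> j] zero[of \<beta>' \<gamma>' j] * by simp
    qed
    hence "\<beta> = \<beta>'" by (intro poly_mapping_eqI)
    thus "\<beta> = \<beta>' \<and> \<gamma> = \<gamma>'" using * by simp
  qed
  have img: "?h ` ?S \<subseteq> ?T"
    by (auto simp: lookup_add)
  have finT: "finite ?T" by (intro finite_PiE) auto
  show "finite ?S" using inj img finT by (meson inj_on_finite)
  have "card ?S \<le> card ?T" using inj img finT by (meson card_inj_on_le)
  also have "card ?T = (\<Prod>j\<in>?K. Suc (Poly_Mapping.lookup \<alpha> j))"
    by (simp add: card_PiE)
  finally have "real (card ?S) \<le> real (\<Prod>j\<in>?K. Suc (Poly_Mapping.lookup \<alpha> j))"
    by (simp only: of_nat_le_iff)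
  also have "\<dots> = (\<Prod>j\<in>?K. real (Suc (Poly_Mapping.lookup \<alpha> j)))" by simp
  also have "\<dots> \<le> two_N \<alpha>"
    unfolding two_N_def
  proof (intro prod_mono conjI)
    fix j
    let ?n = "Poly_Mapping.lookup \<alpha> j"
    have "Suc ?n \<le> 2 ^ ?n" by (simp add: Suc_leI)
    hence "real (Suc ?n) \<le> real (2 ^ ?n)" by (simp only: of_nat_le_iff)
    also have "\<dots> = 2 ^ ?n" by simp
    also have "\<dots> \<le> (2 * real (Suc j)) ^ ?n" by (intro power_mono) auto
    finally show "real (Suc ?n) \<le> (2 * real (Suc j)) ^ ?n" .
  qed simp
  finally show "real (card ?S) \<le> two_N \<alpha>" .
qed

lemma frac_le_frac: "0 < b \<Longrightarrow> 0 < d \<Longrightarrow> a * d \<le> c * b \<Longrightarrow> a / b \<le> c / (d :: real)"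
  by (simp add: pos_divide_le_eq pos_le_divide_eq)

lemma prod_geometric_bound:
  "(\<Prod>j<m. 1 / (1 - 1 / (2 * real (Suc j))\<^sup>2)) \<le> 2 * real (Suc m) / real (m + 2)"
proof (induction m)
  case (Suc m)
  let ?x = "real (Suc m)"
  have "1 / (1 - 1 / (2 * ?x)\<^sup>2) = (2 * ?x)\<^sup>2 / ((2 * ?x)\<^sup>2 - 1)"
    by (simp add: field_simps)
  also have "\<dots> \<le> (?x + 1)\<^sup>2 / (?x * (?x + 2))"
  proof -
    have x: "?x \<ge> 1" by simp
    have "0 \<le> 3 * ?x\<^sup>2 - 2 * ?x - 1"
    proof -
      have "3 * ?x\<^sup>2 - 2 * ?x - 1 = (?x - 1) * (3 * ?x + 1)"
        by (simp add: algebra_simps power2_eq_square)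
      thus ?thesis using x by simp
    qed
    moreover have "(?x + 1)\<^sup>2 * ((2 * ?x)\<^sup>2 - 1) - (2 * ?x)\<^sup>2 * (?x * (?x + 2)) = 3 * ?x\<^sup>2 - 2 * ?x - 1"
      by (simp only: power2_eq_square) algebra
    ultimately have le: "(2 * ?x)\<^sup>2 * (?x * (?x + 2)) \<le> (?x + 1)\<^sup>2 * ((2 * ?x)\<^sup>2 - 1)" by linarith
    have pos: "(2 * ?x)\<^sup>2 - 1 > 0"
    proof -
      have "(1::real)\<^sup>2 < (2 * ?x)\<^sup>2" by (rule power_strict_mono) auto
      thus ?thesis by simp
    qed
    have "?x * (?x + 2) > 0" by simp
    from pos this le show ?thesis by (rule frac_le_frac)
  qed
  finally have step: "1 / (1 - 1 / (2 * ?x)\<^sup>2) \<le> (?x + 1)\<^sup>2 / (?x * (?x + 2))" .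
  have "(\<Prod>j<Suc m. 1 / (1 - 1 / (2 * real (Suc j))\<^sup>2)) \<le>
        2 * real (Suc m) / real (m + 2) * ((?x + 1)\<^sup>2 / (?x * (?x + 2)))"
    unfolding prod.lessThan_Suc
  proof (rule mult_mono[OF Suc.IH step])
    have sq: "(2 * ?x)\<^sup>2 \<ge> 1\<^sup>2" by (intro power_mono) auto
    thus "0 \<le> 1 / (1 - 1 / (2 * ?x)\<^sup>2)" by (simp add: divide_simps)
  qed simp
  also have "\<dots> = 2 * real (Suc (Suc m)) / real (Suc m + 2)"
    by (simp add: divide_simps power2_eq_square) (simp add: algebra_simps)
  finally show ?case .
qed simp

lemma summable_two_N: "(\<lambda>\<alpha>. 1 / (two_N \<alpha>)\<^sup>2) summable_on UNIV"
proof (rule nonneg_bdd_above_summable_on)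
  show "bdd_above (sum (\<lambda>\<alpha>. 1 / (two_N \<alpha>)\<^sup>2) ` {F. F \<subseteq> UNIV \<and> finite F})"
  proof (rule bdd_aboveI2)
    fix S :: "(nat \<Rightarrow>\<^sub>0 nat) set" assume "S \<in> {F. F \<subseteq> UNIV \<and> finite F}"
    hence fin: "finite S" by simp
    obtain m where m: "(\<Union>\<alpha>\<in>S. Poly_Mapping.keys \<alpha>) \<subseteq> {..<m}"
      using finite_nat_iff_bounded[of "\<Union>\<alpha>\<in>S. Poly_Mapping.keys \<alpha>"] fin by auto
    have "finite (\<Union>\<alpha>\<in>S. Poly_Mapping.lookup \<alpha> ` {..<m})" using fin by auto
    then obtain N where N: "(\<Union>\<alpha>\<in>S. Poly_Mapping.lookup \<alpha> ` {..<m}) \<subseteq> {..<N}"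
      using finite_nat_iff_bounded by auto
    define q where "q j = 1 / (2 * real (Suc j))\<^sup>2" for j
    have q: "0 \<le> q j" "q j < 1" for j
    proof -
      show "0 \<le> q j" by (simp add: q_def)
      have "(1::real)\<^sup>2 < (2 * real (Suc j))\<^sup>2" by (intro power_strict_mono) auto
      thus "q j < 1" by (simp add: q_def divide_simps)
    qed
    let ?h = "\<lambda>\<alpha>. restrict (Poly_Mapping.lookup \<alpha>) {..<m}"
    have inj: "inj_on ?h S"
    proof (rule inj_onI)
      fix \<alpha> \<beta> assume *: "\<alpha> \<in> S" "\<beta> \<in> S" "?h \<alpha> = ?h \<beta>"
      show "\<alpha> = \<beta>"
      proof (rule poly_mapping_eqI)
        fix j show "Poly_Mapping.lookup \<alpha> j = Poly_Mapping.lookup \<beta> j"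
        proof (cases "j < m")
          case True thus ?thesis using fun_cong[OF *(3), of j] by simp
        next
          case False
          hence "j \<notin> Poly_Mapping.keys \<alpha>" "j \<notin> Poly_Mapping.keys \<beta>" using m * by auto
          thus ?thesis by (simp add: in_keys_iff)
        qed
      qed
    qed
    have "(\<Sum>\<alpha>\<in>S. 1 / (two_N \<alpha>)\<^sup>2) = (\<Sum>\<alpha>\<in>S. \<Prod>j<m. q j ^ ?h \<alpha> j)"
    proof (rule sum.cong[OF refl])
      fix \<alpha> assume "\<alpha> \<in> S"
      hence "two_N \<alpha> = (\<Prod>j<m. (2 * real (Suc j)) ^ Poly_Mapping.lookup \<alpha> j)"
        using m by (intro two_N_superset) auto
      hence "1 / (two_N \<alpha>)\<^sup>2 = (\<Prod>j<m. 1 / ((2 * real (Suc j)) ^ Poly_Mapping.lookup \<alpha> j)\<^sup>2)"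
        by (simp only: prod_power_distrib prod_dividef) simp
      also have "\<dots> = (\<Prod>j<m. q j ^ ?h \<alpha> j)"
        by (rule prod.cong) (auto simp: q_def power_divide power_mult [symmetric] mult.commute)
      finally show "1 / (two_N \<alpha>)\<^sup>2 = (\<Prod>j<m. q j ^ ?h \<alpha> j)" .
    qed
    also have "\<dots> = (\<Sum>g\<in>?h ` S. \<Prod>j<m. q j ^ g j)"
      by (simp only: sum.reindex[OF inj] o_def)
    also have "\<dots> \<le> (\<Sum>g\<in>(\<Pi>\<^sub>E j\<in>{..<m}. {..<N}). \<Prod>j<m. q j ^ g j)"
    proof (rule sum_mono2)
      show "?h ` S \<subseteq> (\<Pi>\<^sub>E j\<in>{..<m}. {..<N})"
      proof (intro image_subsetI restrict_PiE_iff[THEN iffD2] ballI)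
        fix \<alpha> j assume "\<alpha> \<in> S" "j \<in> {..<m}"
        thus "Poly_Mapping.lookup \<alpha> j \<in> {..<N}" using N by blast
      qed
    qed (use q in \<open>auto intro!: finite_PiE prod_nonneg zero_le_power\<close>)
    also have "\<dots> = (\<Prod>j<m. \<Sum>n<N. q j ^ n)"
      by (rule prod_sum_PiE [symmetric]) auto
    also have "\<dots> \<le> (\<Prod>j<m. 1 / (1 - q j))"
    proof (intro prod_mono conjI sum_nonneg)
      fix j
      have "(\<Sum>n<N. q j ^ n) = (1 - q j ^ N) / (1 - q j)"
        using q[of j] by (simp add: sum_gp_strict)
      also have "\<dots> \<le> 1 / (1 - q j)"
        using q[of j] by (intro divide_right_mono) auto
      finally show "(\<Sum>n<N. q j ^ n) \<le> 1 / (1 - q j)" .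
    qed (use q in auto)
    also have "\<dots> \<le> 2 * real (Suc m) / real (m + 2)"
      unfolding q_def by (rule prod_geometric_bound)
    also have "\<dots> \<le> 2" by (simp add: divide_simps)
    finally show "(\<Sum>\<alpha>\<in>S. 1 / (two_N \<alpha>)\<^sup>2) \<le> 2" .
  qed
qed auto

lemma in_hspace_bound:
  assumes "in_hspace k f"
  shows "\<exists>C. \<forall>\<alpha>. cmod (f \<alpha>) \<le> C * two_N \<alpha> ^ k"
proof -
  let ?g = "\<lambda>\<alpha>. (cmod (f \<alpha>))\<^sup>2 / two_N \<alpha> ^ k"
  define S where "S = infsum ?g UNIV"
  have "cmod (f \<alpha>) \<le> (1 + S) * two_N \<alpha> ^ k" for \<alpha>
  proof -
    have nn: "\<And>\<alpha>. 0 \<le> ?g \<alpha>" using two_N_pos by (simp add: less_imp_le)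
    have S0: "S \<ge> 0" unfolding S_def by (rule infsum_nonneg) (use nn in auto)
    have t: "two_N \<alpha> ^ k \<ge> 1" using two_N_ge_1 by (rule one_le_power)
    have "infsum ?g {\<alpha>} \<le> S"
      unfolding S_def by (rule infsum_mono_neutral) (use assms nn in \<open>auto simp: in_hspace_def\<close>)
    hence "?g \<alpha> \<le> S" by simp
    hence "(cmod (f \<alpha>))\<^sup>2 \<le> S * two_N \<alpha> ^ k" using t by (simp add: divide_simps)
    also have "\<dots> \<le> ((1 + S) * two_N \<alpha> ^ k)\<^sup>2"
    proof -
      have "S * two_N \<alpha> ^ k \<le> (1 + S)\<^sup>2 * two_N \<alpha> ^ k"
        using t S0 by (intro mult_right_mono) (auto simp: power2_eq_square algebra_simps)
      also have "\<dots> \<le> (1 + S)\<^sup>2 * (two_N \<alpha> ^ k)\<^sup>2"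
        using t by (intro mult_left_mono) (auto simp: power2_eq_square)
      finally show ?thesis by (simp add: power_mult_distrib)
    qed
    finally show ?thesis
      using S0 t by (auto intro: power2_le_imp_le)
  qed
  thus ?thesis by blast
qed

lemma in_hspace_of_bound:
  assumes "\<And>\<alpha>. cmod (f \<alpha>) \<le> C * two_N \<alpha> ^ k"
  shows "in_hspace (2 * k + 2) f"
  unfolding in_hspace_def
proof (rule summable_on_comparison_test)
  show "(\<lambda>\<alpha>. C\<^sup>2 * (1 / (two_N \<alpha>)\<^sup>2)) summable_on UNIV"
    by (intro summable_on_cmult_right summable_two_N)
  fix \<alpha>
  have "(cmod (f \<alpha>))\<^sup>2 \<le> (C * two_N \<alpha> ^ k)\<^sup>2" by (intro power_mono assms) auto
  hence "(cmod (f \<alpha>))\<^sup>2 / two_N \<alpha> ^ (2 * k + 2) \<le> (C * two_N \<alpha> ^ k)\<^sup>2 / two_N \<alpha> ^ (2 * k + 2)"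
    by (intro divide_right_mono) auto
  also have "\<dots> = C\<^sup>2 * (1 / (two_N \<alpha>)\<^sup>2)"
  proof -
    have "two_N \<alpha> ^ (2 * k + 2) = (two_N \<alpha> ^ k)\<^sup>2 * (two_N \<alpha>)\<^sup>2"
      by (simp only: power_add power_mult [symmetric] mult.commute[of k 2])
    thus ?thesis using two_N_pos[of \<alpha>] by (simp add: power_mult_distrib)
  qed
  finally show "(cmod (f \<alpha>))\<^sup>2 / two_N \<alpha> ^ (2 * k + 2) \<le> C\<^sup>2 * (1 / (two_N \<alpha>)\<^sup>2)" .
qed auto

lemma ex_in_hspace_iff:
  "(\<exists>k\<ge>1. in_hspace k f) \<longleftrightarrow> (\<exists>C k. \<forall>\<alpha>. cmod (f \<alpha>) \<le> C * two_N \<alpha> ^ k)"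
proof
  assume "\<exists>C k. \<forall>\<alpha>. cmod (f \<alpha>) \<le> C * two_N \<alpha> ^ k"
  then obtain C k where "\<And>\<alpha>. cmod (f \<alpha>) \<le> C * two_N \<alpha> ^ k" by blast
  hence "in_hspace (2 * k + 2) f" by (rule in_hspace_of_bound)
  thus "\<exists>k\<ge>1. in_hspace k f" by (intro exI[of _ "2 * k + 2"]) auto
qed (use in_hspace_bound in blast)

text \<open>The ring $\mathfrak R$, the union of the spaces $\mathcal H_k'$ over $k \geq 1$.\<close>

typedef kondratiev = "{f :: (nat \<Rightarrow>\<^sub>0 nat) \<Rightarrow> complex. \<exists>k\<ge>1. in_hspace k f}"
  morphisms kcoeff Abs_kondratiev
  by (intro exI[of _ "\<lambda>_. 0"]) (auto simp: in_hspace_def)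

setup_lifting type_definition_kondratiev

lemma kondratiev_eqI: "(\<And>\<alpha>. kcoeff F \<alpha> = kcoeff G \<alpha>) \<Longrightarrow> F = G"
  by (simp add: kcoeff_inject [symmetric] fun_eq_iff)

lemma bound_add:
  assumes "\<exists>k\<ge>1. in_hspace k f" "\<exists>k\<ge>1. in_hspace k g"
  shows "\<exists>k\<ge>1. in_hspace k (\<lambda>\<alpha>. f \<alpha> + g \<alpha>)"
proof -
  from assms obtain C k D l where f: "\<And>\<alpha>. cmod (f \<alpha>) \<le> C * two_N \<alpha> ^ k"
    and g: "\<And>\<alpha>. cmod (g \<alpha>) \<le> D * two_N \<alpha> ^ l"
    unfolding ex_in_hspace_iff by blast
  have "cmod (f \<alpha> + g \<alpha>) \<le> (\<bar>C\<bar> + \<bar>D\<bar>) * two_N \<alpha> ^ (k + l)" for \<alpha>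
  proof -
    have *: "two_N \<alpha> ^ k \<le> two_N \<alpha> ^ (k + l)" "two_N \<alpha> ^ l \<le> two_N \<alpha> ^ (k + l)"
      using two_N_ge_1 by (auto intro: power_increasing)
    have "C * two_N \<alpha> ^ k \<le> \<bar>C\<bar> * two_N \<alpha> ^ (k + l)"
      by (intro mult_mono *) auto
    moreover have "D * two_N \<alpha> ^ l \<le> \<bar>D\<bar> * two_N \<alpha> ^ (k + l)"
      by (intro mult_mono *) auto
    ultimately show ?thesis
      using norm_triangle_ineq[of "f \<alpha>" "g \<alpha>"] f[of \<alpha>] g[of \<alpha>] by (simp add: ring_distribs)
  qed
  thus ?thesis unfolding ex_in_hspace_iff by blast
qed

lemma bound_mult:
  assumes "\<exists>k\<ge>1. in_hspace k f" "\<exists>k\<ge>1. in_hspace k g"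
  shows "\<exists>k\<ge>1. in_hspace k (\<lambda>\<alpha>. \<Sum>(\<beta>, \<gamma>) | \<beta> + \<gamma> = \<alpha>. f \<beta> * g \<gamma>)"
proof -
  from assms obtain C k D l where f: "\<And>\<alpha>. cmod (f \<alpha>) \<le> C * two_N \<alpha> ^ k"
    and g: "\<And>\<alpha>. cmod (g \<alpha>) \<le> D * two_N \<alpha> ^ l"
    unfolding ex_in_hspace_iff by blast
  have "cmod (\<Sum>(\<beta>, \<gamma>) | \<beta> + \<gamma> = \<alpha>. f \<beta> * g \<gamma>) \<le> \<bar>C\<bar> * \<bar>D\<bar> * two_N \<alpha> ^ (k + l + 1)" for \<alpha>
  proof -
    let ?B = "\<bar>C\<bar> * \<bar>D\<bar> * two_N \<alpha> ^ (k + l)"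
    have B: "?B \<ge> 0" using two_N_pos[of \<alpha>] by simp
    have "cmod (\<Sum>(\<beta>, \<gamma>) | \<beta> + \<gamma> = \<alpha>. f \<beta> * g \<gamma>) \<le>
          of_nat (card {(\<beta>, \<gamma>). \<beta> + \<gamma> = \<alpha>}) * ?B"
    proof (rule sum_norm_bound, clarify)
      fix \<beta> \<gamma> assume \<alpha>: "\<alpha> = \<beta> + \<gamma>"
      have le: "two_N \<beta> \<le> two_N (\<beta> + \<gamma>)" "two_N \<gamma> \<le> two_N (\<beta> + \<gamma>)"
        using two_N_ge_1[of \<beta>] two_N_ge_1[of \<gamma>] by (auto simp: two_N_add)
      have 1: "cmod (f \<beta>) \<le> \<bar>C\<bar> * two_N (\<beta> + \<gamma>) ^ k"
      proof -
        have "C * two_N \<beta> ^ k \<le> \<bar>C\<bar> * two_N (\<beta> + \<gamma>) ^ k"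
          by (intro mult_mono power_mono le) auto
        thus ?thesis using f[of \<beta>] by linarith
      qed
      have 2: "cmod (g \<gamma>) \<le> \<bar>D\<bar> * two_N (\<beta> + \<gamma>) ^ l"
      proof -
        have "D * two_N \<gamma> ^ l \<le> \<bar>D\<bar> * two_N (\<beta> + \<gamma>) ^ l"
          by (intro mult_mono power_mono le) auto
        thus ?thesis using g[of \<gamma>] by linarith
      qed
      have "cmod (f \<beta> * g \<gamma>) \<le> (\<bar>C\<bar> * two_N (\<beta> + \<gamma>) ^ k) * (\<bar>D\<bar> * two_N (\<beta> + \<gamma>) ^ l)"
        unfolding norm_mult by (intro mult_mono 1 2) auto
      thus "cmod (f \<beta> * g \<gamma>) \<le> \<bar>C\<bar> * \<bar>D\<bar> * two_N (\<beta> + \<gamma>) ^ (k + l)"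
        by (simp add: power_add mult_ac)
    qed
    also have "\<dots> \<le> two_N \<alpha> * ?B"
      by (intro mult_right_mono card_add_pairs B)
    finally show ?thesis by (simp add: mult_ac)
  qed
  thus ?thesis unfolding ex_in_hspace_iff by blast
qed

lemma bound_scale:
  assumes "\<exists>k\<ge>1. in_hspace k f" "\<And>\<alpha>. cmod (g \<alpha>) \<le> c * cmod (f \<alpha>)"
  shows "\<exists>k\<ge>1. in_hspace k g"
proof -
  from assms(1) obtain C k where f: "\<And>\<alpha>. cmod (f \<alpha>) \<le> C * two_N \<alpha> ^ k"
    unfolding ex_in_hspace_iff by blast
  have "cmod (g \<alpha>) \<le> (\<bar>c\<bar> * C) * two_N \<alpha> ^ k" for \<alpha>
  proof -
    have "cmod (g \<alpha>) \<le> \<bar>c\<bar> * cmod (f \<alpha>)"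
      by (rule order_trans[OF assms(2)]) (auto intro: mult_right_mono)
    also have "\<dots> \<le> \<bar>c\<bar> * (C * two_N \<alpha> ^ k)"
      by (intro mult_left_mono f) auto
    finally show ?thesis by (simp add: mult_ac)
  qed
  thus ?thesis unfolding ex_in_hspace_iff by blast
qed

lemma bound_const: "\<exists>k\<ge>1. in_hspace k (\<lambda>\<alpha>. if \<alpha> = 0 then c else 0)"
  unfolding ex_in_hspace_iff by (rule exI[of _ "cmod c"], rule exI[of _ 0]) auto

lift_definition kconst :: "complex \<Rightarrow> kondratiev" is "\<lambda>c \<alpha>. if \<alpha> = 0 then c else 0"
  by (rule bound_const)

lift_definition kstar :: "kondratiev \<Rightarrow> kondratiev" is "\<lambda>f \<alpha>. cnj (f \<alpha>)"
  by (rule bound_scale[where c = 1]) auto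

definition const_term :: "kondratiev \<Rightarrow> complex" where
  "const_term F = kcoeff F 0"

instantiation kondratiev :: comm_ring_1
begin

lift_definition zero_kondratiev :: kondratiev is "\<lambda>_. 0"
  using bound_const[of 0] by simp

lift_definition one_kondratiev :: kondratiev is "\<lambda>\<alpha>. if \<alpha> = 0 then 1 else 0"
  by (rule bound_const)

lift_definition plus_kondratiev :: "kondratiev \<Rightarrow> kondratiev \<Rightarrow> kondratiev" is
  "\<lambda>f g \<alpha>. f \<alpha> + g \<alpha>"
  by (rule bound_add)

lift_definition uminus_kondratiev :: "kondratiev \<Rightarrow> kondratiev" is "\<lambda>f \<alpha>. - f \<alpha>"
  by (rule bound_scale[where c = 1]) auto

lift_definition minus_kondratiev :: "kondratiev \<Rightarrow> kondratiev \<Rightarrow> kondratiev" is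
  "\<lambda>f g \<alpha>. f \<alpha> - g \<alpha>"
proof -
  fix f g :: "(nat \<Rightarrow>\<^sub>0 nat) \<Rightarrow> complex"
  assume f: "\<exists>k\<ge>1. in_hspace k f" and g: "\<exists>k\<ge>1. in_hspace k g"
  have "\<exists>k\<ge>1. in_hspace k (\<lambda>\<alpha>. - g \<alpha>)"
    using g by (rule bound_scale[where c = 1]) auto
  from bound_add[OF f this] show "\<exists>k\<ge>1. in_hspace k (\<lambda>\<alpha>. f \<alpha> - g \<alpha>)" by simp
qed

lift_definition times_kondratiev :: "kondratiev \<Rightarrow> kondratiev \<Rightarrow> kondratiev" is
  "\<lambda>f g \<alpha>. \<Sum>(\<beta>, \<gamma>) | \<beta> + \<gamma> = \<alpha>. f \<beta> * g \<gamma>"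
  by (rule bound_mult)

instance
proof
  fix F G H :: kondratiev
  show "F * G * H = F * (G * H)"
  proof (rule kondratiev_eqI)
    fix \<alpha>
    let ?f = "kcoeff F" and ?g = "kcoeff G" and ?h = "kcoeff H"
    let ?S = "\<lambda>\<alpha> :: nat \<Rightarrow>\<^sub>0 nat. {(\<beta>, \<gamma>). \<beta> + \<gamma> = \<alpha>}"
    have "kcoeff (F * G * H) \<alpha> =
          (\<Sum>p\<in>?S \<alpha>. \<Sum>q\<in>?S (fst p). ?f (fst q) * ?g (snd q) * ?h (snd p))"
      by (simp add: times_kondratiev.rep_eq sum_distrib_right case_prod_beta)
    also have "\<dots> = (\<Sum>(p, q)\<in>Sigma (?S \<alpha>) (\<lambda>p. ?S (fst p)). ?f (fst q) * ?g (snd q) * ?h (snd p))"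
      by (rule sum.Sigma) (auto simp: finite_add_pairs)
    also have "\<dots> = (\<Sum>(p, q)\<in>Sigma (?S \<alpha>) (\<lambda>p. ?S (snd p)). ?f (fst p) * (?g (fst q) * ?h (snd q)))"
      by (rule sum.reindex_bij_witness[of _
          "\<lambda>((a, b), (c, d)). ((a + c, d), (a, c))" "\<lambda>((a, b), (c, d)). ((c, d + b), (d, b))"])
         (auto simp: add.assoc mult.assoc)
    also have "\<dots> = (\<Sum>p\<in>?S \<alpha>. \<Sum>q\<in>?S (snd p). ?f (fst p) * (?g (fst q) * ?h (snd q)))"
      by (rule sum.Sigma [symmetric]) (auto simp: finite_add_pairs)
    also have "\<dots> = kcoeff (F * (G * H)) \<alpha>"
      by (simp add: times_kondratiev.rep_eq sum_distrib_left case_prod_beta)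
    finally show "kcoeff (F * G * H) \<alpha> = kcoeff (F * (G * H)) \<alpha>" .
  qed
  show "F * G = G * F"
  proof (rule kondratiev_eqI)
    fix \<alpha>
    show "kcoeff (F * G) \<alpha> = kcoeff (G * F) \<alpha>"
      unfolding times_kondratiev.rep_eq
      by (rule sum.reindex_bij_witness[of _ "\<lambda>(a, b). (b, a)" "\<lambda>(a, b). (b, a)"])
         (auto simp: add.commute mult.commute)
  qed
  show "1 * F = F"
  proof (rule kondratiev_eqI)
    fix \<alpha>
    have "kcoeff (1 * F) \<alpha> =
          (\<Sum>p | fst p + snd p = \<alpha>. (if fst p = 0 then 1 else 0) * kcoeff F (snd p))"
      by (simp add: times_kondratiev.rep_eq one_kondratiev.rep_eq case_prod_unfold)
    also have "\<dots> = (\<Sum>p\<in>{(0 :: nat \<Rightarrow>\<^sub>0 nat, \<alpha>)}. (if fst p = 0 then 1 else 0) * kcoeff F (snd p))"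
      by (rule sum.mono_neutral_right) (use finite_add_pairs[of \<alpha>] in \<open>auto simp: case_prod_unfold\<close>)
    finally show "kcoeff (1 * F) \<alpha> = kcoeff F \<alpha>" by simp
  qed
  show "(F + G) * H = F * H + G * H"
    by (rule kondratiev_eqI)
       (simp add: times_kondratiev.rep_eq plus_kondratiev.rep_eq case_prod_beta ring_distribs sum.distrib)
  show "(0::kondratiev) \<noteq> 1"
    by transfer (auto simp: fun_eq_iff)
  show "F + G + H = F + (G + H)" "F + G = G + F" "0 + F = F" "- F + F = 0" "F - G = F + - G"
    by (rule kondratiev_eqI; simp add: plus_kondratiev.rep_eq uminus_kondratiev.rep_eq
        minus_kondratiev.rep_eq zero_kondratiev.rep_eq)+
qed

end

instantiation kondratiev :: real_vector
begin

lift_definition scaleR_kondratiev :: "real \<Rightarrow> kondratiev \<Rightarrow> kondratiev" is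
  "\<lambda>c f \<alpha>. c *\<^sub>R f \<alpha>"
  subgoal for c f by (rule bound_scale[where c = "\<bar>c\<bar>"]) auto
  done

instance
  by standard (transfer; auto simp: fun_eq_iff algebra_simps)+

end

text \<open>The inverse in $\mathfrak R$, with value 0 on non-invertible elements.\<close>

instantiation kondratiev :: inverse
begin

definition inverse_kondratiev :: "kondratiev \<Rightarrow> kondratiev" where
  "inverse_kondratiev F = (if F dvd 1 then THE G. F * G = 1 else 0)"

definition divide_kondratiev :: "kondratiev \<Rightarrow> kondratiev \<Rightarrow> kondratiev" where
  "divide_kondratiev F G = F * inverse G"

instance ..

end


section \<open>Topology and analytic functions\<close>

definition hspace :: "nat \<Rightarrow> kondratiev set" where
  "hspace k = {F. in_hspace k (kcoeff F)}"

definition hnorm :: "nat \<Rightarrow> kondratiev \<Rightarrow> real" where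
  "hnorm k F = sqrt (\<Sum>\<^sub>\<infinity>\<alpha>. (cmod (kcoeff F \<alpha>))\<^sup>2 / two_N \<alpha> ^ k)"

text \<open>The locally convex inductive limit topology: a base of neighbourhoods of 0 is given by the
  convex sets whose intersection with each $\mathcal H_k'$ is a neighbourhood of 0 there.\<close>

definition basic_nhd0 :: "kondratiev set \<Rightarrow> bool" where
  "basic_nhd0 V \<longleftrightarrow> convex V \<and> (\<forall>k\<ge>1. \<exists>e>0. {G \<in> hspace k. hnorm k G < e} \<subseteq> V)"

lemma basic_nhd0_UNIV: "basic_nhd0 UNIV"
  by (auto simp: basic_nhd0_def intro: exI[of _ 1])

lemma basic_nhd0_Int:
  assumes "basic_nhd0 V" "basic_nhd0 W"
  shows "basic_nhd0 (V \<inter> W)"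
  unfolding basic_nhd0_def
proof (intro conjI allI impI)
  show "convex (V \<inter> W)" using assms by (auto simp: basic_nhd0_def intro: convex_Int)
  fix k :: nat assume k: "k \<ge> 1"
  obtain d where d: "d > 0" "{G \<in> hspace k. hnorm k G < d} \<subseteq> V"
    using assms(1) k unfolding basic_nhd0_def by meson
  obtain e where e: "e > 0" "{G \<in> hspace k. hnorm k G < e} \<subseteq> W"
    using assms(2) k unfolding basic_nhd0_def by meson
  from d e show "\<exists>e>0. {G \<in> hspace k. hnorm k G < e} \<subseteq> V \<inter> W"
    by (intro exI[of _ "min d e"]) auto
qed

instantiation kondratiev :: topological_space
begin

definition open_kondratiev :: "kondratiev set \<Rightarrow> bool" where
  "open_kondratiev U \<longleftrightarrow> (\<forall>F\<in>U. \<exists>V. basic_nhd0 V \<and> (+) F ` V \<subseteq> U)"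

instance
proof
  show "open (UNIV :: kondratiev set)"
    using basic_nhd0_UNIV by (auto simp: open_kondratiev_def)
next
  fix S T :: "kondratiev set" assume S: "open S" and T: "open T"
  show "open (S \<inter> T)"
    unfolding open_kondratiev_def
  proof
    fix F assume F: "F \<in> S \<inter> T"
    obtain V where V: "basic_nhd0 V" "(+) F ` V \<subseteq> S"
      using S F unfolding open_kondratiev_def by blast
    obtain W where W: "basic_nhd0 W" "(+) F ` W \<subseteq> T"
      using T F unfolding open_kondratiev_def by blast
    show "\<exists>V. basic_nhd0 V \<and> (+) F ` V \<subseteq> S \<inter> T"
      using V W by (intro exI[of _ "V \<inter> W"]) (auto intro: basic_nhd0_Int)
  qed
next
  fix K :: "kondratiev set set" assume "\<forall>S\<in>K. open S"
  thus "open (\<Union>K)"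
    unfolding open_kondratiev_def by (meson Union_iff Union_upper order_trans)
qed

end

definition sums_in_hspace :: "nat \<Rightarrow> (nat \<Rightarrow> kondratiev) \<Rightarrow> kondratiev \<Rightarrow> bool" where
  "sums_in_hspace p x s \<longleftrightarrow>
     (\<forall>m. x m \<in> hspace p) \<and> s \<in> hspace p \<and> (\<lambda>N. hnorm p (s - (\<Sum>m<N. x m))) \<longlonglongrightarrow> 0"

definition has_taylor :: "(complex \<Rightarrow> kondratiev) \<Rightarrow> complex \<Rightarrow> (nat \<Rightarrow> kondratiev) \<Rightarrow> bool" where
  "has_taylor f w c \<longleftrightarrow>
     (\<exists>p\<ge>1. (\<forall>m. c m \<in> hspace p) \<and>
       (\<exists>\<rho>>0. \<forall>\<zeta>\<in>ball w \<rho>. sums_in_hspace p (\<lambda>m. c m * kconst (\<zeta> - w) ^ m) (f \<zeta>)))"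

definition kanalytic_on :: "(complex \<Rightarrow> kondratiev) \<Rightarrow> complex set \<Rightarrow> bool" where
  "kanalytic_on f \<Omega> \<longleftrightarrow> continuous_on \<Omega> f \<and> (\<forall>w\<in>\<Omega>. \<exists>c. has_taylor f w c)"

definition taylor_coeffs :: "(complex \<Rightarrow> kondratiev) \<Rightarrow> complex \<Rightarrow> nat \<Rightarrow> kondratiev" where
  "taylor_coeffs f w = (THE c. has_taylor f w c)"

definition kevaluate :: "(complex \<Rightarrow> kondratiev) \<Rightarrow> kondratiev \<Rightarrow> kondratiev" where
  "kevaluate f r =
     (THE s. \<exists>q\<ge>1. sums_in_hspace q
        (\<lambda>m. taylor_coeffs f (const_term r) m * (r - kconst (const_term r)) ^ m) s)"


section \<open>Schur functions, matrices and linear fractional transformations\<close>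

definition schur_function :: "(complex \<Rightarrow> complex) \<Rightarrow> bool" where
  "schur_function f \<longleftrightarrow> f analytic_on ball 0 1 \<and> (\<forall>z\<in>ball 0 1. cmod (f z) \<le> 1)"

text \<open>Functions on the disk are represented as functions on the complex plane that are
  \<open>extensional\<close> on the disk, so that equality of functions means equality on the disk.\<close>

definition kschur :: "(complex \<Rightarrow> kondratiev) set" where
  "kschur = {f \<in> extensional (ball 0 1).
     kanalytic_on f (ball 0 1) \<and> schur_function (\<lambda>z. const_term (f z))}"

definition kadjoint :: "kondratiev ^ 'n ^ 'm \<Rightarrow> kondratiev ^ 'm ^ 'n" where
  "kadjoint M = (\<chi> i j. kstar (M $ j $ i))"

definition strictly_positive :: "kondratiev ^ 'n ^ 'n \<Rightarrow> bool" where
  "strictly_positive M \<longleftrightarrow> (\<exists>G :: kondratiev ^ 'n ^ 'n. invertible G \<and> M = G ** kadjoint G)"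

definition lft :: "(complex \<Rightarrow> kondratiev ^ 2 ^ 2) \<Rightarrow> (complex \<Rightarrow> kondratiev) \<Rightarrow> complex \<Rightarrow> kondratiev" where
  "lft \<Theta> g = (\<lambda>z\<in>ball 0 1.
     (\<Theta> z $ 1 $ 1 * g z + \<Theta> z $ 1 $ 2) * inverse (\<Theta> z $ 2 $ 1 * g z + \<Theta> z $ 2 $ 2))"

end

theory Submission
  imports Defs "HOL-Complex_Analysis.Cauchy_Integral_Formula"
begin

text \<open>A function into the ring is analytic iff its coefficients are holomorphic and locally bounded by
  \<open>M * two_N \<alpha> ^ k\<close>, and \<open>f(r) = b\<close> holds iff \<open>f(z) - b = (z - r) q(z)\<close> with \<open>q\<close> analytic near the
  constant term of \<open>r\<close>. An element of the ring is a unit iff its constant term is non-zero, so all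
  size conditions and non-vanishing statements live at the level of constant terms, where they form a
  classical Nevanlinna-Pick problem with positive definite Pick matrix.

  For a row vector \<open>(p, q)\<close> put \<open>m = (p, q) C (I - z A)\<^sup>-\<^sup>1\<close> and \<open>u = m P\<^sup>-\<^sup>1\<close>. The entries of
  \<open>(p, q) \<Theta>(z)\<close> satisfy \<open>|r\<^sub>1|\<^sup>2 - |r\<^sub>2|\<^sup>2 = |p|\<^sup>2 - |q|\<^sup>2 - (1 - |z|\<^sup>2) u P u\<^sup>*\<close>. With \<open>(0, 1)\<close> this
  makes the denominator of the linear fractional transformation a unit, with \<open>(1, - f)\<close> it shows that
  \<open>f\<close> is bounded by 1 if \<open>g\<close> is. Conversely Pick's inequality at the nodes and \<open>z\<close> is exactly
  \<open>|r\<^sub>2| \<le> |r\<^sub>1|\<close> for \<open>(1, - f)\<close>, so that \<open>g = - r\<^sub>2 / r\<^sub>1\<close> is bounded by 1. The interpolation conditions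
  correspond to the factor \<open>z - a i\<close> of the row \<open>(1, - b i) \<Theta>(z)\<close>, and for \<open>(1, - f)\<close> this factor cancels in \<open>g\<close>.\<close>

section \<open>Coefficients and inverses\<close>

text \<open>The ring is an inductive limit without a norm of its own, and evaluation substitutes an
  element that is not a number. One estimate deals with both: in the weight
  \<open>two_N \<alpha> ^ s\<close>, multiplication by an element with constant term 0 has
  arbitrarily small norm once \<open>s\<close> is large. This bounds inverses and makes the powers
  of \<open>r - kconst (const_term r)\<close> decay faster than Cauchy bounds of Taylor coefficients
  grow. One exponent must serve for all \<open>z\<close> near a point, so the basic estimates hold
  uniformly over all elements obeying a given bound.

  The nodes are the other obstacle. There both entries of the row \<open>(1, - f) \<Theta>\<close>
  have constant term 0, so \<open>g\<close> cannot be read off pointwise. Since \<open>a i\<close>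
  is not a scalar, the factor \<open>kconst z - a i\<close> has to be divided out in the ring before
  constant terms are compared. The scalar bound for \<open>g\<close> then reaches the finitely many
  nodes by continuity.

  The shape of \<open>\<Theta>\<close> is a normalisation at the boundary point 1, where the formula
  gives the identity matrix; this is the origin of the factors \<open>1 - z\<close> and
  \<open>1 - a i\<close>.\<close>

lemma kcoeff_simps [simp]:
  "kcoeff 0 \<alpha> = 0"
  "kcoeff (F + G) \<alpha> = kcoeff F \<alpha> + kcoeff G \<alpha>"
  "kcoeff (F - G) \<alpha> = kcoeff F \<alpha> - kcoeff G \<alpha>"
  "kcoeff (- F) \<alpha> = - kcoeff F \<alpha>"
  "kcoeff (kstar F) \<alpha> = cnj (kcoeff F \<alpha>)"
  by (simp_all add: zero_kondratiev.rep_eq plus_kondratiev.rep_eq minus_kondratiev.rep_eq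
      uminus_kondratiev.rep_eq kstar.rep_eq)

lemma kcoeff_one: "kcoeff 1 \<alpha> = (if \<alpha> = 0 then 1 else 0)"
  by (simp add: one_kondratiev.rep_eq)

lemma kcoeff_kconst: "kcoeff (kconst c) \<alpha> = (if \<alpha> = 0 then c else 0)"
  by (simp add: kconst.rep_eq)

lemma kcoeff_sum [simp]: "kcoeff (\<Sum>i\<in>I. F i) \<alpha> = (\<Sum>i\<in>I. kcoeff (F i) \<alpha>)"
  by (induction I rule: infinite_finite_induct) auto

text \<open>The pairs of the Cauchy product other than \<open>(0, \<alpha>)\<close>. Their second
  index has smaller weight than \<open>\<alpha>\<close>, so the tail can be treated by recursion and
  induction on multi-indices.\<close>

definition tail_pairs :: "(nat \<Rightarrow>\<^sub>0 nat) \<Rightarrow> ((nat \<Rightarrow>\<^sub>0 nat) \<times> (nat \<Rightarrow>\<^sub>0 nat)) set" where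
  "tail_pairs \<alpha> = {(\<beta>, \<gamma>). \<beta> + \<gamma> = \<alpha> \<and> \<beta> \<noteq> 0}"

lemma finite_tail_pairs [simp]: "finite (tail_pairs \<alpha>)"
  unfolding tail_pairs_def by (rule finite_subset[OF _ finite_add_pairs[of \<alpha>]]) auto

lemma add_eq_0_poly_mapping: "\<beta> + \<gamma> = (0 :: nat \<Rightarrow>\<^sub>0 nat) \<longleftrightarrow> \<beta> = 0 \<and> \<gamma> = 0"
proof
  assume *: "\<beta> + \<gamma> = 0"
  have "Poly_Mapping.lookup \<beta> j + Poly_Mapping.lookup \<gamma> j = 0" for j
    using arg_cong[OF *, of "\<lambda>x. Poly_Mapping.lookup x j"] by (simp add: lookup_add)
  thus "\<beta> = 0 \<and> \<gamma> = 0" by (auto intro!: poly_mapping_eqI)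
qed auto

lemma tail_pairs_0 [simp]: "tail_pairs 0 = {}"
  by (auto simp: tail_pairs_def add_eq_0_poly_mapping)

lemma kcoeff_mult:
  "kcoeff (F * G) \<alpha> = kcoeff F 0 * kcoeff G \<alpha> + (\<Sum>p\<in>tail_pairs \<alpha>. kcoeff F (fst p) * kcoeff G (snd p))"
proof -
  have eq: "{(\<beta>, \<gamma>). \<beta> + \<gamma> = \<alpha>} = insert (0, \<alpha>) (tail_pairs \<alpha>)"
    by (auto simp: tail_pairs_def)
  show ?thesis
    unfolding times_kondratiev.rep_eq eq
    by (subst sum.insert) (simp_all, auto simp: tail_pairs_def case_prod_beta)
qed

lemma kcoeff_kconst_mult [simp]: "kcoeff (kconst c * F) \<alpha> = c * kcoeff F \<alpha>"
proof -
  have "(\<Sum>p\<in>tail_pairs \<alpha>. kcoeff (kconst c) (fst p) * kcoeff F (snd p)) = 0"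
    by (rule sum.neutral) (auto simp: tail_pairs_def kcoeff_kconst)
  thus ?thesis by (simp add: kcoeff_mult kcoeff_kconst)
qed

lemma kconst_0 [simp]: "kconst 0 = 0"
  and kconst_1 [simp]: "kconst 1 = 1"
  and kconst_diff: "kconst (x - y) = kconst x - kconst y"
  and kconst_mult: "kconst (x * y) = kconst x * kconst y"
  by (rule kondratiev_eqI; simp add: kcoeff_kconst kcoeff_one)+

lemma kconst_power: "kconst x ^ m = kconst (x ^ m)"
  by (induction m) (auto simp: kconst_mult)

lemma const_term_simps [simp]:
  "const_term 0 = 0"
  "const_term 1 = 1"
  "const_term (F + G) = const_term F + const_term G"
  "const_term (F - G) = const_term F - const_term G"
  "const_term (- F) = - const_term F"
  "const_term (kconst c) = c"
  "const_term (kstar F) = cnj (const_term F)"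
  "const_term (\<Sum>i\<in>I. H i) = (\<Sum>i\<in>I. const_term (H i))"
  by (simp_all add: const_term_def kcoeff_one kcoeff_kconst)

lemma const_term_mult [simp]: "const_term (F * G) = const_term F * const_term G"
  by (simp add: const_term_def kcoeff_mult)

lemma kstar_mult: "kstar (F * G) = kstar F * kstar G"
  by (rule kondratiev_eqI) (simp add: kcoeff_mult)

lemma kstar_sum: "kstar (\<Sum>i\<in>I. F i) = (\<Sum>i\<in>I. kstar (F i))"
  by (rule kondratiev_eqI) simp

lemma kstar_kstar [simp]: "kstar (kstar F) = F"
  and kstar_1 [simp]: "kstar 1 = 1"
  and kstar_0 [simp]: "kstar 0 = 0"
  by (rule kondratiev_eqI; simp add: kcoeff_one)+

text \<open>A supremum bound in place of \<open>hnorm\<close>. The union over \<open>k\<close> is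
  the same ring, and passing between the two only enlarges the exponent, but products, inverses and
  Cauchy estimates act directly on such bounds.\<close>

definition coeff_bound :: "real \<Rightarrow> nat \<Rightarrow> kondratiev \<Rightarrow> bool" where
  "coeff_bound M k F \<longleftrightarrow> (\<forall>\<alpha>. cmod (kcoeff F \<alpha>) \<le> M * two_N \<alpha> ^ k)"

lemma coeff_bound_exists: "\<exists>M k. coeff_bound M k F"
  using kcoeff[of F] unfolding ex_in_hspace_iff coeff_bound_def by auto

lemma coeff_boundD: "coeff_bound M k F \<Longrightarrow> cmod (kcoeff F \<alpha>) \<le> M * two_N \<alpha> ^ k"
  by (simp add: coeff_bound_def)

lemma coeff_bound_nonneg: "coeff_bound M k F \<Longrightarrow> M \<ge> 0"
  using order_trans[OF norm_ge_zero coeff_boundD[of M k F 0]] by simp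

lemma coeff_bound_mono:
  assumes "coeff_bound M k F" "M \<le> M'" "k \<le> k'"
  shows "coeff_bound M' k' F"
  unfolding coeff_bound_def
proof
  fix \<alpha>
  have "cmod (kcoeff F \<alpha>) \<le> M * two_N \<alpha> ^ k" using assms(1) by (rule coeff_boundD)
  also have "\<dots> \<le> M' * two_N \<alpha> ^ k'"
    using assms coeff_bound_nonneg[OF assms(1)] two_N_ge_1[of \<alpha>]
    by (intro mult_mono power_increasing) auto
  finally show "cmod (kcoeff F \<alpha>) \<le> M' * two_N \<alpha> ^ k'" .
qed

lemma kondratiev_of_bound:
  assumes "\<And>\<alpha>. cmod (f \<alpha>) \<le> M * two_N \<alpha> ^ k"
  obtains F where "kcoeff F = f"
proof -
  have "\<exists>k\<ge>1. in_hspace k f" using assms unfolding ex_in_hspace_iff by blast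
  thus ?thesis using that by (metis (mono_tags, lifting) kcoeff_cases mem_Collect_eq)
qed

lemma two_N_ge_2:
  assumes "\<beta> \<noteq> 0"
  shows "two_N \<beta> \<ge> 2"
proof -
  obtain j where j: "j \<in> Poly_Mapping.keys \<beta>" using assms by (metis ex_in_conv keys_eq_empty)
  let ?f = "\<lambda>j. (2 * real (Suc j)) ^ Poly_Mapping.lookup \<beta> j"
  have "(2::real) ^ 1 \<le> 2 ^ Poly_Mapping.lookup \<beta> j"
    using j by (intro power_increasing) (auto simp: in_keys_iff)
  also have "\<dots> \<le> ?f j" by (intro power_mono) auto
  also have "?f j \<le> (\<Prod>j\<in>Poly_Mapping.keys \<beta>. ?f j)"
  proof -
    have "1 \<le> (\<Prod>j\<in>Poly_Mapping.keys \<beta> - {j}. ?f j)"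
      by (intro prod_ge_1 one_le_power) auto
    hence "?f j * 1 \<le> ?f j * (\<Prod>j\<in>Poly_Mapping.keys \<beta> - {j}. ?f j)"
      by (intro mult_left_mono) auto
    also have "\<dots> = (\<Prod>j\<in>Poly_Mapping.keys \<beta>. ?f j)" using j by (simp add: prod.remove[of _ j])
    finally show ?thesis by simp
  qed
  finally show ?thesis by (simp add: two_N_def)
qed

text \<open>Every non-zero multi-index has weight at least 2, so raising the exponent \<open>s\<close> makes the
  weighted sum over non-zero multi-indices arbitrarily small.\<close>

lemma sum_two_N_small:
  assumes "\<eta> > 0"
  shows "\<exists>s0. \<forall>s\<ge>s0. \<forall>T. finite T \<and> 0 \<notin> T \<longrightarrow> (\<Sum>\<beta>\<in>T. B * two_N \<beta> ^ k / two_N \<beta> ^ s) \<le> \<eta>"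
proof -
  define S where "S = (\<Sum>\<^sub>\<infinity>\<beta>. 1 / (two_N \<beta>)\<^sup>2)"
  have S0: "S \<ge> 0" unfolding S_def by (rule infsum_nonneg) auto
  \<comment> \<open>Of the exponent \<open>k + 2 + j\<close>, the part \<open>k\<close> cancels the
    growth, \<open>2\<close> leaves a summable series with sum \<open>S\<close>, and
    \<open>j\<close> contributes the factor \<open>1 / 2 ^ j\<close> that beats
    \<open>\<bar>B\<bar> * S / \<eta>\<close>.\<close>
  obtain j where j: "\<bar>B\<bar> * S / \<eta> < 2 ^ j" using real_arch_pow[of 2] by auto
  have "(\<Sum>\<beta>\<in>T. B * two_N \<beta> ^ k / two_N \<beta> ^ s) \<le> \<eta>"
    if s: "s \<ge> k + 2 + j" and T: "finite T" "0 \<notin> T" for s T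
  proof -
    have "(\<Sum>\<beta>\<in>T. B * two_N \<beta> ^ k / two_N \<beta> ^ s) \<le> (\<Sum>\<beta>\<in>T. \<bar>B\<bar> / 2 ^ j * (1 / (two_N \<beta>)\<^sup>2))"
    proof (rule sum_mono)
      fix \<beta> assume "\<beta> \<in> T"
      hence 2: "two_N \<beta> \<ge> 2" using T two_N_ge_2[of \<beta>] by metis
      have "two_N \<beta> ^ k * (2 ^ j * (two_N \<beta>)\<^sup>2) \<le> two_N \<beta> ^ k * (two_N \<beta> ^ j * (two_N \<beta>)\<^sup>2)"
        using 2 by (intro mult_left_mono mult_right_mono power_mono) auto
      also have "\<dots> = two_N \<beta> ^ (k + 2 + j)" by (simp only: power_add mult_ac)
      also have "\<dots> \<le> two_N \<beta> ^ s" using 2 s by (intro power_increasing) auto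
      finally have "two_N \<beta> ^ k / two_N \<beta> ^ s \<le> 1 / (2 ^ j * (two_N \<beta>)\<^sup>2)"
        using 2 by (intro frac_le_frac) auto
      hence "\<bar>B\<bar> * (two_N \<beta> ^ k / two_N \<beta> ^ s) \<le> \<bar>B\<bar> * (1 / (2 ^ j * (two_N \<beta>)\<^sup>2))"
        by (intro mult_left_mono) auto
      moreover have "B * (two_N \<beta> ^ k / two_N \<beta> ^ s) \<le> \<bar>B\<bar> * (two_N \<beta> ^ k / two_N \<beta> ^ s)"
        using 2 by (intro mult_right_mono) auto
      ultimately show "B * two_N \<beta> ^ k / two_N \<beta> ^ s \<le> \<bar>B\<bar> / 2 ^ j * (1 / (two_N \<beta>)\<^sup>2)" by simp
    qed
    also have "\<dots> = \<bar>B\<bar> / 2 ^ j * (\<Sum>\<beta>\<in>T. 1 / (two_N \<beta>)\<^sup>2)" by (simp only: sum_distrib_left)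
    also have "\<dots> \<le> \<bar>B\<bar> / 2 ^ j * S"
    proof (rule mult_left_mono)
      show "(\<Sum>\<beta>\<in>T. 1 / (two_N \<beta>)\<^sup>2) \<le> S"
        unfolding S_def by (rule finite_sum_le_infsum) (use T summable_two_N in auto)
    qed auto
    also have "\<dots> \<le> \<eta>" using j assms by (simp add: field_simps)
    finally show ?thesis .
  qed
  thus ?thesis by blast
qed

text \<open>Since \<open>two_N\<close> is multiplicative, convolution with \<open>e\<close> is
  controlled in the weight \<open>two_N \<alpha> ^ s\<close> by the weighted sum of \<open>e\<close>
  over non-zero indices. The exponent \<open>s0\<close> is chosen before \<open>e\<close>,
  \<open>f\<close>, \<open>M\<close> and \<open>\<alpha>\<close>, so it serves whole families;
  \<open>f\<close> is constrained only on the indices that occur, so the estimate can be used inside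
  an induction on \<open>\<alpha>\<close>.\<close>

lemma convolution_small:
  assumes "\<eta> > 0"
  shows "\<exists>s0. \<forall>s\<ge>s0. \<forall>e f M \<alpha>. (\<forall>\<beta>. cmod (e \<beta>) \<le> B * two_N \<beta> ^ k) \<longrightarrow> M \<ge> 0 \<longrightarrow>
     (\<forall>p\<in>tail_pairs \<alpha>. cmod (f (snd p)) \<le> M * two_N (snd p) ^ s) \<longrightarrow>
     cmod (\<Sum>p\<in>tail_pairs \<alpha>. e (fst p) * f (snd p)) \<le> \<eta> * M * two_N \<alpha> ^ s"
proof -
  from sum_two_N_small[OF assms, of B k] obtain s0 where
    s0: "\<And>s T. s \<ge> s0 \<Longrightarrow> finite T \<Longrightarrow> 0 \<notin> T \<Longrightarrow> (\<Sum>\<beta>\<in>T. B * two_N \<beta> ^ k / two_N \<beta> ^ s) \<le> \<eta>"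
    by blast
  have "cmod (\<Sum>p\<in>tail_pairs \<alpha>. e (fst p) * f (snd p)) \<le> \<eta> * M * two_N \<alpha> ^ s"
    if s: "s \<ge> s0" and e: "\<And>\<beta>. cmod (e \<beta>) \<le> B * two_N \<beta> ^ k" and M: "M \<ge> 0"
      and f: "\<And>p. p \<in> tail_pairs \<alpha> \<Longrightarrow> cmod (f (snd p)) \<le> M * two_N (snd p) ^ s"
    for s \<alpha> M and e f :: "(nat \<Rightarrow>\<^sub>0 nat) \<Rightarrow> complex"
  proof -
    have "cmod (\<Sum>p\<in>tail_pairs \<alpha>. e (fst p) * f (snd p)) \<le>
        (\<Sum>p\<in>tail_pairs \<alpha>. (M * two_N \<alpha> ^ s) * (B * two_N (fst p) ^ k / two_N (fst p) ^ s))"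
    proof (rule sum_norm_le)
      fix p assume p: "p \<in> tail_pairs \<alpha>"
      hence \<alpha>: "\<alpha> = fst p + snd p" by (auto simp: tail_pairs_def)
      have "cmod (e (fst p) * f (snd p)) \<le> (B * two_N (fst p) ^ k) * (M * two_N (snd p) ^ s)"
        unfolding norm_mult using order_trans[OF norm_ge_zero e[of "fst p"]]
        by (intro mult_mono e f p) auto
      also have "\<dots> = (M * two_N \<alpha> ^ s) * (B * two_N (fst p) ^ k / two_N (fst p) ^ s)"
        using two_N_pos[of "fst p"] by (simp add: \<alpha> two_N_add power_mult_distrib)
      finally show "cmod (e (fst p) * f (snd p)) \<le>
        (M * two_N \<alpha> ^ s) * (B * two_N (fst p) ^ k / two_N (fst p) ^ s)" .
    qed
    also have "\<dots> = (M * two_N \<alpha> ^ s) * (\<Sum>\<beta>\<in>fst ` tail_pairs \<alpha>. B * two_N \<beta> ^ k / two_N \<beta> ^ s)"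
    proof -
      have "inj_on fst (tail_pairs \<alpha>)" by (auto simp: inj_on_def tail_pairs_def)
      thus ?thesis by (simp add: sum.reindex sum_distrib_left o_def)
    qed
    also have "\<dots> \<le> (M * two_N \<alpha> ^ s) * \<eta>"
      using M s by (intro mult_left_mono s0 finite_imageI finite_tail_pairs) (auto simp: tail_pairs_def)
    finally show ?thesis by (simp add: mult_ac)
  qed
  thus ?thesis by blast
qed

text \<open>Only the tail of the Cauchy product survives. With \<open>\<eta>\<close> half a radius
  of convergence, powers of \<open>E\<close> become summable against Taylor coefficients.\<close>

lemma coeff_bound_mult_small:
  assumes "\<eta> > 0" "const_term E = 0"
  shows "\<exists>s0. \<forall>s\<ge>s0. \<forall>F M. coeff_bound M s F \<longrightarrow> coeff_bound (\<eta> * M) s (E * F)"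
proof -
  obtain B k where E: "coeff_bound B k E" using coeff_bound_exists by blast
  from convolution_small[OF assms(1), of B k] obtain s0 where
    s0: "\<And>s e f M \<alpha>. s \<ge> s0 \<Longrightarrow> \<forall>\<beta>. cmod (e \<beta>) \<le> B * two_N \<beta> ^ k \<Longrightarrow> M \<ge> 0 \<Longrightarrow>
     \<forall>p\<in>tail_pairs \<alpha>. cmod (f (snd p)) \<le> M * two_N (snd p) ^ s \<Longrightarrow>
     cmod (\<Sum>p\<in>tail_pairs \<alpha>. e (fst p) * f (snd p)) \<le> \<eta> * M * two_N \<alpha> ^ s"
    by blast
  have "coeff_bound (\<eta> * M) s (E * F)" if "s \<ge> s0" and F: "coeff_bound M s F" for s F M
    unfolding coeff_bound_def
  proof
    fix \<alpha>
    show "cmod (kcoeff (E * F) \<alpha>) \<le> \<eta> * M * two_N \<alpha> ^ s"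
      using s0[OF that(1), of "kcoeff E" M \<alpha> "kcoeff F"] E F assms(2) coeff_bound_nonneg[OF F]
      by (simp add: kcoeff_mult const_term_def coeff_bound_def)
  qed
  thus ?thesis by blast
qed

text \<open>Splitting off a non-zero index at least halves the weight; as weights are at least 1,
  the integer part drops and serves as a termination measure.\<close>

lemma tail_pairs_less:
  assumes "p \<in> tail_pairs \<alpha>"
  shows "nat \<lfloor>two_N (snd p)\<rfloor> < nat \<lfloor>two_N \<alpha>\<rfloor>"
proof -
  have "\<alpha> = fst p + snd p" "fst p \<noteq> 0" using assms by (auto simp: tail_pairs_def)
  hence "two_N \<alpha> \<ge> 2 * two_N (snd p)"
    using two_N_ge_2[of "fst p"] by (simp add: two_N_add mult_right_mono)
  hence "two_N \<alpha> \<ge> two_N (snd p) + 1" using two_N_ge_1[of "snd p"] by linarith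
  hence "\<lfloor>two_N \<alpha>\<rfloor> \<ge> \<lfloor>two_N (snd p)\<rfloor> + 1" by linarith
  thus ?thesis using two_N_ge_1[of "snd p"] by linarith
qed

lemma multi_index_induct [case_names step]:
  assumes "\<And>\<alpha>. (\<And>p. p \<in> tail_pairs \<alpha> \<Longrightarrow> P (snd p)) \<Longrightarrow> P \<alpha>"
  shows "P \<alpha>"
proof (induction "nat \<lfloor>two_N \<alpha>\<rfloor>" arbitrary: \<alpha> rule: less_induct)
  case less
  thus ?case using assms tail_pairs_less by blast
qed

text \<open>The equation \<open>F * G = 1\<close> read at \<open>\<alpha>\<close> and solved for the
  coefficient of \<open>G\<close>. Unlike the definite description behind \<open>inverse\<close>,
  the recursion transmits bounds and holomorphic dependence on a parameter.\<close>

function inv_coeff :: "((nat \<Rightarrow>\<^sub>0 nat) \<Rightarrow> complex) \<Rightarrow> (nat \<Rightarrow>\<^sub>0 nat) \<Rightarrow> complex" where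
  "inv_coeff f \<alpha> = ((if \<alpha> = 0 then 1 else 0) -
     (\<Sum>p\<in>tail_pairs \<alpha>. f (fst p) * inv_coeff f (snd p))) / f 0"
  by pat_completeness auto
termination
  by (relation "Wellfounded.measure (\<lambda>(f, \<alpha>). nat \<lfloor>two_N \<alpha>\<rfloor>)") (use tail_pairs_less in force)+

declare inv_coeff.simps [simp del]

text \<open>With smallness factor \<open>\<delta>\<close> the tail sum is at most
  \<open>\<delta> * (1 / \<delta>) * two_N \<alpha> ^ s\<close>, so the bound with constant
  \<open>1 / \<delta>\<close> reproduces itself after division by \<open>f 0\<close>.\<close>

lemma inv_coeff_bound:
  assumes "\<delta> > 0"
  shows "\<exists>s. \<forall>f. (\<forall>\<beta>. cmod (f \<beta>) \<le> B * two_N \<beta> ^ k) \<longrightarrow> cmod (f 0) \<ge> \<delta> \<longrightarrow>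
    (\<forall>\<alpha>. cmod (inv_coeff f \<alpha>) \<le> 1 / \<delta> * two_N \<alpha> ^ s)"
proof -
  from convolution_small[OF assms, of B k] obtain s where
    s: "\<And>e f M \<alpha>. \<forall>\<beta>. cmod (e \<beta>) \<le> B * two_N \<beta> ^ k \<Longrightarrow> M \<ge> 0 \<Longrightarrow>
     \<forall>p\<in>tail_pairs \<alpha>. cmod (f (snd p)) \<le> M * two_N (snd p) ^ s \<Longrightarrow>
     cmod (\<Sum>p\<in>tail_pairs \<alpha>. e (fst p) * f (snd p)) \<le> \<delta> * M * two_N \<alpha> ^ s"
    by blast
  have "cmod (inv_coeff f \<alpha>) \<le> 1 / \<delta> * two_N \<alpha> ^ s"
    if f: "\<forall>\<beta>. cmod (f \<beta>) \<le> B * two_N \<beta> ^ k" "cmod (f 0) \<ge> \<delta>" for f \<alpha>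
  proof (induction \<alpha> rule: multi_index_induct)
    case (step \<alpha>)
    have pos: "cmod (f 0) > 0" using f assms by linarith
    have "cmod ((if \<alpha> = 0 then 1 else 0) - (\<Sum>p\<in>tail_pairs \<alpha>. f (fst p) * inv_coeff f (snd p))) \<le> two_N \<alpha> ^ s"
    proof (cases "\<alpha> = 0")
      case False
      have "cmod (\<Sum>p\<in>tail_pairs \<alpha>. f (fst p) * inv_coeff f (snd p)) \<le> \<delta> * (1 / \<delta>) * two_N \<alpha> ^ s"
        by (rule s) (use f step assms in auto)
      thus ?thesis using False assms by simp
    qed simp
    hence "cmod (inv_coeff f \<alpha>) \<le> two_N \<alpha> ^ s / cmod (f 0)"
      using pos by (subst inv_coeff.simps) (simp add: norm_divide divide_right_mono)
    also have "\<dots> \<le> two_N \<alpha> ^ s / \<delta>" using f assms pos by (intro divide_left_mono) auto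
    finally show ?case by simp
  qed
  thus ?thesis by blast
qed

lemma inverse_unique_kondratiev:
  fixes F G :: kondratiev
  assumes "F * G = 1"
  shows "inverse F = G"
proof -
  have "(THE G. F * G = 1) = G"
    using assms by (intro the_equality) (auto, metis mult.assoc mult.commute mult.right_neutral)
  moreover have "F dvd 1" using assms by (metis dvd_triv_left)
  ultimately show ?thesis by (simp add: inverse_kondratiev_def)
qed

lemma kcoeff_inverse:
  assumes "const_term F \<noteq> 0"
  shows "kcoeff (inverse F) = inv_coeff (kcoeff F)" and "F * inverse F = 1"
proof -
  obtain B k where "coeff_bound B k F" using coeff_bound_exists by blast
  moreover have "cmod (kcoeff F 0) > 0" using assms by (simp add: const_term_def)
  ultimately obtain s where
    "\<And>\<alpha>. cmod (inv_coeff (kcoeff F) \<alpha>) \<le> 1 / cmod (kcoeff F 0) * two_N \<alpha> ^ s"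
    using inv_coeff_bound[of "cmod (kcoeff F 0)" B k] unfolding coeff_bound_def by blast
  then obtain G where G: "kcoeff G = inv_coeff (kcoeff F)" by (rule kondratiev_of_bound)
  have "F * G = 1"
  proof (rule kondratiev_eqI)
    fix \<alpha> show "kcoeff (F * G) \<alpha> = kcoeff 1 \<alpha>"
      using assms by (simp add: kcoeff_mult G inv_coeff.simps[of _ \<alpha>] kcoeff_one const_term_def)
  qed
  with inverse_unique_kondratiev[OF this] G
  show "kcoeff (inverse F) = inv_coeff (kcoeff F)" "F * inverse F = 1" by simp_all
qed

lemma unit_iff_const_term: "F dvd 1 \<longleftrightarrow> const_term F \<noteq> 0"
proof
  assume "F dvd 1"
  then obtain G where "1 = F * G" by (auto simp: dvd_def)
  from arg_cong[OF this, of const_term] show "const_term F \<noteq> 0" by auto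
next
  assume "const_term F \<noteq> 0"
  thus "F dvd 1" using kcoeff_inverse(2) by (metis dvd_triv_left)
qed

lemma const_term_inverse: "const_term F \<noteq> 0 \<Longrightarrow> const_term (inverse F) = inverse (const_term F)"
  using arg_cong[OF kcoeff_inverse(2)[of F], of const_term] by (simp add: field_simps)

section \<open>Analytic functions\<close>

lemma coeff_bound_add:
  assumes "coeff_bound M k F" "coeff_bound N k G"
  shows "coeff_bound (M + N) k (F + G)" and "coeff_bound (M + N) k (F - G)"
proof -
  have "cmod (kcoeff F \<alpha>) + cmod (kcoeff G \<alpha>) \<le> (M + N) * two_N \<alpha> ^ k" for \<alpha>
    using coeff_boundD[OF assms(1), of \<alpha>] coeff_boundD[OF assms(2), of \<alpha>] by (simp add: ring_distribs)
  thus "coeff_bound (M + N) k (F + G)" and "coeff_bound (M + N) k (F - G)"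
    unfolding coeff_bound_def kcoeff_simps
    by (blast intro: norm_triangle_le norm_triangle_le_diff)+
qed

text \<open>In the factor \<open>M + 1\<close>, \<open>M\<close> bounds the constant term of
  \<open>F\<close>, and 1 is the smallness factor for which \<open>convolution_small\<close> is
  invoked on the tail.\<close>

lemma coeff_bound_mult:
  "\<exists>s. \<forall>F G. coeff_bound M k F \<longrightarrow> coeff_bound N l G \<longrightarrow> coeff_bound ((M + 1) * N) s (F * G)"
proof -
  from convolution_small[OF zero_less_one, of M k] obtain s0 where
    s0: "\<And>s e f N \<alpha>. s \<ge> s0 \<Longrightarrow> \<forall>\<beta>. cmod (e \<beta>) \<le> M * two_N \<beta> ^ k \<Longrightarrow> N \<ge> 0 \<Longrightarrow>
     \<forall>p\<in>tail_pairs \<alpha>. cmod (f (snd p)) \<le> N * two_N (snd p) ^ s \<Longrightarrow>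
     cmod (\<Sum>p\<in>tail_pairs \<alpha>. e (fst p) * f (snd p)) \<le> N * two_N \<alpha> ^ s"
    unfolding mult_1_left by blast
  have "coeff_bound ((M + 1) * N) (max s0 l) (F * G)" if F: "coeff_bound M k F" and G: "coeff_bound N l G" for F G
    unfolding coeff_bound_def
  proof
    fix \<alpha>
    have G': "coeff_bound N (max s0 l) G" using G by (rule coeff_bound_mono) auto
    have "cmod (kcoeff F 0 * kcoeff G \<alpha>) \<le> M * (N * two_N \<alpha> ^ max s0 l)"
      unfolding norm_mult using coeff_boundD[OF F, of 0] coeff_bound_nonneg[OF F]
      by (intro mult_mono coeff_boundD[OF G']) auto
    moreover have "cmod (\<Sum>p\<in>tail_pairs \<alpha>. kcoeff F (fst p) * kcoeff G (snd p)) \<le> N * two_N \<alpha> ^ max s0 l"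
      by (rule s0) (use F G' coeff_bound_nonneg[OF G] in \<open>auto simp: coeff_bound_def\<close>)
    ultimately show "cmod (kcoeff (F * G) \<alpha>) \<le> (M + 1) * N * two_N \<alpha> ^ max s0 l"
      unfolding kcoeff_mult by (intro norm_triangle_le) (simp add: algebra_simps)
  qed
  thus ?thesis by blast
qed

lemma coeff_bound_inverse:
  assumes "\<delta> > 0"
  shows "\<exists>s. \<forall>F. coeff_bound M k F \<longrightarrow> cmod (const_term F) \<ge> \<delta> \<longrightarrow> coeff_bound (1 / \<delta>) s (inverse F)"
proof -
  from inv_coeff_bound[OF assms, of M k] obtain s where
    s: "\<And>f \<alpha>. (\<forall>\<beta>. cmod (f \<beta>) \<le> M * two_N \<beta> ^ k) \<Longrightarrow> cmod (f 0) \<ge> \<delta> \<Longrightarrow>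
      cmod (inv_coeff f \<alpha>) \<le> 1 / \<delta> * two_N \<alpha> ^ s"
    by blast
  have "coeff_bound (1 / \<delta>) s (inverse F)" if "coeff_bound M k F" "cmod (const_term F) \<ge> \<delta>" for F
  proof -
    have "const_term F \<noteq> 0" using that assms by auto
    thus ?thesis using s[of "kcoeff F"] that
      unfolding coeff_bound_def kcoeff_inverse(1)[OF \<open>const_term F \<noteq> 0\<close>] const_term_def by blast
  qed
  thus ?thesis by blast
qed

text \<open>A local form of analyticity that passes through ring operations without manipulating
  series. The uniformity of \<open>M\<close> and \<open>k\<close> on the disk and over all
  \<open>\<alpha>\<close> is what later puts all Taylor coefficients into one Hilbert space.\<close>

definition kholo_at :: "(complex \<Rightarrow> kondratiev) \<Rightarrow> complex \<Rightarrow> bool" where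
  "kholo_at f w \<longleftrightarrow> (\<exists>\<rho>>0. \<exists>M k. (\<forall>\<alpha>. (\<lambda>z. kcoeff (f z) \<alpha>) holomorphic_on ball w \<rho>) \<and>
     (\<forall>z\<in>ball w \<rho>. coeff_bound M k (f z)))"

lemma kholo_atI:
  assumes "\<rho> > 0" "\<And>\<alpha>. (\<lambda>z. kcoeff (f z) \<alpha>) holomorphic_on ball w \<rho>"
    "\<And>z. z \<in> ball w \<rho> \<Longrightarrow> coeff_bound M k (f z)"
  shows "kholo_at f w"
  using assms unfolding kholo_at_def by blast

lemma kholo_atE:
  assumes "kholo_at f w" "r > 0"
  obtains \<rho> M k where "\<rho> > 0" "\<rho> \<le> r" "\<And>\<alpha>. (\<lambda>z. kcoeff (f z) \<alpha>) holomorphic_on ball w \<rho>"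
    "\<And>z. z \<in> ball w \<rho> \<Longrightarrow> coeff_bound M k (f z)"
proof -
  from assms obtain \<rho> M k where *: "\<rho> > 0" "\<And>\<alpha>. (\<lambda>z. kcoeff (f z) \<alpha>) holomorphic_on ball w \<rho>"
    "\<And>z. z \<in> ball w \<rho> \<Longrightarrow> coeff_bound M k (f z)" unfolding kholo_at_def by blast
  show ?thesis
    by (rule that[of "min \<rho> r" M k]) (use * assms in \<open>auto intro: holomorphic_on_subset[OF *(2)]\<close>)
qed

lemma kholo_atE2:
  assumes "kholo_at f w" "kholo_at g w"
  obtains \<rho> M k N l where "\<rho> > 0" "\<And>\<alpha>. (\<lambda>z. kcoeff (f z) \<alpha>) holomorphic_on ball w \<rho>"
    "\<And>\<alpha>. (\<lambda>z. kcoeff (g z) \<alpha>) holomorphic_on ball w \<rho>"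
    "\<And>z. z \<in> ball w \<rho> \<Longrightarrow> coeff_bound M k (f z)" "\<And>z. z \<in> ball w \<rho> \<Longrightarrow> coeff_bound N l (g z)"
proof -
  obtain \<rho> M k where f: "\<rho> > 0" "\<And>\<alpha>. (\<lambda>z. kcoeff (f z) \<alpha>) holomorphic_on ball w \<rho>"
    "\<And>z. z \<in> ball w \<rho> \<Longrightarrow> coeff_bound M k (f z)"
    by (rule kholo_atE[OF assms(1), of 1]) auto
  obtain \<rho>' N l where g: "\<rho>' > 0" "\<rho>' \<le> \<rho>" "\<And>\<alpha>. (\<lambda>z. kcoeff (g z) \<alpha>) holomorphic_on ball w \<rho>'"
    "\<And>z. z \<in> ball w \<rho>' \<Longrightarrow> coeff_bound N l (g z)"
    by (rule kholo_atE[OF assms(2) f(1)]) blast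
  show ?thesis
    by (rule that[of \<rho>' M k N l]) (use f g in \<open>auto intro: holomorphic_on_subset[OF f(2)]\<close>)
qed

lemma kholo_at_cong:
  assumes "kholo_at f w" "\<forall>\<^sub>F z in nhds w. f z = g z"
  shows "kholo_at g w"
proof -
  from assms(2) obtain d where d: "d > 0" "\<And>z. z \<in> ball w d \<Longrightarrow> f z = g z"
    unfolding eventually_nhds_metric by (auto simp: dist_commute)
  obtain \<rho> M k where *: "\<rho> > 0" "\<rho> \<le> d" "\<And>\<alpha>. (\<lambda>z. kcoeff (f z) \<alpha>) holomorphic_on ball w \<rho>"
    "\<And>z. z \<in> ball w \<rho> \<Longrightarrow> coeff_bound M k (f z)"
    by (rule kholo_atE[OF assms(1) d(1)]) blast
  have eq: "f z = g z" if "z \<in> ball w \<rho>" for z using d(2)[of z] that *(2) by auto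
  show ?thesis
  proof (rule kholo_atI[OF *(1)])
    show "(\<lambda>z. kcoeff (g z) \<alpha>) holomorphic_on ball w \<rho>" for \<alpha>
      using *(3)[of \<alpha>] by (rule holomorphic_transform) (auto simp: eq)
    show "coeff_bound M k (g z)" if "z \<in> ball w \<rho>" for z using *(4)[OF that] eq[OF that] by simp
  qed
qed

section \<open>Closure properties of local analyticity\<close>

lemma kholo_at_const [intro!]: "kholo_at (\<lambda>z. F) w"
  using coeff_bound_exists[of F] by (auto simp: kholo_at_def intro: exI[of _ 1])

lemma kholo_at_kconst [intro!]: "kholo_at kconst w"
proof (rule kholo_atI[of 1])
  show "(\<lambda>z. kcoeff (kconst z) \<alpha>) holomorphic_on ball w 1" for \<alpha>
    by (cases "\<alpha> = 0") (auto simp: kcoeff_kconst)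
  show "coeff_bound (cmod w + 1) 0 (kconst z)" if "z \<in> ball w 1" for z
  proof -
    have "cmod z \<le> cmod w + 1" using that norm_triangle_ineq2[of z w] by (simp add: dist_norm norm_minus_commute)
    thus ?thesis by (auto simp: coeff_bound_def kcoeff_kconst)
  qed
qed auto

lemma kholo_at_add [intro!]: "kholo_at f w \<Longrightarrow> kholo_at g w \<Longrightarrow> kholo_at (\<lambda>z. f z + g z) w"
  and kholo_at_diff [intro!]: "kholo_at f w \<Longrightarrow> kholo_at g w \<Longrightarrow> kholo_at (\<lambda>z. f z - g z) w"
proof -
  assume "kholo_at f w" "kholo_at g w"
  then obtain \<rho> M k N l where *: "\<rho> > 0" "\<And>\<alpha>. (\<lambda>z. kcoeff (f z) \<alpha>) holomorphic_on ball w \<rho>"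
    "\<And>\<alpha>. (\<lambda>z. kcoeff (g z) \<alpha>) holomorphic_on ball w \<rho>"
    "\<And>z. z \<in> ball w \<rho> \<Longrightarrow> coeff_bound M k (f z)" "\<And>z. z \<in> ball w \<rho> \<Longrightarrow> coeff_bound N l (g z)"
    by (rule kholo_atE2) blast
  have b: "coeff_bound M (k + l) (f z)" "coeff_bound N (k + l) (g z)" if "z \<in> ball w \<rho>" for z
    using *(4,5)[OF that] by (auto intro: coeff_bound_mono)
  show "kholo_at (\<lambda>z. f z + g z) w" "kholo_at (\<lambda>z. f z - g z) w"
    by (rule kholo_atI[of \<rho> _ _ "M + N" "k + l"];
        use * b in \<open>auto intro: holomorphic_intros coeff_bound_add\<close>)+
qed

lemma kholo_at_mult [intro!]:
  assumes "kholo_at f w" "kholo_at g w"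
  shows "kholo_at (\<lambda>z. f z * g z) w"
proof -
  from assms obtain \<rho> M k N l where *: "\<rho> > 0" "\<And>\<alpha>. (\<lambda>z. kcoeff (f z) \<alpha>) holomorphic_on ball w \<rho>"
    "\<And>\<alpha>. (\<lambda>z. kcoeff (g z) \<alpha>) holomorphic_on ball w \<rho>"
    "\<And>z. z \<in> ball w \<rho> \<Longrightarrow> coeff_bound M k (f z)" "\<And>z. z \<in> ball w \<rho> \<Longrightarrow> coeff_bound N l (g z)"
    by (rule kholo_atE2) blast
  obtain s where s: "\<And>F G. coeff_bound M k F \<Longrightarrow> coeff_bound N l G \<Longrightarrow> coeff_bound ((M + 1) * N) s (F * G)"
    using coeff_bound_mult[of M k N l] by blast
  show ?thesis
    by (rule kholo_atI[of \<rho> _ _ "(M + 1) * N" s])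
       (use * s in \<open>auto simp: kcoeff_mult intro!: holomorphic_intros\<close>)
qed

lemma kholo_at_sum [intro!]: "(\<And>i. i \<in> I \<Longrightarrow> kholo_at (f i) w) \<Longrightarrow> kholo_at (\<lambda>z. \<Sum>i\<in>I. f i z) w"
  by (induction I rule: infinite_finite_induct) auto

lemma kholo_at_isCont:
  assumes "kholo_at f w"
  shows "isCont (\<lambda>z. kcoeff (f z) \<alpha>) w"
proof -
  from assms obtain \<rho> where "\<rho> > 0" "(\<lambda>z. kcoeff (f z) \<alpha>) holomorphic_on ball w \<rho>"
    unfolding kholo_at_def by blast
  thus ?thesis
    using holomorphic_on_imp_continuous_on continuous_on_interior[of "ball w \<rho>" _ w] by auto
qed

text \<open>By continuity the constant term stays above half its value at \<open>w\<close>, so a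
  single exponent bounds all inverses nearby. Holomorphy of their coefficients follows along the
  recursion \<open>inv_coeff\<close>, one multi-index at a time.\<close>

lemma kholo_at_inverse [intro!]:
  assumes "kholo_at f w" "const_term (f w) \<noteq> 0"
  shows "kholo_at (\<lambda>z. inverse (f z)) w"
proof -
  define \<delta> where "\<delta> = cmod (const_term (f w)) / 2"
  have \<delta>: "\<delta> > 0" using assms by (simp add: \<delta>_def)
  have "isCont (\<lambda>z. cmod (kcoeff (f z) 0)) w"
    using kholo_at_isCont[OF assms(1)] by (rule continuous_norm)
  hence "((\<lambda>z. cmod (kcoeff (f z) 0)) \<longlongrightarrow> cmod (kcoeff (f w) 0)) (nhds w)"
    using tendsto_at_iff_tendsto_nhds[of "\<lambda>z. cmod (kcoeff (f z) 0)" w] by (simp only: isCont_def)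
  hence "\<forall>\<^sub>F z in nhds w. cmod (kcoeff (f z) 0) > \<delta>"
    by (rule order_tendstoD) (use \<delta> in \<open>simp add: \<delta>_def const_term_def\<close>)
  then obtain d where d: "d > 0" "\<And>z. z \<in> ball w d \<Longrightarrow> cmod (const_term (f z)) > \<delta>"
    unfolding eventually_nhds_metric by (auto simp: dist_commute const_term_def)
  obtain \<rho> M k where *: "\<rho> > 0" "\<rho> \<le> d" "\<And>\<alpha>. (\<lambda>z. kcoeff (f z) \<alpha>) holomorphic_on ball w \<rho>"
    "\<And>z. z \<in> ball w \<rho> \<Longrightarrow> coeff_bound M k (f z)"
    by (rule kholo_atE[OF assms(1) d(1)]) blast
  have d': "cmod (const_term (f z)) > \<delta>" if "z \<in> ball w \<rho>" for z using d(2)[of z] that *(2) by auto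
  hence nz: "const_term (f z) \<noteq> 0" if "z \<in> ball w \<rho>" for z using that \<delta> by fastforce
  obtain s where s: "\<And>F. coeff_bound M k F \<Longrightarrow> cmod (const_term F) \<ge> \<delta> \<Longrightarrow> coeff_bound (1 / \<delta>) s (inverse F)"
    using coeff_bound_inverse[OF \<delta>] by blast
  show ?thesis
  proof (rule kholo_atI[OF *(1)])
    show "coeff_bound (1 / \<delta>) s (inverse (f z))" if "z \<in> ball w \<rho>" for z
      using s *(4) d' that by (simp add: less_imp_le)
    have "(\<lambda>z. inv_coeff (kcoeff (f z)) \<alpha>) holomorphic_on ball w \<rho>" for \<alpha>
    proof (induction \<alpha> rule: multi_index_induct)
      case (step \<alpha>)
      thus ?case using nz
        by (subst inv_coeff.simps) (auto intro!: holomorphic_intros *(3) simp: const_term_def)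
    qed
    thus "(\<lambda>z. kcoeff (inverse (f z)) \<alpha>) holomorphic_on ball w \<rho>" for \<alpha>
      by (rule holomorphic_transform) (use nz in \<open>auto simp: kcoeff_inverse(1)\<close>)
  qed
qed

text \<open>The factor in the following estimates is the constant relating the supremum bounds on the
  coefficients to the Hilbert space norms.\<close>

definition two_N_const :: real where
  "two_N_const = sqrt (\<Sum>\<^sub>\<infinity>\<beta>. 1 / (two_N \<beta>)\<^sup>2)"

text \<open>Squaring doubles the exponent, and the extra 2 leaves the convergent sum of
  \<open>1 / (two_N \<alpha>)\<^sup>2\<close>.\<close>

lemma hnorm_le_of_bound:
  assumes "coeff_bound M k F"
  shows "F \<in> hspace (2 * k + 2)" and "hnorm (2 * k + 2) F \<le> M * two_N_const"
proof -
  have M: "M \<ge> 0" using assms by (rule coeff_bound_nonneg)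
  have in_h: "in_hspace (2 * k + 2) (kcoeff F)"
    using assms by (intro in_hspace_of_bound) (rule coeff_boundD)
  thus "F \<in> hspace (2 * k + 2)" by (simp add: hspace_def)
  have "(\<Sum>\<^sub>\<infinity>\<alpha>. (cmod (kcoeff F \<alpha>))\<^sup>2 / two_N \<alpha> ^ (2 * k + 2)) \<le> (\<Sum>\<^sub>\<infinity>\<alpha>. M\<^sup>2 * (1 / (two_N \<alpha>)\<^sup>2))"
  proof (rule infsum_mono)
    show "(\<lambda>\<alpha>. M\<^sup>2 * (1 / (two_N \<alpha>)\<^sup>2)) summable_on UNIV"
      by (intro summable_on_cmult_right summable_two_N)
    fix \<alpha>
    have "(cmod (kcoeff F \<alpha>))\<^sup>2 \<le> (M * two_N \<alpha> ^ k)\<^sup>2"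
      by (intro power_mono coeff_boundD[OF assms]) auto
    hence "(cmod (kcoeff F \<alpha>))\<^sup>2 / two_N \<alpha> ^ (2 * k + 2) \<le> (M * two_N \<alpha> ^ k)\<^sup>2 / two_N \<alpha> ^ (2 * k + 2)"
      by (intro divide_right_mono) auto
    also have "\<dots> = M\<^sup>2 * (1 / (two_N \<alpha>)\<^sup>2)"
    proof -
      have "two_N \<alpha> ^ (2 * k + 2) = (two_N \<alpha> ^ k)\<^sup>2 * (two_N \<alpha>)\<^sup>2"
        by (simp only: power_add power_mult [symmetric] mult.commute[of k 2])
      thus ?thesis using two_N_pos[of \<alpha>] by (simp add: power_mult_distrib)
    qed
    finally show "(cmod (kcoeff F \<alpha>))\<^sup>2 / two_N \<alpha> ^ (2 * k + 2) \<le> M\<^sup>2 * (1 / (two_N \<alpha>)\<^sup>2)" .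
  qed (use in_h in \<open>simp add: in_hspace_def\<close>)
  also have "\<dots> = M\<^sup>2 * (\<Sum>\<^sub>\<infinity>\<alpha>. 1 / (two_N \<alpha>)\<^sup>2)" by (rule infsum_cmult_right') 
  finally have "hnorm (2 * k + 2) F \<le> sqrt (M\<^sup>2 * (\<Sum>\<^sub>\<infinity>\<alpha>. 1 / (two_N \<alpha>)\<^sup>2))"
    unfolding hnorm_def by (rule real_sqrt_le_mono)
  thus "hnorm (2 * k + 2) F \<le> M * two_N_const" using M by (simp add: real_sqrt_mult two_N_const_def)
qed

section \<open>Convergence in norm and convergence of coefficients\<close>

lemma hnorm_nonneg [simp]: "hnorm p F \<ge> 0"
  unfolding hnorm_def by (intro real_sqrt_ge_zero infsum_nonneg) auto

lemma coeff_bound_hnorm: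
  assumes "F \<in> hspace p"
  shows "coeff_bound (hnorm p F) p F"
  unfolding coeff_bound_def
proof
  fix \<alpha>
  let ?g = "\<lambda>\<alpha>. (cmod (kcoeff F \<alpha>))\<^sup>2 / two_N \<alpha> ^ p"
  have t: "two_N \<alpha> ^ p \<ge> 1" using two_N_ge_1 by (rule one_le_power)
  have "infsum ?g {\<alpha>} \<le> infsum ?g UNIV"
    by (rule infsum_mono_neutral) (use assms in \<open>auto simp: hspace_def in_hspace_def\<close>)
  also have "\<dots> = (hnorm p F)\<^sup>2" unfolding hnorm_def by (subst real_sqrt_pow2) (auto intro: infsum_nonneg)
  finally have "(cmod (kcoeff F \<alpha>))\<^sup>2 \<le> (hnorm p F)\<^sup>2 * two_N \<alpha> ^ p"
    using t by (simp add: divide_simps)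
  also have "\<dots> \<le> (hnorm p F)\<^sup>2 * (two_N \<alpha> ^ p)\<^sup>2"
    using t by (intro mult_left_mono) (auto simp: power2_eq_square)
  finally have "(cmod (kcoeff F \<alpha>))\<^sup>2 \<le> (hnorm p F * two_N \<alpha> ^ p)\<^sup>2" by (simp add: power_mult_distrib)
  thus "cmod (kcoeff F \<alpha>) \<le> hnorm p F * two_N \<alpha> ^ p" using t by (auto intro: power2_le_imp_le)
qed

lemma hspace_diff:
  assumes "F \<in> hspace p" "G \<in> hspace p"
  shows "F - G \<in> hspace p"
  unfolding hspace_def in_hspace_def mem_Collect_eq
proof (rule summable_on_comparison_test)
  show "(\<lambda>\<alpha>. 2 * ((cmod (kcoeff F \<alpha>))\<^sup>2 / two_N \<alpha> ^ p) + 2 * ((cmod (kcoeff G \<alpha>))\<^sup>2 / two_N \<alpha> ^ p)) summable_on UNIV"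
    using assms unfolding hspace_def in_hspace_def by (intro summable_on_add summable_on_cmult_right) auto
  fix \<alpha>
  let ?x = "cmod (kcoeff F \<alpha>)" and ?y = "cmod (kcoeff G \<alpha>)"
  have "(cmod (kcoeff (F - G) \<alpha>))\<^sup>2 \<le> (?x + ?y)\<^sup>2"
    by (intro power_mono) (auto intro: norm_triangle_ineq4)
  also have "\<dots> \<le> 2 * ?x\<^sup>2 + 2 * ?y\<^sup>2"
    using zero_le_power2[of "?x - ?y"] by (simp add: power2_eq_square algebra_simps)
  finally have "(cmod (kcoeff (F - G) \<alpha>))\<^sup>2 / two_N \<alpha> ^ p \<le> (2 * ?x\<^sup>2 + 2 * ?y\<^sup>2) / two_N \<alpha> ^ p"
    by (intro divide_right_mono) auto
  thus "(cmod (kcoeff (F - G) \<alpha>))\<^sup>2 / two_N \<alpha> ^ p \<le> 2 * (?x\<^sup>2 / two_N \<alpha> ^ p) + 2 * (?y\<^sup>2 / two_N \<alpha> ^ p)"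
    by (simp add: add_divide_distrib)
qed auto

lemma hspace_partial_sum:
  fixes x :: "nat \<Rightarrow> kondratiev"
  assumes "\<forall>m. x m \<in> hspace p" "s \<in> hspace p"
  shows "s - (\<Sum>m<N. x m) \<in> hspace p"
proof (induct N)
  case (Suc N)
  have "s - (\<Sum>m<Suc N. x m) = (s - (\<Sum>m<N. x m)) - x N" by simp
  thus ?case using Suc assms hspace_diff by metis
qed (use assms in auto)

lemma sums_in_hspace_coeff:
  assumes "sums_in_hspace p x s"
  shows "(\<lambda>m. kcoeff (x m) \<alpha>) sums kcoeff s \<alpha>"
proof -
  have lim: "(\<lambda>N. hnorm p (s - (\<Sum>m<N. x m)) * two_N \<alpha> ^ p) \<longlonglongrightarrow> 0 * two_N \<alpha> ^ p"
    using assms unfolding sums_in_hspace_def by (intro tendsto_intros) auto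
  have "cmod (kcoeff s \<alpha> - (\<Sum>m<N. kcoeff (x m) \<alpha>)) \<le> hnorm p (s - (\<Sum>m<N. x m)) * two_N \<alpha> ^ p" for N
    using coeff_boundD[OF coeff_bound_hnorm[OF hspace_partial_sum[of x p s N]], of \<alpha>] assms
    unfolding sums_in_hspace_def by simp
  hence "(\<lambda>N. kcoeff s \<alpha> - (\<Sum>m<N. kcoeff (x m) \<alpha>)) \<longlonglongrightarrow> 0"
    using lim by (intro Lim_null_comparison[OF _ lim[simplified]]) auto
  hence "(\<lambda>N. kcoeff s \<alpha> - (kcoeff s \<alpha> - (\<Sum>m<N. kcoeff (x m) \<alpha>))) \<longlonglongrightarrow> kcoeff s \<alpha> - 0"
    by (intro tendsto_intros)
  thus ?thesis by (simp add: sums_def)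
qed

lemma sums_in_hspace_unique: "sums_in_hspace p x s \<Longrightarrow> sums_in_hspace q x t \<Longrightarrow> s = t"
  by (rule kondratiev_eqI) (metis sums_in_hspace_coeff sums_unique2)

text \<open>Used with \<open>N = 0\<close> to bound a sum, with \<open>N = 1\<close> as a modulus of
  continuity, and with general \<open>N\<close> for convergence in norm.\<close>

lemma coeff_bound_tail:
  assumes "\<And>m. coeff_bound (M * q ^ m) k (x m)" "0 \<le> q" "q < 1"
    and "\<And>\<alpha>. (\<lambda>m. kcoeff (x m) \<alpha>) sums kcoeff s \<alpha>"
  shows "coeff_bound (M * q ^ N / (1 - q)) k (s - (\<Sum>m<N. x m))"
  unfolding coeff_bound_def
proof
  fix \<alpha>
  have g: "(\<lambda>m. M * two_N \<alpha> ^ k * q ^ N * q ^ m) sums (M * two_N \<alpha> ^ k * q ^ N * (1 / (1 - q)))"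
    using assms by (intro sums_mult geometric_sums) auto
  have le: "norm (kcoeff (x (m + N)) \<alpha>) \<le> M * two_N \<alpha> ^ k * q ^ N * q ^ m" for m
    using coeff_boundD[OF assms(1)[of "m + N"], of \<alpha>] by (simp add: power_add mult_ac)
  have "(\<lambda>m. kcoeff (x (m + N)) \<alpha>) sums (kcoeff s \<alpha> - (\<Sum>m<N. kcoeff (x m) \<alpha>))"
    using sums_split_initial_segment[OF assms(4)[of \<alpha>], of N] by (simp add: lessThan_atLeast0)
  hence eq: "kcoeff (s - (\<Sum>m<N. x m)) \<alpha> = suminf (\<lambda>m. kcoeff (x (m + N)) \<alpha>)" by (simp add: sums_unique)
  have "norm (suminf (\<lambda>m. kcoeff (x (m + N)) \<alpha>)) \<le> suminf (\<lambda>m. M * two_N \<alpha> ^ k * q ^ N * q ^ m)"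
    using le g by (intro norm_suminf_le) (auto simp: sums_iff)
  also have "\<dots> = M * two_N \<alpha> ^ k * q ^ N * (1 / (1 - q))" using g by (rule sums_unique [symmetric])
  finally show "cmod (kcoeff (s - (\<Sum>m<N. x m)) \<alpha>) \<le> M * q ^ N / (1 - q) * two_N \<alpha> ^ k"
    unfolding eq by (simp add: mult_ac)
qed

text \<open>A geometric majorant uniform in \<open>\<alpha>\<close> upgrades coefficientwise
  convergence to convergence in one Hilbert space.\<close>

lemma sums_in_hspace_of_bound:
  assumes "\<And>m. coeff_bound (M * q ^ m) k (x m)" "0 \<le> q" "q < 1"
    and "\<And>\<alpha>. (\<lambda>m. kcoeff (x m) \<alpha>) sums kcoeff s \<alpha>"
  shows "sums_in_hspace (2 * k + 2) x s"
  unfolding sums_in_hspace_def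
proof (intro conjI allI)
  note tail = coeff_bound_tail[where M = M and q = q and x = x and s = s, OF assms]
  show "x m \<in> hspace (2 * k + 2)" for m using assms(1) by (rule hnorm_le_of_bound)
  show "s \<in> hspace (2 * k + 2)" using hnorm_le_of_bound(1)[OF tail[of 0]] by simp
  have "(\<lambda>N. M * q ^ N / (1 - q) * two_N_const) \<longlonglongrightarrow> M * 0 / (1 - q) * two_N_const"
    using assms by (intro tendsto_intros LIMSEQ_power_zero) auto
  hence lim: "(\<lambda>N. M * q ^ N / (1 - q) * two_N_const) \<longlonglongrightarrow> 0" by simp
  show "(\<lambda>N. hnorm (2 * k + 2) (s - (\<Sum>m<N. x m))) \<longlonglongrightarrow> 0"
    by (rule Lim_null_comparison[OF _ lim]) (use hnorm_le_of_bound(2)[OF tail] in auto)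
qed

text \<open>The working form of \<open>has_taylor\<close>: bounds \<open>M / \<rho> ^ m\<close> as
  in Cauchy's inequality replace membership in a Hilbert space, and the series is summed coefficient
  by coefficient.\<close>

definition has_expansion :: "(complex \<Rightarrow> kondratiev) \<Rightarrow> complex \<Rightarrow> (nat \<Rightarrow> kondratiev) \<Rightarrow> real \<Rightarrow> real \<Rightarrow> nat \<Rightarrow> bool" where
  "has_expansion f w c \<rho> M k \<longleftrightarrow> \<rho> > 0 \<and> (\<forall>m. coeff_bound (M / \<rho> ^ m) k (c m)) \<and>
     (\<forall>\<zeta>\<in>ball w \<rho>. \<forall>\<alpha>. (\<lambda>m. kcoeff (c m) \<alpha> * (\<zeta> - w) ^ m) sums kcoeff (f \<zeta>) \<alpha>)"

text \<open>Cauchy's inequality for each coefficient function gives a bound with the same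
  \<open>M\<close> and \<open>k\<close> for every \<open>\<alpha>\<close>; hence the scalar Taylor
  coefficients of fixed order \<open>m\<close> assemble to an element of the ring.\<close>

lemma kholo_at_expansion:
  assumes "kholo_at f w"
  obtains c \<rho> M k where "has_expansion f w c \<rho> M k"
proof -
  obtain r M k where r: "r > 0" "\<And>\<alpha>. (\<lambda>z. kcoeff (f z) \<alpha>) holomorphic_on ball w r"
    "\<And>z. z \<in> ball w r \<Longrightarrow> coeff_bound M k (f z)"
    by (rule kholo_atE[OF assms zero_less_one]) blast
  \<comment> \<open>Cauchy's inequality needs continuity and the bound on a closed disk, which half
    the radius provides.\<close>
  define \<rho> where "\<rho> = r / 2"
  have \<rho>: "\<rho> > 0" "cball w \<rho> \<subseteq> ball w r" "ball w \<rho> \<subseteq> ball w r" using r by (auto simp: \<rho>_def)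
  define d where "d m \<alpha> = (deriv ^^ m) (\<lambda>z. kcoeff (f z) \<alpha>) w / fact m" for m \<alpha>
  have bound: "cmod (d m \<alpha>) \<le> M / \<rho> ^ m * two_N \<alpha> ^ k" for m \<alpha>
  proof -
    have "cmod ((deriv ^^ m) (\<lambda>z. kcoeff (f z) \<alpha>) w) \<le> fact m * (M * two_N \<alpha> ^ k) / \<rho> ^ m"
    proof (rule Cauchy_inequality)
      show "(\<lambda>z. kcoeff (f z) \<alpha>) holomorphic_on ball w \<rho>" using r(2) \<rho>(3) by (rule holomorphic_on_subset)
      show "continuous_on (cball w \<rho>) (\<lambda>z. kcoeff (f z) \<alpha>)"
        using holomorphic_on_imp_continuous_on[OF r(2)] \<rho>(2) by (rule continuous_on_subset)
      show "cmod (kcoeff (f x) \<alpha>) \<le> M * two_N \<alpha> ^ k" if "cmod (w - x) = \<rho>" for x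
        using that \<rho> by (intro coeff_boundD r(3)) (auto simp: dist_norm)
    qed (use \<rho> in auto)
    thus ?thesis by (simp add: d_def norm_divide field_simps)
  qed
  have "\<exists>c. kcoeff c = d m" for m
    by (rule kondratiev_of_bound[OF bound]) blast
  then obtain c where c: "\<And>m. kcoeff (c m) = d m" by metis
  have "(\<lambda>m. kcoeff (c m) \<alpha> * (\<zeta> - w) ^ m) sums kcoeff (f \<zeta>) \<alpha>" if "\<zeta> \<in> ball w \<rho>" for \<zeta> \<alpha>
    using holomorphic_power_series[OF r(2)[of \<alpha>], of \<zeta>] that \<rho> by (auto simp: c d_def)
  hence "has_expansion f w c \<rho> M k"
    unfolding has_expansion_def coeff_bound_def using \<rho>(1) bound by (auto simp: c)
  thus ?thesis by (rule that)
qed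

lemma kcoeff_mult_kconst_power: "kcoeff (F * kconst z ^ m) \<alpha> = kcoeff F \<alpha> * z ^ m"
  by (simp add: kconst_power mult.commute[of F] mult.commute[of "kcoeff F \<alpha>"])

lemma expansion_term_bound:
  assumes "has_expansion f w c \<rho> M k" "cmod (\<zeta> - w) \<le> t * \<rho>"
  shows "coeff_bound (M * t ^ m) k (c m * kconst (\<zeta> - w) ^ m)"
  unfolding coeff_bound_def kcoeff_mult_kconst_power
proof
  fix \<alpha>
  have \<rho>: "\<rho> > 0" and c: "coeff_bound (M / \<rho> ^ m) k (c m)" using assms by (auto simp: has_expansion_def)
  have "cmod (kcoeff (c m) \<alpha> * (\<zeta> - w) ^ m) \<le> (M / \<rho> ^ m * two_N \<alpha> ^ k) * (t * \<rho>) ^ m"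
    unfolding norm_mult norm_power using coeff_bound_nonneg[OF c] 
    by (intro mult_mono power_mono coeff_boundD[OF c] assms mult_nonneg_nonneg) auto
  also have "\<dots> = M * t ^ m * two_N \<alpha> ^ k" using \<rho> by (simp add: power_mult_distrib)
  finally show "cmod (kcoeff (c m) \<alpha> * (\<zeta> - w) ^ m) \<le> M * t ^ m * two_N \<alpha> ^ k" .
qed

lemma expansion_has_taylor:
  assumes "has_expansion f w c \<rho> M k"
  shows "has_taylor f w c"
  unfolding has_taylor_def
proof (intro exI conjI ballI allI)
  have \<rho>: "\<rho> > 0" using assms by (auto simp: has_expansion_def)
  show "c m \<in> hspace (2 * k + 2)" for m
    using assms unfolding has_expansion_def by (meson hnorm_le_of_bound(1))
  show "\<rho> / 2 > 0" using \<rho> by simp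
  fix \<zeta> assume "\<zeta> \<in> ball w (\<rho> / 2)"
  hence \<zeta>: "cmod (\<zeta> - w) \<le> (1 / 2) * \<rho>" "\<zeta> \<in> ball w \<rho>" using \<rho> by (auto simp: dist_norm norm_minus_commute)
  show "sums_in_hspace (2 * k + 2) (\<lambda>m. c m * kconst (\<zeta> - w) ^ m) (f \<zeta>)"
    by (rule sums_in_hspace_of_bound[OF expansion_term_bound[OF assms \<zeta>(1)]])
       (use assms \<zeta>(2) in \<open>auto simp: has_expansion_def kcoeff_mult_kconst_power\<close>)
qed auto

lemma has_taylor_coeff_sums:
  assumes "has_taylor f w c"
  obtains \<rho> where "\<rho> > 0" "\<And>\<zeta> \<alpha>. \<zeta> \<in> ball w \<rho> \<Longrightarrow> (\<lambda>m. kcoeff (c m) \<alpha> * (\<zeta> - w) ^ m) sums kcoeff (f \<zeta>) \<alpha>"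
  using assms sums_in_hspace_coeff unfolding has_taylor_def kcoeff_mult_kconst_power[symmetric] by meson

text \<open>A non-zero coefficient of positive index would make the sum non-zero near
  \<open>w\<close>, by isolation of zeros; the coefficient of index 0 is read off at the
  centre.\<close>

lemma power_series_coeffs_zero:
  fixes d :: "nat \<Rightarrow> complex"
  assumes "\<rho> > 0" "\<And>\<zeta>. \<zeta> \<in> ball w \<rho> \<Longrightarrow> (\<lambda>m. d m * (\<zeta> - w) ^ m) sums 0"
  shows "d m = 0"
proof (rule ccontr)
  assume nz: "d m \<noteq> 0"
  show False
  proof (cases "m = 0")
    case True
    thus False using assms(2)[of w] nz assms(1) powser_sums_zero_iff[of d 0] by simp
  next
    case False
    have *: "(\<lambda>n. d n * (x - w) ^ n) sums (\<lambda>_. 0) x" if "norm (x - w) < \<rho>" for x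
      using assms(2)[of x] that by (simp add: dist_norm norm_minus_commute)
    obtain s where s: "0 < s" "\<And>z. z \<in> cball w s - {w} \<Longrightarrow> (\<lambda>_. 0 :: complex) z \<noteq> 0"
      by (rule powser_0_nonzero[OF assms(1) * _ nz]) (use False in auto)
    have "w + of_real s \<in> cball w s - {w}" using s(1) by (auto simp: dist_norm)
    thus False using s(2) by blast
  qed
qed

lemma has_taylor_unique:
  assumes "has_taylor f w c" "has_taylor f w d"
  shows "c = d"
proof (intro ext kondratiev_eqI)
  fix m \<alpha>
  obtain \<rho> where c: "\<rho> > 0" "\<And>\<zeta> \<alpha>. \<zeta> \<in> ball w \<rho> \<Longrightarrow> (\<lambda>m. kcoeff (c m) \<alpha> * (\<zeta> - w) ^ m) sums kcoeff (f \<zeta>) \<alpha>"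
    using has_taylor_coeff_sums[OF assms(1)] by metis
  obtain \<rho>' where d: "\<rho>' > 0" "\<And>\<zeta> \<alpha>. \<zeta> \<in> ball w \<rho>' \<Longrightarrow> (\<lambda>m. kcoeff (d m) \<alpha> * (\<zeta> - w) ^ m) sums kcoeff (f \<zeta>) \<alpha>"
    using has_taylor_coeff_sums[OF assms(2)] by metis
  have "kcoeff (c m) \<alpha> - kcoeff (d m) \<alpha> = 0"
  proof (rule power_series_coeffs_zero)
    show "min \<rho> \<rho>' > 0" using c d by simp
    show "(\<lambda>m. (kcoeff (c m) \<alpha> - kcoeff (d m) \<alpha>) * (\<zeta> - w) ^ m) sums 0" if "\<zeta> \<in> ball w (min \<rho> \<rho>')" for \<zeta>
      using sums_diff[OF c(2)[of \<zeta> \<alpha>] d(2)[of \<zeta> \<alpha>]] that by (simp add: ring_distribs)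
  qed
  thus "kcoeff (c m) \<alpha> = kcoeff (d m) \<alpha>" by simp
qed

lemma taylor_coeffs_eq: "has_taylor f w c \<Longrightarrow> taylor_coeffs f w = c"
  unfolding taylor_coeffs_def using has_taylor_unique by blast

text \<open>Convergence at a single point at distance \<open>\<rho> / 2\<close> bounds all Taylor coefficients, and
  the geometric series then gives a uniform bound on a smaller disk.\<close>

lemma has_taylor_kholo_at:
  assumes "has_taylor f w c"
  shows "kholo_at f w"
proof -
  obtain p \<rho> where p: "\<And>m. c m \<in> hspace p" and \<rho>: "\<rho> > 0"
    and s: "\<And>\<zeta>. \<zeta> \<in> ball w \<rho> \<Longrightarrow> sums_in_hspace p (\<lambda>m. c m * kconst (\<zeta> - w) ^ m) (f \<zeta>)"
    using assms unfolding has_taylor_def by blast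
  have sums: "(\<lambda>m. kcoeff (c m) \<alpha> * (\<zeta> - w) ^ m) sums kcoeff (f \<zeta>) \<alpha>" if "\<zeta> \<in> ball w \<rho>" for \<zeta> \<alpha>
    using sums_in_hspace_coeff[OF s[OF that]] by (simp add: kcoeff_mult_kconst_power)
  define \<zeta>0 where "\<zeta>0 = w + of_real (\<rho> / 2)"
  define x where "x m = c m * kconst (\<zeta>0 - w) ^ m" for m
  have \<zeta>0: "sums_in_hspace p x (f \<zeta>0)" unfolding x_def using \<rho> by (intro s) (auto simp: \<zeta>0_def dist_norm)
  hence "Bseq (\<lambda>N. hnorm p (f \<zeta>0 - (\<Sum>m<N. x m)))"
    unfolding sums_in_hspace_def by (meson convergent_imp_Bseq convergentI)
  then obtain K where K: "\<And>N. hnorm p (f \<zeta>0 - (\<Sum>m<N. x m)) \<le> K"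
    unfolding Bseq_def by auto
  have part: "coeff_bound K p (f \<zeta>0 - (\<Sum>m<N. x m))" for N
    using coeff_bound_hnorm[OF hspace_partial_sum[of x p "f \<zeta>0" N]] K[of N] \<zeta>0
    unfolding sums_in_hspace_def by (meson coeff_bound_mono order_refl)
  \<comment> \<open>Each term is the difference of two consecutive remainders, whence the factor
    2.\<close>
  have x: "coeff_bound (2 * K) p (x m)" for m
    using coeff_bound_add(2)[OF part[of m] part[of "Suc m"]] by simp
  have "has_expansion f w c (\<rho> / 2) (2 * K) p"
    unfolding has_expansion_def
  proof (intro conjI allI ballI)
    show "coeff_bound (2 * K / (\<rho> / 2) ^ m) p (c m)" for m
      unfolding coeff_bound_def
    proof
      fix \<alpha>
      have "cmod (kcoeff (x m) \<alpha>) = cmod (kcoeff (c m) \<alpha>) * (\<rho> / 2) ^ m"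
        using \<rho> by (simp add: x_def kcoeff_mult_kconst_power \<zeta>0_def norm_mult norm_power norm_divide)
      thus "cmod (kcoeff (c m) \<alpha>) \<le> 2 * K / (\<rho> / 2) ^ m * two_N \<alpha> ^ p"
        using coeff_boundD[OF x[of m], of \<alpha>] \<rho> by (simp add: pos_le_divide_eq del: power_divide)
    qed
  qed (use \<rho> sums in auto)
  note ex = this
  show ?thesis
  proof (rule kholo_atI)
    show "\<rho> / 4 > 0" using \<rho> by simp
    show "(\<lambda>z. kcoeff (f z) \<alpha>) holomorphic_on ball w (\<rho> / 4)" for \<alpha>
      by (rule power_series_holomorphic[where a = "\<lambda>m. kcoeff (c m) \<alpha>"]) (use sums \<rho> in auto)
    fix \<zeta> assume "\<zeta> \<in> ball w (\<rho> / 4)"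
    hence \<zeta>: "cmod (\<zeta> - w) \<le> (1 / 2) * (\<rho> / 2)" "\<zeta> \<in> ball w \<rho>"
      using \<rho> by (auto simp: dist_norm norm_minus_commute)
    show "coeff_bound (2 * K * (1 / 2) ^ 0 / (1 - 1 / 2)) p (f \<zeta>)"
      using coeff_bound_tail[OF expansion_term_bound[OF ex \<zeta>(1)], of "f \<zeta>" 0] sums[OF \<zeta>(2)]
      by (simp add: kcoeff_mult_kconst_power)
  qed
qed

text \<open>Near \<open>w\<close> all increments \<open>f \<zeta> - f w\<close> lie in the single
  space of index \<open>2 * k + 2\<close>, where every basic neighbourhood contains a ball. Their
  norm is bounded by the tail of the Taylor series from index 1 on, which tends to 0.\<close>

lemma kholo_at_isCont':
  assumes "kholo_at f w"
  shows "isCont f w"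
  unfolding continuous_at
proof (rule topological_tendstoI)
  fix U assume U: "open U" "f w \<in> U"
  obtain V where V: "basic_nhd0 V" "(+) (f w) ` V \<subseteq> U"
    using U unfolding open_kondratiev_def by blast
  obtain c \<rho> M k where ex: "has_expansion f w c \<rho> M k" by (rule kholo_at_expansion[OF assms])
  have \<rho>: "\<rho> > 0" using ex by (simp add: has_expansion_def)
  have "\<exists>e>0. {G \<in> hspace (2 * k + 2). hnorm (2 * k + 2) G < e} \<subseteq> V"
    using V(1) unfolding basic_nhd0_def by simp
  then obtain e where e: "e > 0" "{G \<in> hspace (2 * k + 2). hnorm (2 * k + 2) G < e} \<subseteq> V"
    by blast
  have c0: "c 0 = f w"
  proof (rule kondratiev_eqI)
    fix \<alpha>
    have "w \<in> ball w \<rho>" using \<rho> by simp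
    hence "(\<lambda>m. kcoeff (c m) \<alpha> * (w - w) ^ m) sums kcoeff (f w) \<alpha>"
      using ex unfolding has_expansion_def by blast
    thus "kcoeff (c 0) \<alpha> = kcoeff (f w) \<alpha>" by (simp only: diff_self powser_sums_zero_iff)
  qed
  have "((\<lambda>\<zeta>. M * (cmod (\<zeta> - w) / \<rho>) ^ 1 / (1 - cmod (\<zeta> - w) / \<rho>) * two_N_const) \<longlongrightarrow>
     M * (cmod (w - w) / \<rho>) ^ 1 / (1 - cmod (w - w) / \<rho>) * two_N_const) (at w)"
    using \<rho> by (intro tendsto_intros) auto
  hence "\<forall>\<^sub>F \<zeta> in at w. M * (cmod (\<zeta> - w) / \<rho>) ^ 1 / (1 - cmod (\<zeta> - w) / \<rho>) * two_N_const < e"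
    using e(1) by (auto dest: order_tendstoD(2)[of _ _ _ e])
  moreover have "\<forall>\<^sub>F \<zeta> in at w. \<zeta> \<in> ball w \<rho>" using \<rho> by (intro eventually_at_in_open') auto
  ultimately show "\<forall>\<^sub>F \<zeta> in at w. f \<zeta> \<in> U"
  proof eventually_elim
    case (elim \<zeta>)
    let ?t = "cmod (\<zeta> - w) / \<rho>"
    have t: "?t < 1" "0 \<le> ?t" using elim(2) \<rho> by (auto simp: dist_norm norm_minus_commute)
    have "coeff_bound (M * ?t ^ 1 / (1 - ?t)) k (f \<zeta> - (\<Sum>m<1. c m * kconst (\<zeta> - w) ^ m))"
    proof (rule coeff_bound_tail[OF expansion_term_bound[OF ex]])
      show "(\<lambda>m. kcoeff (c m * kconst (\<zeta> - w) ^ m) \<alpha>) sums kcoeff (f \<zeta>) \<alpha>" for \<alpha>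
        using ex elim(2) by (auto simp: has_expansion_def kcoeff_mult_kconst_power)
    qed (use t \<rho> in auto)
    hence "coeff_bound (M * ?t ^ 1 / (1 - ?t)) k (f \<zeta> - f w)" by (simp add: c0)
    from hnorm_le_of_bound[OF this] elim(1) have "f \<zeta> - f w \<in> V" using e(2) by auto
    thus ?case using V(2) by (metis add.commute diff_add_cancel image_subset_iff)
  qed
qed

lemma kanalytic_on_iff_kholo_at: "kanalytic_on f \<Omega> \<longleftrightarrow> (\<forall>w\<in>\<Omega>. kholo_at f w)"
proof
  assume *: "\<forall>w\<in>\<Omega>. kholo_at f w"
  have "\<exists>c. has_taylor f w c" if "w \<in> \<Omega>" for w
    using * that by (metis kholo_at_expansion expansion_has_taylor)
  moreover have "continuous_on \<Omega> f"
    using * by (intro continuous_at_imp_continuous_on ballI kholo_at_isCont') auto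
  ultimately show "kanalytic_on f \<Omega>" by (simp add: kanalytic_on_def)
qed (auto simp: kanalytic_on_def intro: has_taylor_kholo_at)

section \<open>Evaluation at elements of the ring\<close>

lemma coeff_sums_exists:
  assumes "\<And>m. coeff_bound (M * q ^ m) k (x m)" "0 \<le> q" "q < 1"
  obtains s where "coeff_bound (M / (1 - q)) k s" "\<And>\<alpha>. (\<lambda>m. kcoeff (x m) \<alpha>) sums kcoeff s \<alpha>"
proof -
  have g: "(\<lambda>m. M * two_N \<alpha> ^ k * q ^ m) sums (M * two_N \<alpha> ^ k * (1 / (1 - q)))" for \<alpha>
    using assms by (intro sums_mult geometric_sums) auto
  have le: "norm (kcoeff (x m) \<alpha>) \<le> M * two_N \<alpha> ^ k * q ^ m" for m \<alpha>
    using coeff_boundD[OF assms(1)[of m], of \<alpha>] by (simp add: mult_ac)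
  have sm: "summable (\<lambda>m. kcoeff (x m) \<alpha>)" for \<alpha>
    by (rule summable_comparison_test[OF _ sums_summable[OF g[of \<alpha>]]]) (use le in blast)
  have b: "cmod (suminf (\<lambda>m. kcoeff (x m) \<alpha>)) \<le> M / (1 - q) * two_N \<alpha> ^ k" for \<alpha>
  proof -
    have "cmod (suminf (\<lambda>m. kcoeff (x m) \<alpha>)) \<le> suminf (\<lambda>m. M * two_N \<alpha> ^ k * q ^ m)"
      using le g by (intro norm_suminf_le) (auto simp: sums_iff)
    also have "\<dots> = M * two_N \<alpha> ^ k * (1 / (1 - q))" using g by (rule sums_unique [symmetric])
    finally show ?thesis by (simp add: mult_ac)
  qed
  obtain s where "kcoeff s = (\<lambda>\<alpha>. suminf (\<lambda>m. kcoeff (x m) \<alpha>))" by (rule kondratiev_of_bound[OF b])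
  thus ?thesis using b sm by (intro that[of s]) (auto simp: coeff_bound_def)
qed

text \<open>Each coefficient of a product is a finite combination of coefficients, so multiplication
  by \<open>E\<close> commutes with coefficientwise summation.\<close>

lemma coeff_sums_mult:
  assumes "\<And>\<alpha>. (\<lambda>m. kcoeff (x m) \<alpha> * t m) sums kcoeff s \<alpha>"
  shows "(\<lambda>m. kcoeff (E * x m) \<alpha> * t m) sums kcoeff (E * s) \<alpha>"
proof -
  have "(\<lambda>m. kcoeff E 0 * (kcoeff (x m) \<alpha> * t m) +
      (\<Sum>p\<in>tail_pairs \<alpha>. kcoeff E (fst p) * (kcoeff (x m) (snd p) * t m))) sums kcoeff (E * s) \<alpha>"
    unfolding kcoeff_mult by (intro sums_add sums_mult sums_sum assms)
  thus ?thesis unfolding kcoeff_mult by (simp add: ring_distribs sum_distrib_left sum_distrib_right mult_ac)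
qed

text \<open>Multiplication by \<open>t\<close> shifts the series by one place and leaves room for
  \<open>b\<close> at index 0; the case distinction is needed because \<open>m - 1\<close> is 0 for
  \<open>m = 0\<close>.\<close>

lemma coeff_sums_linear_factor:
  assumes "\<And>\<alpha>. (\<lambda>m. kcoeff (e m) \<alpha> * t ^ m) sums kcoeff Q \<alpha>"
  shows "(\<lambda>m. kcoeff ((if m = 0 then b else e (m - 1)) - E * e m) \<alpha> * t ^ m)
    sums kcoeff (b + (kconst t - E) * Q) \<alpha>"
proof -
  have "(\<lambda>m. t * (kcoeff (e m) \<alpha> * t ^ m)) sums (t * kcoeff Q \<alpha>)"
    by (intro sums_mult assms)
  hence "(\<lambda>m. kcoeff (if Suc m = 0 then b else e (Suc m - 1)) \<alpha> * t ^ Suc m) sums (t * kcoeff Q \<alpha>)"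
    by (simp add: mult_ac)
  hence "(\<lambda>m. kcoeff (if m = 0 then b else e (m - 1)) \<alpha> * t ^ m) sums (t * kcoeff Q \<alpha> + kcoeff b \<alpha>)"
    by (subst (asm) sums_Suc_iff) simp
  note diff = sums_diff[OF this coeff_sums_mult[OF assms, of E \<alpha>]]
  have "kcoeff (b + (kconst t - E) * Q) \<alpha> = t * kcoeff Q \<alpha> + kcoeff b \<alpha> - kcoeff (E * Q) \<alpha>"
    by (simp add: left_diff_distrib)
  thus ?thesis using diff unfolding kcoeff_simps(3) left_diff_distrib by (simp only:)
qed

text \<open>Each factor \<open>E\<close> costs only half the radius \<open>\<rho>\<close>, so the
  terms with \<open>j = m\<close> decay like \<open>(1 / 2) ^ m\<close>. The indices are kept apart
  because the quotient in \<open>kevaluate_factor\<close> pairs a coefficient with a lower power of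
  \<open>E\<close>.\<close>

lemma expansion_power_bound:
  assumes "has_expansion f w c \<rho> M k" "const_term E = 0"
  obtains s where "\<And>m j. coeff_bound (M / \<rho> ^ m * (\<rho> / 2) ^ j) s (c m * E ^ j)"
proof -
  have \<rho>: "\<rho> / 2 > 0" and c: "\<And>m. coeff_bound (M / \<rho> ^ m) k (c m)"
    using assms by (auto simp: has_expansion_def)
  obtain s0 where s0: "\<And>s F M. s \<ge> s0 \<Longrightarrow> coeff_bound M s F \<Longrightarrow> coeff_bound (\<rho> / 2 * M) s (E * F)"
    using coeff_bound_mult_small[OF \<rho> assms(2)] by blast
  have "coeff_bound (M / \<rho> ^ m * (\<rho> / 2) ^ j) (max s0 k) (c m * E ^ j)" for m j
  proof (induction j)
    case 0
    show ?case using c[of m] by (auto intro: coeff_bound_mono)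
  next
    case (Suc j)
    from s0[OF _ this] show ?case by (simp add: mult_ac)
  qed
  thus ?thesis by (rule that)
qed

lemma coeff_bound_power_tendsto_0:
  assumes "\<And>m. coeff_bound (M * q ^ m) k (x m)" "0 \<le> q" "q < 1"
  shows "(\<lambda>m. kcoeff (x m) \<alpha>) \<longlonglongrightarrow> 0"
proof (rule Lim_null_comparison)
  show "\<forall>\<^sub>F m in sequentially. norm (kcoeff (x m) \<alpha>) \<le> M * q ^ m * two_N \<alpha> ^ k"
    using coeff_boundD[OF assms(1)] by auto
  have "(\<lambda>m. M * q ^ m * two_N \<alpha> ^ k) \<longlonglongrightarrow> M * 0 * two_N \<alpha> ^ k"
    using assms by (intro tendsto_intros LIMSEQ_power_zero) auto
  thus "(\<lambda>m. M * q ^ m * two_N \<alpha> ^ k) \<longlonglongrightarrow> 0" by simp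
qed

text \<open>Evaluation at \<open>r\<close> is characterised by divisibility of \<open>f - b\<close> by \<open>kconst z - r\<close>. The
  partial sums of the evaluation series then telescope.\<close>

lemma kevaluate_eqI:
  assumes f: "kholo_at f w" and q: "kholo_at q w" and w: "const_term r = w"
    and eq: "\<forall>\<^sub>F z in nhds w. f z = b + (kconst z - r) * q z"
  shows "kevaluate f r = b"
proof -
  define E where "E = r - kconst w"
  have E: "const_term E = 0" by (simp add: E_def w)
  obtain c \<rho> M k where c: "has_expansion f w c \<rho> M k" by (rule kholo_at_expansion[OF f])
  obtain d \<rho>' M' k' where d: "has_expansion q w d \<rho>' M' k'" by (rule kholo_at_expansion[OF q])
  obtain \<epsilon> where \<epsilon>: "\<epsilon> > 0" "\<And>z. z \<in> ball w \<epsilon> \<Longrightarrow> f z = b + (kconst z - r) * q z"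
    using eq unfolding eventually_nhds_metric by (auto simp: dist_commute)
  have pos: "\<rho> > 0" "\<rho>' > 0" using c d by (auto simp: has_expansion_def)
  \<comment> \<open>Comparison of coefficients in \<open>f = b + (kconst (z - w) - E) * q\<close>,
    which is the hypothesis after the substitution \<open>r = kconst w + E\<close>.\<close>
  have cd: "c m = (if m = 0 then b else d (m - 1)) - E * d m" for m
  proof (rule kondratiev_eqI)
    fix \<alpha>
    let ?c = "\<lambda>m. (if m = 0 then b else d (m - 1)) - E * d m"
    have "kcoeff (c m) \<alpha> - kcoeff (?c m) \<alpha> = 0"
    proof (rule power_series_coeffs_zero[where \<rho> = "min \<epsilon> (min \<rho> \<rho>')" and w = w])
      fix \<zeta> assume \<zeta>: "\<zeta> \<in> ball w (min \<epsilon> (min \<rho> \<rho>'))"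
      have "(\<lambda>m. kcoeff (c m) \<alpha> * (\<zeta> - w) ^ m) sums kcoeff (f \<zeta>) \<alpha>"
        using c \<zeta> by (auto simp: has_expansion_def)
      moreover have "(\<lambda>m. kcoeff (?c m) \<alpha> * (\<zeta> - w) ^ m) sums kcoeff (b + (kconst (\<zeta> - w) - E) * q \<zeta>) \<alpha>"
        by (rule coeff_sums_linear_factor) (use d \<zeta> in \<open>auto simp: has_expansion_def\<close>)
      moreover have "b + (kconst (\<zeta> - w) - E) * q \<zeta> = f \<zeta>"
        using \<epsilon>(2)[of \<zeta>] \<zeta> by (simp add: E_def kconst_diff)
      ultimately have "(\<lambda>m. kcoeff (c m) \<alpha> * (\<zeta> - w) ^ m - kcoeff (?c m) \<alpha> * (\<zeta> - w) ^ m) sums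
          (kcoeff (f \<zeta>) \<alpha> - kcoeff (f \<zeta>) \<alpha>)" by (intro sums_diff) simp_all
      thus "(\<lambda>m. (kcoeff (c m) \<alpha> - kcoeff (?c m) \<alpha>) * (\<zeta> - w) ^ m) sums 0"
        by (simp only: left_diff_distrib diff_self)
    qed (use pos \<epsilon> in auto)
    thus "kcoeff (c m) \<alpha> = kcoeff (?c m) \<alpha>" by simp
  qed
  have telescope: "(\<Sum>m<Suc N. c m * E ^ m) = b - d N * E ^ Suc N" for N
    by (induction N) (auto simp: cd algebra_simps)
  obtain s where s: "\<And>m j. coeff_bound (M / \<rho> ^ m * (\<rho> / 2) ^ j) s (c m * E ^ j)"
    by (rule expansion_power_bound[OF c E]) blast
  obtain s' where s': "\<And>m j. coeff_bound (M' / \<rho>' ^ m * (\<rho>' / 2) ^ j) s' (d m * E ^ j)"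
    by (rule expansion_power_bound[OF d E]) blast
  have "sums_in_hspace (2 * s + 2) (\<lambda>m. c m * E ^ m) b"
  proof (rule sums_in_hspace_of_bound[where q = "1 / 2" and M = M])
    show "coeff_bound (M * (1 / 2) ^ m) s (c m * E ^ m)" for m
      using s[of m m] pos by (simp add: power_divide)
    fix \<alpha>
    \<comment> \<open>The remainder has one more factor \<open>E\<close> than the index of
      \<open>d\<close>, hence the extra constant \<open>\<rho>' / 2\<close> beside the geometric
      decay.\<close>
    have "(\<lambda>N. kcoeff (d N * E ^ Suc N) \<alpha>) \<longlonglongrightarrow> 0"
    proof (rule coeff_bound_power_tendsto_0[where q = "1 / 2"])
      show "coeff_bound (M' * (\<rho>' / 2) * (1 / 2) ^ N) s' (d N * E ^ Suc N)" for N
        using s'[of N "Suc N"] pos by (simp add: power_divide mult_ac)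
    qed auto
    hence "(\<lambda>N. kcoeff b \<alpha> - kcoeff (d N * E ^ Suc N) \<alpha>) \<longlonglongrightarrow> kcoeff b \<alpha> - 0"
      by (intro tendsto_intros)
    hence "(\<lambda>N. kcoeff (\<Sum>m<Suc N. c m * E ^ m) \<alpha>) \<longlonglongrightarrow> kcoeff b \<alpha>"
      unfolding telescope by simp
    hence "(\<lambda>N. \<Sum>m<Suc N. kcoeff (c m * E ^ m) \<alpha>) \<longlonglongrightarrow> kcoeff b \<alpha>"
      by (simp only: kcoeff_sum)
    thus "(\<lambda>m. kcoeff (c m * E ^ m) \<alpha>) sums kcoeff b \<alpha>"
      unfolding sums_def by (rule LIMSEQ_imp_Suc)
  qed auto
  moreover have "taylor_coeffs f w = c"
    using expansion_has_taylor[OF c] by (rule taylor_coeffs_eq)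
  ultimately show ?thesis
    unfolding kevaluate_def w E_def
    by (intro the_equality exI[of _ "2 * s + 2"]) (auto dest: sums_in_hspace_unique)
qed

text \<open>Synthetic division for power series: the quotient has the Taylor coefficients
  \<open>e m\<close>, the sums of \<open>c (Suc m + j) * E ^ j\<close> over \<open>j\<close>, and
  satisfies \<open>e m = c (Suc m) + E * e (Suc m)\<close>. The remainder
  \<open>b = c 0 + E * e 0\<close> is identified with the evaluation only at the end, by the
  converse \<open>kevaluate_eqI\<close>.\<close>

lemma kevaluate_factor:
  assumes f: "kholo_at f w" and w: "const_term r = w"
  obtains q where "kholo_at q w" "\<forall>\<^sub>F z in nhds w. f z = kevaluate f r + (kconst z - r) * q z"
proof -
  define E where "E = r - kconst w"
  have E: "const_term E = 0" by (simp add: E_def w)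
  obtain c \<rho> M k where c: "has_expansion f w c \<rho> M k" by (rule kholo_at_expansion[OF f])
  have \<rho>: "\<rho> > 0" using c by (auto simp: has_expansion_def)
  obtain s where s: "\<And>m j. coeff_bound (M / \<rho> ^ m * (\<rho> / 2) ^ j) s (c m * E ^ j)"
    by (rule expansion_power_bound[OF c E]) blast
  have "\<exists>e. coeff_bound (2 * M / \<rho> ^ Suc m) s e \<and> (\<forall>\<alpha>. (\<lambda>j. kcoeff (c (Suc m + j) * E ^ j) \<alpha>) sums kcoeff e \<alpha>)" for m
  proof -
    have "coeff_bound (M / \<rho> ^ Suc m * (1 / 2) ^ j) s (c (Suc m + j) * E ^ j)" for j
      using s[of "Suc m + j" j] \<rho> by (simp add: power_add power_divide)
    then obtain e where "coeff_bound (M / \<rho> ^ Suc m / (1 - 1 / 2)) s e"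
      "\<And>\<alpha>. (\<lambda>j. kcoeff (c (Suc m + j) * E ^ j) \<alpha>) sums kcoeff e \<alpha>"
      by (rule coeff_sums_exists) auto
    thus ?thesis by (intro exI[of _ e]) (simp add: mult.commute)
  qed
  then obtain e where e: "\<And>m. coeff_bound (2 * M / \<rho> ^ Suc m) s (e m)"
    "\<And>m \<alpha>. (\<lambda>j. kcoeff (c (Suc m + j) * E ^ j) \<alpha>) sums kcoeff (e m) \<alpha>" by metis
  have e_eq: "e m = c (Suc m) + E * e (Suc m)" for m
  proof (rule kondratiev_eqI)
    fix \<alpha>
    have "(\<lambda>j. kcoeff (E * (c (Suc (Suc m) + j) * E ^ j)) \<alpha> * 1) sums kcoeff (E * e (Suc m)) \<alpha>"
      using e(2)[of "Suc m"] by (intro coeff_sums_mult) simp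
    hence "(\<lambda>j. kcoeff (c (Suc m + Suc j) * E ^ Suc j) \<alpha>) sums kcoeff (E * e (Suc m)) \<alpha>"
      by (simp add: mult_ac)
    hence "(\<lambda>j. kcoeff (c (Suc m + j) * E ^ j) \<alpha>) sums (kcoeff (E * e (Suc m)) \<alpha> + kcoeff (c (Suc m)) \<alpha>)"
      by (subst (asm) sums_Suc_iff) simp
    with e(2)[of m \<alpha>] show "kcoeff (e m) \<alpha> = kcoeff (c (Suc m) + E * e (Suc m)) \<alpha>"
      by (simp add: sums_unique2 add.commute)
  qed
  define b where "b = c 0 + E * e 0"
  have c_eq: "c m = (if m = 0 then b else e (m - 1)) - E * e m" for m
    using e_eq[of "m - 1"] by (cases m) (auto simp: b_def)
  have "\<exists>Q. coeff_bound (4 * M / \<rho>) s Q \<and> (\<forall>\<alpha>. (\<lambda>m. kcoeff (e m) \<alpha> * (z - w) ^ m) sums kcoeff Q \<alpha>)"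
    if z: "z \<in> ball w (\<rho> / 2)" for z
  proof -
    have "coeff_bound (2 * M / \<rho> * (1 / 2) ^ m) s (e m * kconst (z - w) ^ m)" for m
      unfolding coeff_bound_def kcoeff_mult_kconst_power
    proof
      fix \<alpha>
      have "cmod (kcoeff (e m) \<alpha> * (z - w) ^ m) \<le> (2 * M / \<rho> ^ Suc m * two_N \<alpha> ^ s) * (\<rho> / 2) ^ m"
        unfolding norm_mult norm_power using coeff_bound_nonneg[OF e(1)[of m]] z
        by (intro mult_mono power_mono coeff_boundD[OF e(1)] mult_nonneg_nonneg)
           (auto simp: dist_norm norm_minus_commute)
      also have "\<dots> = 2 * M / \<rho> * (1 / 2) ^ m * two_N \<alpha> ^ s" using \<rho> by (simp add: power_divide)
      finally show "cmod (kcoeff (e m) \<alpha> * (z - w) ^ m) \<le> 2 * M / \<rho> * (1 / 2) ^ m * two_N \<alpha> ^ s" .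
    qed
    then obtain Q where "coeff_bound (2 * M / \<rho> / (1 - 1 / 2)) s Q"
      "\<And>\<alpha>. (\<lambda>m. kcoeff (e m * kconst (z - w) ^ m) \<alpha>) sums kcoeff Q \<alpha>"
      by (rule coeff_sums_exists) auto
    thus ?thesis by (intro exI[of _ Q]) (simp add: kcoeff_mult_kconst_power mult.commute[of _ M])
  qed
  then obtain q where q: "\<And>z. z \<in> ball w (\<rho> / 2) \<Longrightarrow> coeff_bound (4 * M / \<rho>) s (q z)"
    "\<And>z \<alpha>. z \<in> ball w (\<rho> / 2) \<Longrightarrow> (\<lambda>m. kcoeff (e m) \<alpha> * (z - w) ^ m) sums kcoeff (q z) \<alpha>" by metis
  have holo: "kholo_at q w"
  proof (rule kholo_atI)
    show "(\<lambda>z. kcoeff (q z) \<alpha>) holomorphic_on ball w (\<rho> / 2)" for \<alpha>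
      by (rule power_series_holomorphic[where a = "\<lambda>m. kcoeff (e m) \<alpha>"]) (use q in auto)
  qed (use \<rho> q in auto)
  have eq: "f z = b + (kconst z - r) * q z" if z: "z \<in> ball w (\<rho> / 2)" for z
  proof (rule kondratiev_eqI)
    fix \<alpha>
    have "(\<lambda>m. kcoeff (c m) \<alpha> * (z - w) ^ m) sums kcoeff (b + (kconst (z - w) - E) * q z) \<alpha>"
      unfolding c_eq by (rule coeff_sums_linear_factor) (rule q(2)[OF z])
    moreover have "(\<lambda>m. kcoeff (c m) \<alpha> * (z - w) ^ m) sums kcoeff (f z) \<alpha>"
      using c z \<rho> by (auto simp: has_expansion_def)
    moreover have "kconst (z - w) - E = kconst z - r" by (simp add: E_def kconst_diff)
    ultimately show "kcoeff (f z) \<alpha> = kcoeff (b + (kconst z - r) * q z) \<alpha>" by (metis sums_unique2)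
  qed
  have ev: "\<forall>\<^sub>F z in nhds w. f z = b + (kconst z - r) * q z"
    by (rule eventually_mono[OF eventually_nhds_in_open[of "ball w (\<rho> / 2)"]]) (use eq \<rho> in auto)
  with kevaluate_eqI[OF f holo w ev] holo show ?thesis by (intro that) auto
qed

section \<open>The scalar problem\<close>

text \<open>Cauchy's formula over the parameter interval: the derivative of the circle is
  \<open>2 * pi * \<i>\<close> times the circle itself, which cancels the usual prefactor and leaves
  a mean.\<close>

lemma circle_mean_cauchy_kernel:
  assumes "h holomorphic_on ball 0 1" "0 < r" "r < 1" "cmod \<zeta> < r"
  shows "((\<lambda>t. h (circlepath 0 r t) * (circlepath 0 r t / (circlepath 0 r t - \<zeta>))) has_integral h \<zeta>) {0..1}"
proof -
  have "h holomorphic_on cball 0 r" using assms by (auto intro: holomorphic_on_subset)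
  hence "((\<lambda>u. h u / (u - \<zeta>)) has_contour_integral (2 * of_real pi * \<i> * h \<zeta>)) (circlepath 0 r)"
    by (rule Cauchy_integral_circlepath_simple) (use assms in auto)
  hence "((\<lambda>t. h (circlepath 0 r t) / (circlepath 0 r t - \<zeta>) *
      (2 * of_real pi * \<i> * circlepath 0 r t)) has_integral (2 * of_real pi * \<i> * h \<zeta>)) {0..1}"
    unfolding has_contour_integral_def
    by (rule has_integral_eq[rotated]) (simp add: vector_derivative_circlepath01, simp add: circlepath)
  hence "((\<lambda>t. inverse (2 * of_real pi * \<i>) * (h (circlepath 0 r t) / (circlepath 0 r t - \<zeta>) *
      (2 * of_real pi * \<i> * circlepath 0 r t))) has_integral inverse (2 * of_real pi * \<i>) * (2 * of_real pi * \<i> * h \<zeta>)) {0..1}"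
    by (rule has_integral_mult_right)
  thus ?thesis by (simp add: field_simps)
qed

text \<open>With \<open>U\<close> and \<open>V\<close> the combinations of Szego kernels with weights \<open>d i\<close> and
  \<open>d i * cnj (f (z i))\<close>, the form is the circle mean of
  \<open>|U|\<^sup>2 + |V|\<^sup>2 - 2 Re (f V cnj U) \<ge> |U - f V|\<^sup>2\<close>.\<close>

lemma pick_form_radius:
  fixes z d :: "'i \<Rightarrow> complex"
  assumes f: "f holomorphic_on ball 0 1" "\<And>w. w \<in> ball 0 1 \<Longrightarrow> cmod (f w) \<le> 1"
    and r: "0 < r" "r < 1" and z: "\<And>i. i \<in> I \<Longrightarrow> cmod (z i) < r\<^sup>2"
  shows "0 \<le> Re (\<Sum>j\<in>I. \<Sum>i\<in>I. cnj (d j) * d i *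
    ((1 - f (z j) * cnj (f (z i))) * (of_real (r\<^sup>2) / (of_real (r\<^sup>2) - cnj (z i) * z j))))"
proof -
  \<comment> \<open>The Szego kernel of the disk of radius \<open>r\<close>. The condition on
    \<open>z i\<close> moves its pole outside the unit disk, so it is holomorphic there, and on the
    circle its conjugate is the Cauchy kernel.\<close>
  define k where "k i u = of_real (r\<^sup>2) / (of_real (r\<^sup>2) - cnj (z i) * u)" for i u
  define U where "U u = (\<Sum>i\<in>I. d i * k i u)" for u
  define V where "V u = (\<Sum>i\<in>I. d i * cnj (f (z i)) * k i u)" for u
  define \<gamma> where "\<gamma> = circlepath 0 r"
  have r2: "r\<^sup>2 < r" using r by (simp add: power2_eq_square)
  have zr: "cmod (z i) < r" if "i \<in> I" for i using z[OF that] r2 by linarith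
  have nz: "of_real (r\<^sup>2) - cnj (z i) * u \<noteq> 0" if "i \<in> I" "u \<in> ball 0 1" for i u
  proof
    assume "of_real (r\<^sup>2) - cnj (z i) * u = 0"
    hence "cmod (of_real (r\<^sup>2)) = cmod (z i) * cmod u" by (metis complex_mod_cnj norm_mult right_minus_eq)
    hence eq: "r\<^sup>2 = cmod (z i) * cmod u" using r by (simp add: norm_power)
    have "cmod (z i) * cmod u \<le> cmod (z i) * 1" using that by (intro mult_left_mono) auto
    thus False using z[OF that(1)] eq by linarith
  qed
  have holk: "k i holomorphic_on ball 0 1" if "i \<in> I" for i
    unfolding k_def using nz[OF that] by (intro holomorphic_intros) auto
  have holU: "U holomorphic_on ball 0 1" and holV: "V holomorphic_on ball 0 1"
    unfolding U_def V_def by (intro holomorphic_intros holk; assumption)+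
  have \<gamma>: "cmod (\<gamma> t) = r" for t using r by (simp add: \<gamma>_def circlepath norm_mult)
  have cnjk: "cnj (k j (\<gamma> t)) = \<gamma> t / (\<gamma> t - z j)" if "j \<in> I" for j t
  proof -
    have "\<gamma> t * cnj (\<gamma> t) = of_real (r\<^sup>2)" using \<gamma>[of t] by (simp add: complex_norm_square[symmetric])
    moreover have "cnj (\<gamma> t) \<noteq> 0" using \<gamma>[of t] r by auto
    ultimately show ?thesis
    proof -
      have "\<gamma> t / (\<gamma> t - z j) = (\<gamma> t * cnj (\<gamma> t)) / ((\<gamma> t - z j) * cnj (\<gamma> t))"
        using \<open>cnj (\<gamma> t) \<noteq> 0\<close> by simp
      also have "(\<gamma> t - z j) * cnj (\<gamma> t) = of_real (r\<^sup>2) - z j * cnj (\<gamma> t)"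
        using \<open>\<gamma> t * cnj (\<gamma> t) = of_real (r\<^sup>2)\<close> by (simp add: left_diff_distrib)
      finally show ?thesis using \<open>\<gamma> t * cnj (\<gamma> t) = of_real (r\<^sup>2)\<close> by (simp add: k_def)
    qed
  qed
  \<comment> \<open>The reproducing property: pairing with a combination of kernels evaluates
    \<open>h\<close> at the points \<open>z j\<close>.\<close>
  have mean: "((\<lambda>t. h (\<gamma> t) * cnj (\<Sum>j\<in>I. e j * k j (\<gamma> t))) has_integral (\<Sum>j\<in>I. cnj (e j) * h (z j))) {0..1}"
    if "h holomorphic_on ball 0 1" for h e
  proof -
    have "((\<lambda>t. \<Sum>j\<in>I. cnj (e j) * (h (\<gamma> t) * (\<gamma> t / (\<gamma> t - z j)))) has_integral (\<Sum>j\<in>I. cnj (e j) * h (z j))) {0..1}"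
    proof (cases "finite I")
      case True
      thus ?thesis unfolding \<gamma>_def
        by (intro has_integral_sum has_integral_mult_right circle_mean_cauchy_kernel that r zr)
    qed auto
    moreover have "(\<Sum>j\<in>I. cnj (e j) * (h (\<gamma> t) * (\<gamma> t / (\<gamma> t - z j)))) = h (\<gamma> t) * cnj (\<Sum>j\<in>I. e j * k j (\<gamma> t))" for t
      by (simp add: sum_distrib_left cnjk mult_ac)
    ultimately show ?thesis by simp
  qed
  let ?W = "\<lambda>t. U (\<gamma> t) * cnj (U (\<gamma> t)) + V (\<gamma> t) * cnj (V (\<gamma> t)) - 2 * (f (\<gamma> t) * V (\<gamma> t) * cnj (U (\<gamma> t)))"
  let ?F = "\<Sum>j\<in>I. cnj (d j) * (f (z j) * V (z j))"
  have 1: "((\<lambda>t. U (\<gamma> t) * cnj (U (\<gamma> t))) has_integral (\<Sum>j\<in>I. cnj (d j) * U (z j))) {0..1}"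
    using mean[OF holU, of d] unfolding U_def[of "\<gamma> _"] .
  have 2: "((\<lambda>t. V (\<gamma> t) * cnj (V (\<gamma> t))) has_integral (\<Sum>j\<in>I. cnj (d j * cnj (f (z j))) * V (z j))) {0..1}"
    using mean[OF holV, of "\<lambda>i. d i * cnj (f (z i))"] unfolding V_def[of "\<gamma> _"] .
  have 3: "((\<lambda>t. f (\<gamma> t) * V (\<gamma> t) * cnj (U (\<gamma> t))) has_integral ?F) {0..1}"
    using mean[OF holomorphic_on_mult[OF f(1) holV], of d] unfolding U_def[of "\<gamma> _"] .
  \<comment> \<open>The mean of \<open>V\<close> times its conjugate and the mean of the cross term
    are both \<open>?F\<close>, so one copy of \<open>?F\<close> remains with a minus sign.\<close>
  have "(?W has_integral ((\<Sum>j\<in>I. cnj (d j) * U (z j)) + ?F - 2 * ?F)) {0..1}"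
    using 2 by (intro has_integral_diff has_integral_add has_integral_mult_right 1 3) (simp add: mult_ac)
  hence "((\<lambda>t. Re (?W t)) has_integral Re ((\<Sum>j\<in>I. cnj (d j) * U (z j)) + ?F - 2 * ?F)) {0..1}"
    by (rule has_integral_Re)
  hence "0 \<le> Re ((\<Sum>j\<in>I. cnj (d j) * U (z j)) + ?F - 2 * ?F)"
  proof (rule has_integral_nonneg)
    fix t :: real
    have fle: "cmod (f (\<gamma> t)) \<le> 1" using f(2)[of "\<gamma> t"] \<gamma>[of t] r by auto
    have Re2: "Re (2 * x) = 2 * Re x" for x by simp
    have sq: "Re (x * cnj x) = (cmod x)\<^sup>2" for x by (simp add: complex_norm_square[symmetric])
    have "0 \<le> (cmod (U (\<gamma> t) - f (\<gamma> t) * V (\<gamma> t)))\<^sup>2" by simp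
    also have "\<dots> = (cmod (U (\<gamma> t)))\<^sup>2 + (cmod (f (\<gamma> t) * V (\<gamma> t)))\<^sup>2 - 2 * Re (f (\<gamma> t) * V (\<gamma> t) * cnj (U (\<gamma> t)))"
      by (simp only: sq[symmetric]) (simp add: algebra_simps)
    also have "(cmod (f (\<gamma> t) * V (\<gamma> t)))\<^sup>2 \<le> (1 * cmod (V (\<gamma> t)))\<^sup>2"
      unfolding norm_mult using fle by (intro power_mono mult_right_mono) auto
    finally show "0 \<le> Re (?W t)" by (simp only: minus_complex.sel plus_complex.sel sq Re2) simp
  qed
  also have "(\<Sum>j\<in>I. cnj (d j) * U (z j)) + ?F - 2 * ?F = (\<Sum>j\<in>I. cnj (d j) * U (z j) - cnj (d j) * (f (z j) * V (z j)))"
    by (simp add: sum_subtractf)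
  also have "\<dots> = (\<Sum>j\<in>I. \<Sum>i\<in>I. cnj (d j) * d i * ((1 - f (z j) * cnj (f (z i))) * k i (z j)))"
    unfolding U_def V_def by (intro sum.cong refl) (simp add: sum_distrib_left sum_subtractf[symmetric] algebra_simps)
  finally show ?thesis by (simp add: k_def)
qed

text \<open>As \<open>f\<close> is given only on the open disk, the form arises as the limit of the
  forms for circles of radius \<open>r\<close> tending to 1. Finiteness of \<open>I\<close> puts all
  points below \<open>r\<^sup>2\<close> eventually.\<close>

lemma pick_form_nonneg:
  fixes z u :: "'i \<Rightarrow> complex"
  assumes f: "f holomorphic_on ball 0 1" "\<And>w. w \<in> ball 0 1 \<Longrightarrow> cmod (f w) \<le> 1"
    and I: "finite I" and z: "\<And>i. i \<in> I \<Longrightarrow> cmod (z i) < 1"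
  shows "0 \<le> Re (\<Sum>j\<in>I. \<Sum>i\<in>I. u j * cnj (u i) * ((1 - f (z j) * cnj (f (z i))) / (1 - z j * cnj (z i))))"
proof -
  let ?G = "\<lambda>r. Re (\<Sum>j\<in>I. \<Sum>i\<in>I. cnj (cnj (u j)) * cnj (u i) *
    ((1 - f (z j) * cnj (f (z i))) * (of_real (r\<^sup>2) / (of_real (r\<^sup>2) - cnj (z i) * z j))))"
  have "(?G \<longlongrightarrow> ?G 1) (at_left 1)"
  proof (intro tendsto_intros)
    fix i j assume "i \<in> I" "j \<in> I"
    have "cmod (z i) * cmod (z j) < 1 * 1" using z[OF \<open>i \<in> I\<close>] z[OF \<open>j \<in> I\<close>] by (intro mult_strict_mono') auto
    thus "complex_of_real (1\<^sup>2) - cnj (z i) * z j \<noteq> 0"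
      by (metis complex_mod_cnj less_irrefl mult_1 norm_mult norm_one of_real_1 power_one right_minus_eq)
  qed
  moreover have "\<forall>\<^sub>F r in at_left 1. 0 \<le> ?G r"
  proof -
    have "\<forall>\<^sub>F r in at_left (1::real). \<forall>i\<in>I. cmod (z i) < r\<^sup>2"
      using I z by (intro eventually_ball_finite ballI order_tendstoD[of "\<lambda>r. r\<^sup>2" "1\<^sup>2"] tendsto_intros) auto
    moreover have "\<forall>\<^sub>F r in at_left (1::real). r \<in> {0<..<1}"
      by (rule eventually_at_leftI[of 0]) auto
    ultimately show ?thesis
      by eventually_elim (rule pick_form_radius[OF f], auto)
  qed
  ultimately have "0 \<le> ?G 1" by (rule tendsto_lowerbound) auto
  thus ?thesis by (simp add: mult.commute[of "cnj (z _)"])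
qed

locale scalar_pick =
  fixes a b :: "'n::finite \<Rightarrow> complex" and P Q :: "'n \<Rightarrow> 'n \<Rightarrow> complex"
  assumes a: "\<And>i. cmod (a i) < 1"
    and P: "\<And>i j. P i j = (1 - b i * cnj (b j)) / (1 - a i * cnj (a j))"
    and QP: "\<And>i j. (\<Sum>k\<in>UNIV. Q i k * P k j) = (if i = j then 1 else 0)"
    and PQ: "\<And>i j. (\<Sum>k\<in>UNIV. P i k * Q k j) = (if i = j then 1 else 0)"
    and psd: "\<And>u. 0 \<le> Re (\<Sum>i\<in>UNIV. \<Sum>j\<in>UNIV. u i * cnj (u j) * P i j)"
begin

section \<open>Rows of the scalar coefficient matrix and their energy\<close>

definition mrow :: "complex \<Rightarrow> complex \<Rightarrow> complex \<Rightarrow> 'n \<Rightarrow> complex" where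
  "mrow z p q k = (p + q * cnj (b k)) / (1 - z * cnj (a k))"

definition urow :: "complex \<Rightarrow> complex \<Rightarrow> complex \<Rightarrow> 'n \<Rightarrow> complex" where
  "urow z p q k = (\<Sum>j\<in>UNIV. mrow z p q j * Q j k)"

text \<open>The two entries of the row vector \<open>(p, q) \<Theta>(z)\<close>.\<close>

definition row1 :: "complex \<Rightarrow> complex \<Rightarrow> complex \<Rightarrow> complex" where
  "row1 z p q = p - (1 - z) * (\<Sum>k\<in>UNIV. urow z p q k / (1 - a k))"

definition row2 :: "complex \<Rightarrow> complex \<Rightarrow> complex \<Rightarrow> complex" where
  "row2 z p q = q + (1 - z) * (\<Sum>k\<in>UNIV. urow z p q k * b k / (1 - a k))"

definition energy :: "complex \<Rightarrow> complex \<Rightarrow> complex \<Rightarrow> complex" where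
  "energy z p q = (\<Sum>k\<in>UNIV. urow z p q k * cnj (mrow z p q k))"

lemma one_minus_nz [simp]: "cmod z < 1 \<Longrightarrow> 1 - z * cnj (a k) \<noteq> 0" "1 - a k \<noteq> 0" "1 - a k * cnj (a l) \<noteq> 0"
proof -
  have *: "1 - z * cnj (a k) \<noteq> 0" if "cmod z < 1" for z k
  proof
    assume "1 - z * cnj (a k) = 0"
    hence "cmod z * cmod (a k) = 1" by (metis complex_mod_cnj norm_mult norm_one right_minus_eq)
    moreover have "cmod z * cmod (a k) < 1 * 1" using that a by (intro mult_strict_mono') auto
    ultimately show False by simp
  qed
  thus "cmod z < 1 \<Longrightarrow> 1 - z * cnj (a k) \<noteq> 0" "1 - a k * cnj (a l) \<noteq> 0" using a by auto
  show "1 - a k \<noteq> 0" using a[of k] by auto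
qed

lemma one_minus_cnj_nz [simp]: "1 - cnj (a k) \<noteq> 0" "cmod z < 1 \<Longrightarrow> 1 - cnj z * a k \<noteq> 0"
proof -
  show "1 - cnj (a k) \<noteq> 0" using one_minus_nz(2)[of k] complex_cnj_one_iff[of "a k"] by auto
  assume "cmod z < 1"
  from one_minus_nz(1)[OF this, of k] have "cnj (1 - z * cnj (a k)) \<noteq> 0" by (simp only: complex_cnj_zero_iff not_False_eq_True)
  thus "1 - cnj z * a k \<noteq> 0" by simp
qed

lemma nodes_neq_1 [simp]: "a k \<noteq> 1" "cnj (a k) \<noteq> 1" "a k * cnj (a l) \<noteq> 1"
  "cmod z < 1 \<Longrightarrow> z * cnj (a k) \<noteq> 1" "cmod z < 1 \<Longrightarrow> cnj z * a k \<noteq> 1"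
  using one_minus_nz one_minus_cnj_nz by (metis right_minus_eq)+

lemma P_hermitian: "cnj (P i j) = P j i"
  by (simp add: P mult.commute)

lemma urow_P: "(\<Sum>k\<in>UNIV. urow z p q k * P k l) = mrow z p q l"
proof -
  have "(\<Sum>k\<in>UNIV. urow z p q k * P k l) = (\<Sum>j\<in>UNIV. mrow z p q j * (\<Sum>k\<in>UNIV. Q j k * P k l))"
    unfolding urow_def sum_distrib_left sum_distrib_right
    by (subst sum.swap) (simp add: mult.assoc)
  also have "\<dots> = mrow z p q l" by (simp add: QP if_distrib[of "\<lambda>x. _ * x"] cong: if_cong)
  finally show ?thesis .
qed

lemma P_urow: "(\<Sum>l\<in>UNIV. P k l * cnj (urow z p q l)) = cnj (mrow z p q k)"
  unfolding urow_P[symmetric] cnj_sum by (simp add: P_hermitian mult.commute)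

lemma energy_eq_form: "energy z p q = (\<Sum>k\<in>UNIV. \<Sum>l\<in>UNIV. urow z p q k * cnj (urow z p q l) * P k l)"
  unfolding energy_def P_urow[symmetric] by (simp add: sum_distrib_left mult_ac)

lemma energy_real: "cnj (energy z p q) = energy z p q"
  unfolding energy_eq_form cnj_sum
  by (subst sum.swap) (simp add: P_hermitian mult_ac)

lemma energy_nonneg: "0 \<le> Re (energy z p q)"
  unfolding energy_eq_form by (rule psd)

text \<open>The quadratic part collapses by \<open>(1 - x * y) / ((1 - x) * (1 - y)) = 1 / (1 - x) +
  1 / (1 - y) - 1\<close> with \<open>x = a k\<close> and \<open>y = cnj (a l)\<close>, which turns
  the double sum into \<open>Y + cnj Y - energy\<close>. The linear part uses
  \<open>1 - cnj z * a k = cnj (1 - z) + cnj z * (1 - a k)\<close>. The sums \<open>Y\<close>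
  cancel, and the energy terms add up to the factor \<open>1 - z * cnj z\<close>.\<close>

lemma row_energy:
  assumes z: "cmod z < 1"
  shows "row1 z p q * cnj (row1 z p q) - row2 z p q * cnj (row2 z p q) =
    p * cnj p - q * cnj q - (1 - z * cnj z) * energy z p q"
proof -
  let ?u = "urow z p q" and ?m = "mrow z p q" and ?E = "energy z p q" and ?s = "1 - z"
  define S1 where "S1 = (\<Sum>k\<in>UNIV. ?u k / (1 - a k))"
  define S2 where "S2 = (\<Sum>k\<in>UNIV. ?u k * b k / (1 - a k))"
  define Y where "Y = (\<Sum>k\<in>UNIV. ?u k * cnj (?m k) / (1 - a k))"
  have T: "?s * (S1 * cnj p + S2 * cnj q) = ?s * cnj ?s * Y + ?s * cnj z * ?E"
  proof -
    have "?u k / (1 - a k) * cnj p + ?u k * b k / (1 - a k) * cnj q =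
      cnj ?s * (?u k * cnj (?m k) / (1 - a k)) + cnj z * (?u k * cnj (?m k))" for k
    proof -
      have nz: "1 - cnj z * a k \<noteq> 0" "1 - a k \<noteq> 0" 
        using z by simp_all
      have m: "cnj p + b k * cnj q = cnj (?m k) * (1 - cnj z * a k)"
        using nz by (simp add: mrow_def mult.commute)
      have "?u k / (1 - a k) * cnj p + ?u k * b k / (1 - a k) * cnj q = ?u k * (cnj p + b k * cnj q) / (1 - a k)"
        by (simp add: add_divide_distrib ring_distribs mult.assoc)
      also have "\<dots> = ?u k * cnj (?m k) * ((cnj ?s + cnj z * (1 - a k)) / (1 - a k))"
        unfolding m by (simp add: algebra_simps)
      also have "\<dots> = cnj ?s * (?u k * cnj (?m k) / (1 - a k)) + cnj z * (?u k * cnj (?m k))"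
        using nz by (simp add: divide_simps) (simp add: algebra_simps)
      finally show ?thesis .
    qed
    hence eq: "S1 * cnj p + S2 * cnj q = cnj ?s * Y + cnj z * ?E"
      unfolding S1_def S2_def Y_def energy_def by (simp add: sum_distrib_left sum_distrib_right sum.distrib[symmetric])
    show ?thesis unfolding eq by (simp add: algebra_simps)
  qed
  have X: "S1 * cnj S1 - S2 * cnj S2 = Y + cnj Y - ?E"
  proof -
    have "S1 * cnj S1 - S2 * cnj S2 = (\<Sum>k\<in>UNIV. \<Sum>l\<in>UNIV. 
        ?u k * cnj (?u l) * ((1 - b k * cnj (b l)) / ((1 - a k) * (1 - cnj (a l)))))"
      unfolding S1_def S2_def cnj_sum sum_product
      by (simp add: sum_subtractf[symmetric] diff_divide_distrib ring_distribs mult_ac)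
    also have "\<dots> = (\<Sum>k\<in>UNIV. \<Sum>l\<in>UNIV. ?u k / (1 - a k) * (P k l * cnj (?u l)) +
        cnj (?u l) / (1 - cnj (a l)) * (?u k * P k l) - ?u k * cnj (?u l) * P k l)"
    proof (intro sum.cong refl)
      fix k l
      have nz: "1 - a k \<noteq> 0" "1 - cnj (a l) \<noteq> 0" "1 - a k * cnj (a l) \<noteq> 0"
        by simp_all
      have eq: "(1 - b k * cnj (b l)) / ((1 - a k) * (1 - cnj (a l))) =
        P k l * (1 / (1 - a k) + 1 / (1 - cnj (a l)) - 1)"
        unfolding P using nz by (simp add: divide_simps) (simp add: algebra_simps)
      show "?u k * cnj (?u l) * ((1 - b k * cnj (b l)) / ((1 - a k) * (1 - cnj (a l)))) =
        ?u k / (1 - a k) * (P k l * cnj (?u l)) +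
        cnj (?u l) / (1 - cnj (a l)) * (?u k * P k l) - ?u k * cnj (?u l) * P k l"
        unfolding eq by (simp add: algebra_simps)
    qed
    also have "\<dots> = (\<Sum>k\<in>UNIV. ?u k / (1 - a k) * (\<Sum>l\<in>UNIV. P k l * cnj (?u l))) +
        (\<Sum>k\<in>UNIV. \<Sum>l\<in>UNIV. cnj (?u l) / (1 - cnj (a l)) * (?u k * P k l)) - ?E"
      unfolding energy_eq_form by (simp add: sum_subtractf sum.distrib sum_distrib_left)
    also have "(\<Sum>k\<in>UNIV. \<Sum>l\<in>UNIV. cnj (?u l) / (1 - cnj (a l)) * (?u k * P k l)) =
        (\<Sum>l\<in>UNIV. cnj (?u l) / (1 - cnj (a l)) * (\<Sum>k\<in>UNIV. ?u k * P k l))"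
      by (subst sum.swap) (simp add: sum_distrib_left)
    also have "(\<Sum>k\<in>UNIV. ?u k / (1 - a k) * (\<Sum>l\<in>UNIV. P k l * cnj (?u l))) = Y"
      unfolding P_urow Y_def by simp
    also have "(\<Sum>l\<in>UNIV. cnj (?u l) / (1 - cnj (a l)) * (\<Sum>k\<in>UNIV. ?u k * P k l)) = cnj Y"
      unfolding urow_P Y_def by simp
    finally show ?thesis .
  qed
  have T': "cnj ?s * (cnj S1 * p + cnj S2 * q) = ?s * cnj ?s * cnj Y + cnj ?s * z * ?E"
    using arg_cong[OF T, of cnj] energy_real[of z p q] by (simp add: mult_ac)
  have "row1 z p q * cnj (row1 z p q) - row2 z p q * cnj (row2 z p q) = p * cnj p - q * cnj q
     - ?s * (S1 * cnj p + S2 * cnj q) - cnj ?s * (cnj S1 * p + cnj S2 * q) + ?s * cnj ?s * (S1 * cnj S1 - S2 * cnj S2)"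
    unfolding row1_def row2_def S1_def[symmetric] S2_def[symmetric] by (simp add: algebra_simps)
  also have "\<dots> = p * cnj p - q * cnj q - (1 - z * cnj z) * ?E"
    unfolding T T' X by (simp add: algebra_simps)
  finally show ?thesis .
qed

lemma row_energy_norm:
  assumes "cmod z < 1"
  shows "(cmod (row1 z p q))\<^sup>2 - (cmod (row2 z p q))\<^sup>2 = (cmod p)\<^sup>2 - (cmod q)\<^sup>2 - (1 - (cmod z)\<^sup>2) * Re (energy z p q)"
proof -
  have "complex_of_real ((cmod (row1 z p q))\<^sup>2 - (cmod (row2 z p q))\<^sup>2) =
    of_real ((cmod p)\<^sup>2 - (cmod q)\<^sup>2) - of_real (1 - (cmod z)\<^sup>2) * energy z p q"
    using row_energy[OF assms, of p q] by (simp only: of_real_diff of_real_1 complex_norm_square)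
  from arg_cong[OF this, of Re] show ?thesis by simp
qed

text \<open>Solving for \<open>u\<close> shows that \<open>\<Theta>(z)\<close> is invertible away from the nodes, where the inverse
  has simple poles.\<close>

lemma urow_of_rows:
  assumes z: "cmod z < 1"
  shows "urow z p q l * (z - a l) / (1 - a l) =
    (\<Sum>k\<in>UNIV. (row1 z p q + row2 z p q * cnj (b k)) / (1 - cnj (a k)) * Q k l)"
proof -
  let ?u = "urow z p q"
  have *: "(\<Sum>l\<in>UNIV. ?u l * (z - a l) / (1 - a l) * P l k) =
    (row1 z p q + row2 z p q * cnj (b k)) / (1 - cnj (a k))" for k
  proof -
    have nzk: "1 - cnj (a k) \<noteq> 0" by (rule one_minus_cnj_nz)
    have m: "p + q * cnj (b k) = (\<Sum>l\<in>UNIV. ?u l * P l k) * (1 - z * cnj (a k))"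
      unfolding urow_P using z by (simp add: mrow_def)
    have "row1 z p q + row2 z p q * cnj (b k) = (p + q * cnj (b k)) -
        (1 - z) * (\<Sum>l\<in>UNIV. ?u l * (1 - b l * cnj (b k)) / (1 - a l))"
      unfolding row1_def row2_def
      by (simp add: diff_divide_distrib ring_distribs sum_subtractf sum_distrib_left sum_distrib_right mult_ac)
    also have "\<dots> = (\<Sum>l\<in>UNIV. ?u l * P l k * (1 - z * cnj (a k)) - (1 - z) * (?u l * (1 - b l * cnj (b k)) / (1 - a l)))"
      unfolding m by (simp add: sum_subtractf sum_distrib_left sum_distrib_right)
    \<comment> \<open>The node factor comes from \<open>(1 - z * y) * (1 - x) - (1 - z) * (1 - x *
      y) = (z - x) * (1 - y)\<close> with \<open>x = a l\<close> and
      \<open>y = cnj (a k)\<close>.\<close>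
    also have "\<dots> = (\<Sum>l\<in>UNIV. ?u l * (z - a l) / (1 - a l) * P l k * (1 - cnj (a k)))"
    proof (intro sum.cong refl)
      fix l
      have nz: "1 - a l \<noteq> 0" "1 - a l * cnj (a k) \<noteq> 0" by simp_all
      have bb: "1 - b l * cnj (b k) = P l k * (1 - a l * cnj (a k))" using nz by (simp add: P)
      show "?u l * P l k * (1 - z * cnj (a k)) - (1 - z) * (?u l * (1 - b l * cnj (b k)) / (1 - a l)) =
        ?u l * (z - a l) / (1 - a l) * P l k * (1 - cnj (a k))"
        unfolding bb using nz(1) by (simp add: divide_simps) (simp add: algebra_simps)
    qed
    also have "\<dots> = (\<Sum>l\<in>UNIV. ?u l * (z - a l) / (1 - a l) * P l k) * (1 - cnj (a k))"
      by (simp add: sum_distrib_right)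
    finally show ?thesis using nzk by simp
  qed
  have "(\<Sum>k\<in>UNIV. (row1 z p q + row2 z p q * cnj (b k)) / (1 - cnj (a k)) * Q k l) =
    (\<Sum>j\<in>UNIV. ?u j * (z - a j) / (1 - a j) * (\<Sum>k\<in>UNIV. P j k * Q k l))"
    unfolding *[symmetric] sum_distrib_left sum_distrib_right
    by (subst sum.swap) (simp add: mult.assoc)
  also have "\<dots> = ?u l * (z - a l) / (1 - a l)" by (simp add: PQ if_distrib[of "\<lambda>x. _ * x"] cong: if_cong)
  finally show ?thesis by simp
qed

text \<open>Off the nodes, vanishing entries force \<open>u = 0\<close> by
  \<open>urow_of_rows\<close>, and for \<open>u = 0\<close> the entries are \<open>p\<close> and
  \<open>q\<close> themselves.\<close>

lemma rows_nonzero: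
  assumes z: "cmod z < 1" "z \<notin> range a" and "row1 z p q = 0" "row2 z p q = 0"
  shows "p = 0" "q = 0"
proof -
  have u: "urow z p q l = 0" for l
  proof -
    have "z - a l \<noteq> 0" using z(2) by auto
    thus ?thesis using urow_of_rows[OF z(1), of p q l] assms(3,4) by simp
  qed
  have "row1 z p q = p" "row2 z p q = q" by (simp_all add: row1_def row2_def u)
  thus "p = 0" "q = 0" using assms(3,4) by simp_all
qed

text \<open>Dividing \<open>urow_of_rows\<close> by \<open>z - a i\<close> and letting
  \<open>z\<close> tend to the node would give \<open>u\<close> a vanishing component
  \<open>i\<close>. But at the node the vector \<open>m\<close> for \<open>(1, - b i)\<close> is row
  \<open>i\<close> of \<open>P\<close>, so \<open>u\<close> is the unit vector of index
  \<open>i\<close>.\<close>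

lemma rows_simple_zero:
  assumes f: "isCont f (a i)" "f (a i) = b i" and h: "isCont h1 (a i)" "isCont h2 (a i)"
    and eq: "\<forall>\<^sub>F z in at (a i). row1 z 1 (- f z) = (z - a i) * h1 z \<and> row2 z 1 (- f z) = (z - a i) * h2 z"
    and 0: "h1 (a i) = 0" "h2 (a i) = 0"
  shows False
proof -
  let ?R = "\<lambda>z. (1 - a i) * (\<Sum>k\<in>UNIV. (h1 z + h2 z * cnj (b k)) / (1 - cnj (a k)) * Q k i)"
  have "\<forall>\<^sub>F z in at (a i). z \<in> ball 0 1 - {a i}"
    using a[of i] by (intro eventually_at_in_open) auto
  with eq have ev: "\<forall>\<^sub>F z in at (a i). urow z 1 (- f z) i = ?R z"
  proof eventually_elim
    case (elim z)
    have "urow z 1 (- f z) i * (z - a i) / (1 - a i) = 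
      (\<Sum>k\<in>UNIV. (z - a i) * ((h1 z + h2 z * cnj (b k)) / (1 - cnj (a k)) * Q k i))"
      by (subst urow_of_rows) (use elim in \<open>auto simp: ring_distribs mult_ac intro!: sum.cong\<close>)
    hence "(z - a i) * (urow z 1 (- f z) i / (1 - a i)) = (z - a i) *
      (\<Sum>k\<in>UNIV. (h1 z + h2 z * cnj (b k)) / (1 - cnj (a k)) * Q k i)"
      by (simp add: sum_distrib_left mult_ac)
    hence "urow z 1 (- f z) i / (1 - a i) = (\<Sum>k\<in>UNIV. (h1 z + h2 z * cnj (b k)) / (1 - cnj (a k)) * Q k i)"
      using elim(2) by (simp only: mult_cancel_left) auto
    thus ?case by (simp add: divide_eq_eq mult.commute)
  qed
  have "((\<lambda>z. urow z 1 (- f z) i) \<longlongrightarrow> urow (a i) 1 (- f (a i)) i) (at (a i))"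
    unfolding urow_def mrow_def using f(1) by (intro tendsto_intros) (auto simp: isCont_def)
  hence "(?R \<longlongrightarrow> urow (a i) 1 (- f (a i)) i) (at (a i))"
    using ev by (rule Lim_transform_eventually)
  moreover have "(?R \<longlongrightarrow> ?R (a i)) (at (a i))"
    using h by (intro tendsto_intros) (auto simp: isCont_def)
  ultimately have "urow (a i) 1 (- f (a i)) i = ?R (a i)"
    by (rule tendsto_unique[OF trivial_limit_at])
  hence "urow (a i) 1 (- b i) i = 0" using 0 f(2) by simp
  moreover have "urow (a i) 1 (- b i) i = 1"
    using PQ[of i i] by (simp add: urow_def mrow_def P)
  ultimately show False by simp
qed

text \<open>Weight 1 at the extra point \<open>z\<close> (index \<open>None\<close>) and weights
  \<open>- u\<close> at the nodes produce the Schur complement of \<open>P\<close> in the enlarged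
  Pick matrix: each mixed sum contributes minus the energy, the block \<open>P\<close> plus the
  energy.\<close>

lemma interpolant_row_bound:
  assumes f: "f holomorphic_on ball 0 1" "\<And>w. w \<in> ball 0 1 \<Longrightarrow> cmod (f w) \<le> 1"
    and fb: "\<And>i. f (a i) = b i" and z: "cmod z < 1"
  shows "cmod (row2 z 1 (- f z)) \<le> cmod (row1 z 1 (- f z))"
proof -
  let ?m = "mrow z 1 (- f z)" and ?u = "urow z 1 (- f z)" and ?E = "energy z 1 (- f z)"
  define x where "x = (\<lambda>i. case i of None \<Rightarrow> z | Some k \<Rightarrow> a k)"
  define c where "c = (\<lambda>i. case i of None \<Rightarrow> 1 | Some k \<Rightarrow> - ?u k)"
  have "0 \<le> Re (\<Sum>j\<in>UNIV. \<Sum>i\<in>UNIV. c j * cnj (c i) * ((1 - f (x j) * cnj (f (x i))) / (1 - x j * cnj (x i))))"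
    by (rule pick_form_nonneg[OF f]) (use a z in \<open>auto simp: x_def split: option.splits\<close>)
  also have "(\<Sum>j\<in>UNIV. \<Sum>i\<in>UNIV. c j * cnj (c i) * ((1 - f (x j) * cnj (f (x i))) / (1 - x j * cnj (x i)))) =
    (1 - f z * cnj (f z)) / (1 - z * cnj z) + (\<Sum>l\<in>UNIV. - cnj (?u l) * ((1 - f z * cnj (b l)) / (1 - z * cnj (a l)))) +
    (\<Sum>k\<in>UNIV. - ?u k * ((1 - b k * cnj (f z)) / (1 - a k * cnj z)) + (\<Sum>l\<in>UNIV. ?u k * cnj (?u l) * P k l))"
    by (simp add: UNIV_option_conv sum.reindex x_def c_def fb P)
  also have "(\<Sum>l\<in>UNIV. - cnj (?u l) * ((1 - f z * cnj (b l)) / (1 - z * cnj (a l)))) = - cnj ?E"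
    unfolding energy_def cnj_sum by (simp add: mrow_def sum_negf)
  also have "(\<Sum>k\<in>UNIV. - ?u k * ((1 - b k * cnj (f z)) / (1 - a k * cnj z)) + (\<Sum>l\<in>UNIV. ?u k * cnj (?u l) * P k l)) = - ?E + ?E"
    unfolding sum.distrib energy_eq_form[symmetric] by (simp add: energy_def mrow_def sum_negf mult.commute)
  finally have "0 \<le> Re ((1 - f z * cnj (f z)) / (1 - z * cnj z) - ?E)"
    by (simp add: energy_real)
  also have "(1 - f z * cnj (f z)) / (1 - z * cnj z) = complex_of_real ((1 - (cmod (f z))\<^sup>2) / (1 - (cmod z)\<^sup>2))"
    by (simp only: of_real_divide of_real_diff of_real_1 complex_norm_square)
  finally have "Re ?E \<le> (1 - (cmod (f z))\<^sup>2) / (1 - (cmod z)\<^sup>2)" by simp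
  moreover have pos: "1 - (cmod z)\<^sup>2 > 0" using z by (simp add: power_less_one_iff abs_square_less_1)
  ultimately have "(1 - (cmod z)\<^sup>2) * Re ?E \<le> 1 - (cmod (f z))\<^sup>2" by (simp add: field_simps)
  hence "(cmod (row2 z 1 (- f z)))\<^sup>2 \<le> (cmod (row1 z 1 (- f z)))\<^sup>2"
    using row_energy_norm[OF z, of 1 "- f z"] unfolding norm_one norm_minus_cancel power_one by linarith
  thus ?thesis by (rule power2_le_imp_le) simp
qed

end

section \<open>The interpolation problem over the ring\<close>

lemma kholo_at_const_term_isCont: "kholo_at f w \<Longrightarrow> isCont (\<lambda>z. const_term (f z)) w"
  unfolding const_term_def by (rule kholo_at_isCont)

lemma schur_function_const_termI:
  assumes "\<And>w. w \<in> ball 0 1 \<Longrightarrow> kholo_at f w" "\<And>z. z \<in> ball 0 1 \<Longrightarrow> cmod (const_term (f z)) \<le> 1"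
  shows "schur_function (\<lambda>z. const_term (f z))"
  using assms unfolding schur_function_def analytic_on_def kholo_at_def const_term_def by meson

lemma kschurI:
  assumes "f \<in> extensional (ball 0 1)" "\<And>w. w \<in> ball 0 1 \<Longrightarrow> kholo_at f w"
    "\<And>z. z \<in> ball 0 1 \<Longrightarrow> cmod (const_term (f z)) \<le> 1"
  shows "f \<in> kschur"
  using assms by (auto simp: kschur_def kanalytic_on_iff_kholo_at intro: schur_function_const_termI)

lemma kschurD:
  assumes "f \<in> kschur"
  shows "f \<in> extensional (ball 0 1)" "\<And>w. w \<in> ball 0 1 \<Longrightarrow> kholo_at f w"
    "\<And>z. z \<in> ball 0 1 \<Longrightarrow> cmod (const_term (f z)) \<le> 1"
  using assms by (auto simp: kschur_def kanalytic_on_iff_kholo_at schur_function_def)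

lemma kholo_at_restrict: "open S \<Longrightarrow> w \<in> S \<Longrightarrow> kholo_at f w \<Longrightarrow> kholo_at (restrict f S) w"
  by (rule kholo_at_cong[where f = f], assumption)
     (auto intro!: eventually_mono[OF eventually_nhds_in_open[of S]])

text \<open>\<open>v1\<close> and \<open>v2\<close> are the columns of \<open>P\<^sup>-\<^sup>1 (I - A\<^sup>*)\<^sup>-\<^sup>1 C\<^sup>* J\<close>, and \<open>P0\<close>, \<open>Q0\<close> the constant terms
  of \<open>P\<close> and its inverse.\<close>

locale ring_pick = scalar_pick "\<lambda>i. const_term (a i)" "\<lambda>i. const_term (b i)" P0 Q0
  for a b :: "'n::finite \<Rightarrow> kondratiev" and P0 Q0 :: "'n \<Rightarrow> 'n \<Rightarrow> complex" +
  fixes v1 v2 :: "'n \<Rightarrow> kondratiev"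
  assumes v1: "\<And>i. (\<Sum>j\<in>UNIV. (1 - b i * kstar (b j)) * inverse (1 - a i * kstar (a j)) * v1 j) = inverse (1 - a i)"
    and v2: "\<And>i. (\<Sum>j\<in>UNIV. (1 - b i * kstar (b j)) * inverse (1 - a i * kstar (a j)) * v2 j) = - b i * inverse (1 - a i)"
begin

text \<open>The diagonal entries of the resolvent \<open>(I - z A)^-1\<close>.\<close>

definition res :: "complex \<Rightarrow> 'n \<Rightarrow> kondratiev" where
  "res z j = inverse (1 - kconst z * kstar (a j))"

definition \<theta>11 :: "complex \<Rightarrow> kondratiev" where
  "\<theta>11 z = 1 - kconst (1 - z) * (\<Sum>j\<in>UNIV. res z j * v1 j)"

definition \<theta>12 :: "complex \<Rightarrow> kondratiev" where
  "\<theta>12 z = - kconst (1 - z) * (\<Sum>j\<in>UNIV. res z j * v2 j)"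

definition \<theta>21 :: "complex \<Rightarrow> kondratiev" where
  "\<theta>21 z = - kconst (1 - z) * (\<Sum>j\<in>UNIV. kstar (b j) * res z j * v1 j)"

definition \<theta>22 :: "complex \<Rightarrow> kondratiev" where
  "\<theta>22 z = 1 - kconst (1 - z) * (\<Sum>j\<in>UNIV. kstar (b j) * res z j * v2 j)"

lemma res_inverse: "cmod z < 1 \<Longrightarrow> res z j * (1 - kconst z * kstar (a j)) = 1"
  using kcoeff_inverse(2)[of "1 - kconst z * kstar (a j)"] by (simp add: res_def mult.commute)

lemma const_term_res: "cmod z < 1 \<Longrightarrow> const_term (res z j) = 1 / (1 - z * cnj (const_term (a j)))"
  by (simp add: res_def const_term_inverse divide_inverse)

lemma kholo_at_kconst_diff: "kholo_at (\<lambda>z. kconst (c - z)) w"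
  unfolding kconst_diff by (intro kholo_at_diff kholo_at_const kholo_at_kconst)

lemma kholo_at_res: "cmod w < 1 \<Longrightarrow> kholo_at (\<lambda>z. res z j) w"
  unfolding res_def by (intro kholo_at_inverse kholo_at_diff kholo_at_mult kholo_at_const kholo_at_kconst) auto

lemma kholo_at_uminus: "kholo_at f w \<Longrightarrow> kholo_at (\<lambda>z. - f z) w"
  using kholo_at_diff[OF kholo_at_const[of 0]] by simp

lemma kholo_at_\<theta>:
  assumes "cmod w < 1"
  shows "kholo_at \<theta>11 w" "kholo_at \<theta>12 w" "kholo_at \<theta>21 w" "kholo_at \<theta>22 w"
  unfolding \<theta>11_def[abs_def] \<theta>12_def[abs_def] \<theta>21_def[abs_def] \<theta>22_def[abs_def]
  by (intro kholo_at_diff kholo_at_uminus kholo_at_mult kholo_at_sum kholo_at_const kholo_at_kconst_diff kholo_at_res assms)+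

section \<open>Reduction of the matrix function to constant terms\<close>

lemma const_term_v:
  "const_term (v1 j) = (\<Sum>k\<in>UNIV. Q0 j k / (1 - const_term (a k)))"
  "const_term (v2 j) = - (\<Sum>k\<in>UNIV. Q0 j k * const_term (b k) / (1 - const_term (a k)))"
proof -
  have *: "c j = (\<Sum>i\<in>UNIV. Q0 j i * (\<Sum>k\<in>UNIV. P0 i k * c k))" for c :: "'n \<Rightarrow> complex"
  proof -
    have "(\<Sum>i\<in>UNIV. Q0 j i * (\<Sum>k\<in>UNIV. P0 i k * c k)) = (\<Sum>k\<in>UNIV. (\<Sum>i\<in>UNIV. Q0 j i * P0 i k) * c k)"
      unfolding sum_distrib_left sum_distrib_right by (subst sum.swap) (simp add: mult.assoc)
    thus ?thesis by (simp add: QP if_distrib[of "\<lambda>x. x * _"] cong: if_cong)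
  qed
  have c: "const_term ((1 - b i * kstar (b j)) * inverse (1 - a i * kstar (a j))) = P0 i j" for i j
    by (simp add: P const_term_inverse divide_inverse)
  have inv: "const_term (inverse (1 - a i)) = 1 / (1 - const_term (a i))" for i
    by (simp add: const_term_inverse divide_inverse)
  have 1: "(\<Sum>k\<in>UNIV. P0 i k * const_term (v1 k)) = 1 / (1 - const_term (a i))"
    "(\<Sum>k\<in>UNIV. P0 i k * const_term (v2 k)) = - const_term (b i) / (1 - const_term (a i))" for i
    using arg_cong[OF v1[of i], of const_term] arg_cong[OF v2[of i], of const_term] inv[of i]
    unfolding const_term_simps(8) const_term_mult c[symmetric] by simp_all
  show "const_term (v1 j) = (\<Sum>k\<in>UNIV. Q0 j k / (1 - const_term (a k)))"
    by (subst *) (simp add: 1)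
  show "const_term (v2 j) = - (\<Sum>k\<in>UNIV. Q0 j k * const_term (b k) / (1 - const_term (a k)))"
    by (subst *) (simp add: 1 sum_negf)
qed

text \<open>Taking constant terms is a ring homomorphism; interchanging the sums moves
  \<open>Q0\<close> from the columns \<open>v1\<close>, \<open>v2\<close> to \<open>mrow\<close>,
  where it forms \<open>urow\<close>.\<close>

lemma const_term_row:
  assumes "cmod z < 1"
  shows "p * const_term (\<theta>11 z) + q * const_term (\<theta>21 z) = row1 z p q"
    "p * const_term (\<theta>12 z) + q * const_term (\<theta>22 z) = row2 z p q"
proof -
  have sw: "(\<Sum>j\<in>UNIV. mrow z p q j * (\<Sum>k\<in>UNIV. Q0 j k * c k)) = (\<Sum>k\<in>UNIV. urow z p q k * c k)" for c
    unfolding urow_def sum_distrib_left sum_distrib_right by (subst sum.swap) (simp add: mult.assoc)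
  have m: "mrow z p q j = p * const_term (res z j) + q * (cnj (const_term (b j)) * const_term (res z j))" for j
    using assms by (simp add: mrow_def const_term_res add_divide_distrib)
  have mv: "(\<Sum>j\<in>UNIV. mrow z p q j * v j) = p * (\<Sum>j\<in>UNIV. const_term (res z j) * v j) +
      q * (\<Sum>j\<in>UNIV. cnj (const_term (b j)) * const_term (res z j) * v j)" for v
    by (simp add: m ring_distribs sum.distrib sum_distrib_left mult_ac)
  have "p * const_term (\<theta>11 z) + q * const_term (\<theta>21 z) = p - (1 - z) * (\<Sum>j\<in>UNIV. mrow z p q j * const_term (v1 j))"
    unfolding \<theta>11_def \<theta>21_def mv by (simp add: algebra_simps)
  also have "(\<Sum>j\<in>UNIV. mrow z p q j * const_term (v1 j)) = (\<Sum>k\<in>UNIV. urow z p q k / (1 - const_term (a k)))"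
    using sw[of "\<lambda>k. 1 / (1 - const_term (a k))"] by (simp add: const_term_v)
  finally show "p * const_term (\<theta>11 z) + q * const_term (\<theta>21 z) = row1 z p q" by (simp add: row1_def)
  have "p * const_term (\<theta>12 z) + q * const_term (\<theta>22 z) = q - (1 - z) * (\<Sum>j\<in>UNIV. mrow z p q j * const_term (v2 j))"
    unfolding \<theta>12_def \<theta>22_def mv by (simp add: algebra_simps)
  also have "(\<Sum>j\<in>UNIV. mrow z p q j * const_term (v2 j)) = - (\<Sum>k\<in>UNIV. urow z p q k * const_term (b k) / (1 - const_term (a k)))"
    using sw[of "\<lambda>k. const_term (b k) / (1 - const_term (a k))"] by (simp add: const_term_v sum_negf)
  finally show "p * const_term (\<theta>12 z) + q * const_term (\<theta>22 z) = row2 z p q" by (simp add: row2_def)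
qed

lemma denominator_const_term:
  assumes z: "cmod z < 1" and g: "cmod (const_term (g z)) \<le> 1"
  shows "const_term (\<theta>21 z * g z + \<theta>22 z) \<noteq> 0"
proof
  assume 0: "const_term (\<theta>21 z * g z + \<theta>22 z) = 0"
  have c: "row1 z 0 1 = const_term (\<theta>21 z)" "row2 z 0 1 = const_term (\<theta>22 z)"
    using const_term_row[OF z, of 0 1] by simp_all
  have "(1 - (cmod z)\<^sup>2) * Re (energy z 0 1) \<ge> 0"
    using z by (intro mult_nonneg_nonneg energy_nonneg) (simp add: power_le_one)
  hence "(cmod (const_term (\<theta>21 z)))\<^sup>2 < (cmod (const_term (\<theta>22 z)))\<^sup>2"
    using row_energy_norm[OF z, of 0 1] unfolding c by simp
  hence less: "cmod (const_term (\<theta>21 z)) < cmod (const_term (\<theta>22 z))" by (rule power_less_imp_less_base) simp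
  have "const_term (\<theta>22 z) = - (const_term (\<theta>21 z) * const_term (g z))"
    using 0 by (simp add: eq_neg_iff_add_eq_0 add.commute)
  hence "cmod (const_term (\<theta>22 z)) = cmod (const_term (\<theta>21 z)) * cmod (const_term (g z))" by (simp add: norm_mult)
  also have "\<dots> \<le> cmod (const_term (\<theta>21 z)) * 1" using g by (intro mult_left_mono) auto
  finally show False using less by simp
qed

definition lift :: "(complex \<Rightarrow> kondratiev) \<Rightarrow> complex \<Rightarrow> kondratiev" where
  "lift g = (\<lambda>z\<in>ball 0 1. (\<theta>11 z * g z + \<theta>12 z) * inverse (\<theta>21 z * g z + \<theta>22 z))"

text \<open>Clearing the unit denominator says that the row \<open>(1, - F) \<Theta>\<close>
  annihilates the column \<open>(g, 1)\<close>. This form bounds \<open>F\<close> when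
  \<open>g\<close> is known and can be solved for \<open>g\<close> when \<open>F\<close> is
  known.\<close>

lemma lift_eq_iff:
  assumes g: "cmod (const_term (g z)) \<le> 1" and z: "cmod z < 1"
  shows "lift g z = F \<longleftrightarrow> (\<theta>11 z - F * \<theta>21 z) * g z = F * \<theta>22 z - \<theta>12 z"
proof -
  let ?D = "\<theta>21 z * g z + \<theta>22 z" and ?N = "\<theta>11 z * g z + \<theta>12 z"
  have D: "?D * inverse ?D = 1" using denominator_const_term[OF z, of g, OF g] by (rule kcoeff_inverse(2))
  have lift: "lift g z = ?N * inverse ?D" using z by (simp add: lift_def)
  have "(lift g z = F) = (?N = F * ?D)"
  proof
    assume "lift g z = F"
    hence "F * ?D = (?N * inverse ?D) * ?D" unfolding lift by simp
    also have "\<dots> = ?N * (?D * inverse ?D)" by (simp only: mult.assoc mult.commute[of ?D])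
    finally show "?N = F * ?D" unfolding D by simp
  next
    assume eq: "?N = F * ?D"
    show "lift g z = F" unfolding lift eq mult.assoc D by simp
  qed
  moreover have "(\<theta>11 z - F * \<theta>21 z) * g z - (F * \<theta>22 z - \<theta>12 z) = ?N - F * ?D"
    by (simp add: algebra_simps)
  ultimately show ?thesis by (metis right_minus_eq)
qed

section \<open>The transform preserves the Schur class and interpolates\<close>

lemma kholo_at_lift:
  assumes "g \<in> kschur" "w \<in> ball 0 1"
  shows "kholo_at (lift g) w"
  unfolding lift_def using assms denominator_const_term[of w g] kschurD(2,3)[OF assms]
  by (intro kholo_at_restrict kholo_at_mult kholo_at_add kholo_at_inverse kholo_at_\<theta>) auto

lemma lift_const_term_le:
  assumes g: "cmod (const_term (g z)) \<le> 1" and z: "cmod z < 1"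
  shows "cmod (const_term (lift g z)) \<le> 1"
proof -
  define F where "F = const_term (lift g z)"
  have "(\<theta>11 z - lift g z * \<theta>21 z) * g z = lift g z * \<theta>22 z - \<theta>12 z"
    by (rule lift_eq_iff[of g z, OF g z, THEN iffD1, OF refl])
  from arg_cong[OF this, of const_term] have eq: "row1 z 1 (- F) * const_term (g z) = - row2 z 1 (- F)"
    by (simp add: const_term_row[OF z, symmetric] F_def)
  have "cmod (row2 z 1 (- F)) = cmod (row1 z 1 (- F)) * cmod (const_term (g z))"
    using arg_cong[OF eq, of cmod] by (simp add: norm_mult)
  also have "\<dots> \<le> cmod (row1 z 1 (- F)) * 1" using g by (intro mult_left_mono) auto
  finally have "(cmod (row2 z 1 (- F)))\<^sup>2 \<le> (cmod (row1 z 1 (- F)))\<^sup>2" by (intro power_mono) auto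
  moreover have "(1 - (cmod z)\<^sup>2) * Re (energy z 1 (- F)) \<ge> 0"
    using z by (intro mult_nonneg_nonneg energy_nonneg) (simp add: power_le_one)
  ultimately have "(cmod F)\<^sup>2 \<le> 1\<^sup>2" using row_energy_norm[OF z, of 1 "- F"]
    unfolding norm_one norm_minus_cancel power_one by linarith
  thus ?thesis unfolding F_def by (rule power2_le_imp_le) simp
qed

lemma lift_kschur:
  assumes "g \<in> kschur"
  shows "lift g \<in> kschur"
proof (rule kschurI)
  show "lift g \<in> extensional (ball 0 1)" by (simp add: lift_def)
  show "cmod (const_term (lift g z)) \<le> 1" if "z \<in> ball 0 1" for z
    using that assms by (intro lift_const_term_le kschurD) auto
qed (use assms kholo_at_lift in auto)

text \<open>Together with \<open>quot2\<close>, the explicit cofactor of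
  \<open>kconst z - a i\<close> in the row \<open>(1, - b i) \<Theta>\<close>, so its analyticity
  needs no division.\<close>

definition quot1 :: "'n \<Rightarrow> complex \<Rightarrow> kondratiev" where
  "quot1 i z = (\<Sum>j\<in>UNIV. (1 - b i * kstar (b j)) * inverse (1 - a i * kstar (a j)) * (1 - kstar (a j)) * res z j * v1 j)"

definition quot2 :: "'n \<Rightarrow> complex \<Rightarrow> kondratiev" where
  "quot2 i z = (\<Sum>j\<in>UNIV. (1 - b i * kstar (b j)) * inverse (1 - a i * kstar (a j)) * (1 - kstar (a j)) * res z j * v2 j)"

lemma kholo_at_quot: "cmod w < 1 \<Longrightarrow> kholo_at (quot1 i) w" "cmod w < 1 \<Longrightarrow> kholo_at (quot2 i) w"
  unfolding quot1_def[abs_def] quot2_def[abs_def]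
  by (intro kholo_at_sum kholo_at_mult kholo_at_const kholo_at_res; assumption)+

text \<open>The equations for \<open>v1\<close> and \<open>v2\<close> rewrite the leading terms
  \<open>1\<close> and \<open>- b i\<close> as sums over \<open>j\<close> with the same numerators
  as the resolvent sums. Termwise, \<open>(1 - x) / (1 - x * y) - (1 - z) / (1 - z * y)\<close>
  equals \<open>(z - x) * (1 - y) / ((1 - x * y) * (1 - z * y))\<close>, with \<open>x = a i\<close>
  and \<open>y = kstar (a j)\<close>.\<close>

lemma node_factor:
  assumes z: "cmod z < 1"
  shows "\<theta>11 z - b i * \<theta>21 z = (kconst z - a i) * quot1 i z"
    "\<theta>12 z - b i * \<theta>22 z = (kconst z - a i) * quot2 i z"
proof -
  let ?y = "\<lambda>j. inverse (1 - a i * kstar (a j))"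
  let ?c = "\<lambda>j. 1 - b i * kstar (b j)"
  let ?Z = "kconst z"
  have y: "?y j * (1 - a i * kstar (a j)) = 1" for j
    using kcoeff_inverse(2)[of "1 - a i * kstar (a j)"] by (simp add: mult.commute)
  have ai: "(1 - a i) * inverse (1 - a i) = 1" using kcoeff_inverse(2)[of "1 - a i"] by simp
  have key: "(1 - a i) * ?y j - (1 - ?Z) * res z j = (?Z - a i) * (?y j * (1 - kstar (a j)) * res z j)" for j
  proof -
    have "(1 - a i) * ?y j - (1 - ?Z) * res z j = (1 - a i) * ?y j * (res z j * (1 - ?Z * kstar (a j)))
        - (1 - ?Z) * res z j * (?y j * (1 - a i * kstar (a j)))"
      by (simp only: y res_inverse[OF z] mult_1_right)
    also have "\<dots> = (?Z - a i) * (?y j * (1 - kstar (a j)) * res z j)"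
      by (simp add: algebra_simps)
    finally show ?thesis .
  qed
  have sum_key: "(1 - a i) * (\<Sum>j\<in>UNIV. ?c j * ?y j * v j) - (1 - ?Z) * (\<Sum>j\<in>UNIV. ?c j * res z j * v j) =
      (?Z - a i) * (\<Sum>j\<in>UNIV. ?c j * ?y j * (1 - kstar (a j)) * res z j * v j)" for v
  proof -
    have "(1 - a i) * (\<Sum>j\<in>UNIV. ?c j * ?y j * v j) - (1 - ?Z) * (\<Sum>j\<in>UNIV. ?c j * res z j * v j) =
        (\<Sum>j\<in>UNIV. ?c j * v j * ((1 - a i) * ?y j - (1 - ?Z) * res z j))"
      by (simp add: sum_distrib_left sum_subtractf[symmetric] algebra_simps)
    also have "\<dots> = (?Z - a i) * (\<Sum>j\<in>UNIV. ?c j * ?y j * (1 - kstar (a j)) * res z j * v j)"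
      unfolding key sum_distrib_left by (simp add: mult_ac)
    finally show ?thesis .
  qed
  have split: "(\<Sum>j\<in>UNIV. ?c j * res z j * v j) =
      (\<Sum>j\<in>UNIV. res z j * v j) - b i * (\<Sum>j\<in>UNIV. kstar (b j) * res z j * v j)" for v
    by (simp add: sum_distrib_left sum_subtractf[symmetric] algebra_simps)
  have "\<theta>11 z - b i * \<theta>21 z = 
      (1 - a i) * (\<Sum>j\<in>UNIV. ?c j * ?y j * v1 j) - (1 - ?Z) * (\<Sum>j\<in>UNIV. ?c j * res z j * v1 j)"
    unfolding v1 ai split \<theta>11_def \<theta>21_def by (simp add: kconst_diff algebra_simps)
  thus "\<theta>11 z - b i * \<theta>21 z = (kconst z - a i) * quot1 i z" unfolding sum_key quot1_def .
  have "(1 - a i) * (\<Sum>j\<in>UNIV. ?c j * ?y j * v2 j) = - b i * ((1 - a i) * inverse (1 - a i))"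
    unfolding v2 by (simp only: mult_ac)
  hence bi: "(1 - a i) * (\<Sum>j\<in>UNIV. ?c j * ?y j * v2 j) = - b i" unfolding ai by simp
  have "\<theta>12 z - b i * \<theta>22 z =
      (1 - a i) * (\<Sum>j\<in>UNIV. ?c j * ?y j * v2 j) - (1 - ?Z) * (\<Sum>j\<in>UNIV. ?c j * res z j * v2 j)"
    unfolding bi split \<theta>12_def \<theta>22_def by (simp add: kconst_diff algebra_simps)
  thus "\<theta>12 z - b i * \<theta>22 z = (kconst z - a i) * quot2 i z" unfolding sum_key quot2_def .
qed

lemma eventually_disk: "w \<in> ball 0 1 \<Longrightarrow> \<forall>\<^sub>F z in nhds w. cmod z < 1"
  using eventually_nhds_in_open[of "ball 0 1" w] by simp

lemma lift_interpolates:
  assumes g: "g \<in> kschur"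
  shows "kevaluate (lift g) (a i) = b i"
proof -
  let ?w = "const_term (a i)"
  have w: "?w \<in> ball 0 1" using a[of i] by simp
  let ?D = "\<lambda>z. \<theta>21 z * g z + \<theta>22 z"
  let ?q = "\<lambda>z. (quot1 i z * g z + quot2 i z) * inverse (?D z)"
  show ?thesis
  proof (rule kevaluate_eqI)
    show "kholo_at (lift g) ?w" using g w by (rule kholo_at_lift)
    show "kholo_at ?q ?w"
      using w kschurD(2,3)[OF g] denominator_const_term[of ?w g]
      by (intro kholo_at_mult kholo_at_add kholo_at_inverse kholo_at_\<theta> kholo_at_quot) auto
    show "\<forall>\<^sub>F z in nhds ?w. lift g z = b i + (kconst z - a i) * ?q z"
      using eventually_disk[OF w]
    proof eventually_elim
      case (elim z)
      have D: "?D z * inverse (?D z) = 1"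
        using denominator_const_term[OF elim] kschurD(3)[OF g] elim by (intro kcoeff_inverse(2)) auto
      have "(kconst z - a i) * (quot1 i z * g z + quot2 i z) =
          (\<theta>11 z - b i * \<theta>21 z) * g z + (\<theta>12 z - b i * \<theta>22 z)"
        unfolding node_factor[OF elim] by (simp add: algebra_simps)
      also have "\<dots> = (\<theta>11 z * g z + \<theta>12 z) - b i * ?D z" by (simp add: algebra_simps)
      finally have eq: "(kconst z - a i) * (quot1 i z * g z + quot2 i z) = (\<theta>11 z * g z + \<theta>12 z) - b i * ?D z" .
      have "(kconst z - a i) * ?q z = (kconst z - a i) * (quot1 i z * g z + quot2 i z) * inverse (?D z)"
        by (simp only: mult.assoc)
      also have "\<dots> = (\<theta>11 z * g z + \<theta>12 z) * inverse (?D z) - b i * (?D z * inverse (?D z))"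
        unfolding eq by (simp only: left_diff_distrib mult.assoc)
      finally have "(kconst z - a i) * ?q z =
        (\<theta>11 z * g z + \<theta>12 z) * inverse (?D z) - b i * (?D z * inverse (?D z))" .
      thus ?case using elim by (simp add: D lift_def)
    qed
  qed simp
qed

section \<open>Injectivity and surjectivity of the transform\<close>

lemma eventually_not_node: "\<forall>\<^sub>F z in at w. z \<notin> range (\<lambda>i. const_term (a i))"
proof -
  have "\<forall>\<^sub>F z in at w. z \<in> - (range (\<lambda>i. const_term (a i)) - {w}) - {w}"
    by (intro eventually_at_in_open open_Compl finite_imp_closed finite_Diff) auto
  thus ?thesis by eventually_elim auto
qed

lemma interpolant_unit:
  assumes z: "cmod z < 1" "z \<notin> range (\<lambda>i. const_term (a i))"
    and le: "cmod (row2 z 1 (- const_term F)) \<le> cmod (row1 z 1 (- const_term F))"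
  shows "const_term (\<theta>11 z - F * \<theta>21 z) \<noteq> 0"
proof
  assume "const_term (\<theta>11 z - F * \<theta>21 z) = 0"
  hence "row1 z 1 (- const_term F) = 0" by (simp add: const_term_row[OF z(1), symmetric])
  with le rows_nonzero[OF z this] show False by simp
qed

text \<open>Nodes are isolated, so equality extends across them by continuity; limits are compared
  coefficient by coefficient in the complex numbers.\<close>

lemma kschur_eqI:
  assumes "g \<in> kschur" "h \<in> kschur"
    and "\<And>z. cmod z < 1 \<Longrightarrow> z \<notin> range (\<lambda>i. const_term (a i)) \<Longrightarrow> g z = h z"
  shows "g = h"
proof (rule extensionalityI)
  show "g \<in> extensional (ball 0 1)" "h \<in> extensional (ball 0 1)" using assms kschurD by auto
  fix w :: complex assume w: "w \<in> ball 0 1"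
  show "g w = h w"
  proof (rule kondratiev_eqI)
    fix \<alpha>
    have "((\<lambda>z. kcoeff (g z) \<alpha>) \<longlongrightarrow> kcoeff (g w) \<alpha>) (at w)"
      using kholo_at_isCont[OF kschurD(2)[OF assms(1) w]] by (simp add: isCont_def)
    moreover have "\<forall>\<^sub>F z in at w. cmod z < 1"
      using eventually_disk[OF w] by (simp add: eventually_at_filter eventually_mono)
    hence "\<forall>\<^sub>F z in at w. kcoeff (g z) \<alpha> = kcoeff (h z) \<alpha>"
      using eventually_not_node[of w] by eventually_elim (simp add: assms(3))
    ultimately have "((\<lambda>z. kcoeff (h z) \<alpha>) \<longlongrightarrow> kcoeff (g w) \<alpha>) (at w)"
      by (rule Lim_transform_eventually)
    moreover have "((\<lambda>z. kcoeff (h z) \<alpha>) \<longlongrightarrow> kcoeff (h w) \<alpha>) (at w)"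
      using kholo_at_isCont[OF kschurD(2)[OF assms(2) w]] by (simp add: isCont_def)
    ultimately show "kcoeff (g w) \<alpha> = kcoeff (h w) \<alpha>" by (rule tendsto_unique[OF trivial_limit_at])
  qed
qed

lemma mult_unit_cancel:
  fixes D x y :: kondratiev
  assumes "const_term D \<noteq> 0" "D * x = D * y"
  shows "x = y"
  using assms kcoeff_inverse(2)[of D] by (metis mult.assoc mult.commute mult.right_neutral)

lemma inj_on_lift: "inj_on lift kschur"
proof (rule inj_onI)
  fix g h assume g: "g \<in> kschur" and h: "h \<in> kschur" and eq: "lift g = lift h"
  show "g = h"
  proof (rule kschur_eqI[OF g h])
    fix z assume z: "cmod z < 1" "z \<notin> range (\<lambda>i. const_term (a i))"
    define F where "F = lift g z"
    have gz: "cmod (const_term (g z)) \<le> 1" and hz: "cmod (const_term (h z)) \<le> 1"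
      using z g h by (auto intro: kschurD)
    have eqs: "(\<theta>11 z - F * \<theta>21 z) * g z = F * \<theta>22 z - \<theta>12 z" "(\<theta>11 z - F * \<theta>21 z) * h z = F * \<theta>22 z - \<theta>12 z"
      using lift_eq_iff[of g z, OF gz z(1)] lift_eq_iff[of h z, OF hz z(1)] eq by (auto simp: F_def)
    have "const_term (\<theta>11 z - F * \<theta>21 z) \<noteq> 0"
    proof (rule interpolant_unit[OF z])
      have "row1 z 1 (- const_term F) * const_term (g z) = - row2 z 1 (- const_term F)"
        using arg_cong[OF eqs(1), of const_term] by (simp add: const_term_row[OF z(1), symmetric])
      hence "cmod (row2 z 1 (- const_term F)) = cmod (row1 z 1 (- const_term F)) * cmod (const_term (g z))"
        by (metis norm_minus_cancel norm_mult)
      also have "\<dots> \<le> cmod (row1 z 1 (- const_term F)) * 1" using gz by (intro mult_left_mono) auto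
      finally show "cmod (row2 z 1 (- const_term F)) \<le> cmod (row1 z 1 (- const_term F))" by simp
    qed
    thus "g z = h z" by (rule mult_unit_cancel) (simp add: eqs)
  qed
qed

text \<open>At \<open>z = const_term (a i)\<close> the factor \<open>kconst z - a i\<close> has
  constant term 0, so evaluation in the ring induces scalar interpolation of the constant terms, to
  which Pick's inequality applies.\<close>

lemma interpolant_const_term:
  assumes f: "f \<in> kschur" "\<And>i. kevaluate f (a i) = b i"
  shows "(\<lambda>z. const_term (f z)) holomorphic_on ball 0 1" "const_term (f (const_term (a i))) = const_term (b i)"
    "cmod z < 1 \<Longrightarrow> cmod (row2 z 1 (- const_term (f z))) \<le> cmod (row1 z 1 (- const_term (f z)))"
proof -
  show holo: "(\<lambda>z. const_term (f z)) holomorphic_on ball 0 1"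
    using f(1) by (simp add: kschur_def schur_function_def analytic_on_open)
  show eq: "const_term (f (const_term (a i))) = const_term (b i)" for i
  proof -
    have "kholo_at f (const_term (a i))" using f(1) a[of i] by (intro kschurD) auto
    then obtain q where
      "\<forall>\<^sub>F z in nhds (const_term (a i)). f z = kevaluate f (a i) + (kconst z - a i) * q z"
      by (rule kevaluate_factor) auto
    from eventually_nhds_x_imp_x[OF this] show ?thesis by (simp add: f(2))
  qed
  show "cmod (row2 z 1 (- const_term (f z))) \<le> cmod (row1 z 1 (- const_term (f z)))" if "cmod z < 1"
    using interpolant_row_bound[OF holo _ eq that] kschurD(3)[OF f(1)] by auto
qed

text \<open>Near a node both \<open>\<theta>11 - f \<theta>21\<close> and \<open>f \<theta>22 - \<theta>12\<close> contain the factor \<open>kconst z - a i\<close>; after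
  dividing it out the former is a unit because the zero at the node is simple.\<close>

lemma local_preimage:
  assumes f: "f \<in> kschur" "\<And>i. kevaluate f (a i) = b i"
  obtains h where "kholo_at h (const_term (a i))"
    "\<forall>\<^sub>F z in nhds (const_term (a i)). (\<theta>11 z - f z * \<theta>21 z) * h z = f z * \<theta>22 z - \<theta>12 z"
proof -
  define w where "w = const_term (a i)"
  have w: "w \<in> ball 0 1" "cmod w < 1" using a[of i] by (auto simp: w_def)
  have fw: "kholo_at f w" using f(1) w(1) by (rule kschurD)
  then obtain q where q: "kholo_at q w" "\<forall>\<^sub>F z in nhds w. f z = kevaluate f (a i) + (kconst z - a i) * q z"
    by (rule kevaluate_factor) (auto simp: w_def)
  let ?D1 = "\<lambda>z. quot1 i z - q z * \<theta>21 z" and ?N1 = "\<lambda>z. q z * \<theta>22 z - quot2 i z"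
  have factor: "\<forall>\<^sub>F z in nhds w. \<theta>11 z - f z * \<theta>21 z = (kconst z - a i) * ?D1 z \<and>
      f z * \<theta>22 z - \<theta>12 z = (kconst z - a i) * ?N1 z"
    using q(2) eventually_disk[OF w(1)]
  proof eventually_elim
    case (elim z)
    have fz: "f z = b i + (kconst z - a i) * q z" using elim(1) by (simp add: f(2))
    have "\<theta>11 z - f z * \<theta>21 z = (\<theta>11 z - b i * \<theta>21 z) - (kconst z - a i) * q z * \<theta>21 z"
      unfolding fz by (simp only: distrib_right diff_diff_eq)
    moreover have "f z * \<theta>22 z - \<theta>12 z = (kconst z - a i) * q z * \<theta>22 z - (\<theta>12 z - b i * \<theta>22 z)"
      unfolding fz by (simp add: distrib_right)
    ultimately show ?case
      unfolding node_factor[OF elim(2)] by (simp only: right_diff_distrib mult.assoc simp_thms)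
  qed
  have holo: "kholo_at ?D1 w" "kholo_at ?N1 w"
    by (intro kholo_at_diff kholo_at_mult kholo_at_quot kholo_at_\<theta> w q)+
  let ?d = "\<lambda>z. const_term (?D1 z)" and ?n = "\<lambda>z. const_term (?N1 z)"
  have cont: "isCont ?d w" "isCont ?n w" by (rule kholo_at_const_term_isCont, rule holo)+
  have rows: "\<forall>\<^sub>F z in nhds w. cmod z < 1 \<and> row1 z 1 (- const_term (f z)) = (z - w) * ?d z \<and>
      row2 z 1 (- const_term (f z)) = (z - w) * (- ?n z)"
    using factor eventually_disk[OF w(1)]
  proof eventually_elim
    case (elim z)
    have "row1 z 1 (- const_term (f z)) = const_term (\<theta>11 z - f z * \<theta>21 z)"
      "row2 z 1 (- const_term (f z)) = - const_term (f z * \<theta>22 z - \<theta>12 z)"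
      by (simp_all add: const_term_row[OF elim(2), symmetric])
    thus ?case using elim by (simp add: w_def flip: mult_minus_right)
  qed
  hence rows': "\<forall>\<^sub>F z in at w. cmod z < 1 \<and> row1 z 1 (- const_term (f z)) = (z - w) * ?d z \<and>
      row2 z 1 (- const_term (f z)) = (z - w) * (- ?n z)"
    by (auto simp: eventually_at_filter elim: eventually_mono)
  \<comment> \<open>Pick's inequality off the node, divided by the modulus of \<open>z - w\<close>,
    passes to the limit. A zero of \<open>?d\<close> at \<open>w\<close> would therefore force a
    zero of \<open>?n\<close> as well, which \<open>rows_simple_zero\<close> excludes.\<close>
  have "?d w \<noteq> 0"
  proof
    assume d0: "?d w = 0"
    have "\<forall>\<^sub>F z in at w. cmod (?n z) \<le> cmod (?d z)"
      using rows' eventually_neq_at_within[of w w UNIV]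
    proof eventually_elim
      case (elim z)
      hence "cmod ((z - w) * (- ?n z)) \<le> cmod ((z - w) * ?d z)"
        using interpolant_const_term(3)[OF f, of z] by metis
      hence "cmod (z - w) * cmod (?n z) \<le> cmod (z - w) * cmod (?d z)"
        unfolding norm_mult norm_minus_cancel .
      thus ?case using elim(2) by (subst (asm) mult_le_cancel_left_pos) auto
    qed
    moreover have "((\<lambda>z. cmod (?n z)) \<longlongrightarrow> cmod (?n w)) (at w)" "((\<lambda>z. cmod (?d z)) \<longlongrightarrow> cmod (?d w)) (at w)"
      by (rule tendsto_norm[OF cont(2)[unfolded isCont_def]], rule tendsto_norm[OF cont(1)[unfolded isCont_def]])
    ultimately have "cmod (?n w) \<le> cmod (?d w)"
      by (intro tendsto_le[OF trivial_limit_at, of "\<lambda>z. cmod (?d z)" _ w "\<lambda>z. cmod (?n z)"])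
    hence n0: "?n w = 0" using d0 by simp
    show False
    proof (rule rows_simple_zero[of i "\<lambda>z. const_term (f z)" ?d "\<lambda>z. - ?n z"])
      show "isCont (\<lambda>z. const_term (f z)) (const_term (a i))"
        using fw unfolding w_def by (rule kholo_at_const_term_isCont)
      show "const_term (f (const_term (a i))) = const_term (b i)" by (rule interpolant_const_term[OF f])
      show "isCont ?d (const_term (a i))" "isCont (\<lambda>z. - ?n z) (const_term (a i))"
        using cont(1) continuous_minus[OF cont(2)] unfolding w_def by blast+
      show "\<forall>\<^sub>F z in at (const_term (a i)). row1 z 1 (- const_term (f z)) = (z - const_term (a i)) * ?d z \<and>
        row2 z 1 (- const_term (f z)) = (z - const_term (a i)) * - ?n z"
        using rows' unfolding w_def by eventually_elim blast
      show "?d (const_term (a i)) = 0" "- ?n (const_term (a i)) = 0" using d0 n0 by (simp_all add: w_def)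
    qed
  qed
  moreover have "(?d \<longlongrightarrow> ?d w) (nhds w)"
    using cont(1) tendsto_at_iff_tendsto_nhds[of ?d w] by (simp only: isCont_def)
  ultimately have nz: "\<forall>\<^sub>F z in nhds w. ?d z \<noteq> 0"
    by (intro tendsto_imp_eventually_ne)
  show ?thesis
  proof (rule that[of "\<lambda>z. ?N1 z * inverse (?D1 z)"])
    show "kholo_at (\<lambda>z. ?N1 z * inverse (?D1 z)) (const_term (a i))"
      using holo \<open>?d w \<noteq> 0\<close> unfolding w_def by (intro kholo_at_mult kholo_at_inverse)
    show "\<forall>\<^sub>F z in nhds (const_term (a i)).
      (\<theta>11 z - f z * \<theta>21 z) * (?N1 z * inverse (?D1 z)) = f z * \<theta>22 z - \<theta>12 z"
      using factor nz unfolding w_def[symmetric]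
    proof eventually_elim
      case (elim z)
      have "(\<theta>11 z - f z * \<theta>21 z) * (?N1 z * inverse (?D1 z)) = (kconst z - a i) * ?N1 z * (?D1 z * inverse (?D1 z))"
        using elim(1) by (simp only: mult_ac simp_thms)
      thus ?case using kcoeff_inverse(2)[OF elim(2)] elim(1) by simp
    qed
  qed
qed

text \<open>The linear equation for \<open>g\<close> is solved by division off the nodes and by
  local preimages at them. Near a node both solutions agree wherever the coefficient
  \<open>?D\<close> is a unit, so the glued function is analytic.\<close>

lemma lift_surj:
  assumes f: "f \<in> kschur" "\<And>i. kevaluate f (a i) = b i"
  obtains g where "g \<in> kschur" "lift g = f"
proof -
  let ?R = "range (\<lambda>i. const_term (a i))"
  let ?D = "\<lambda>z. \<theta>11 z - f z * \<theta>21 z" and ?N = "\<lambda>z. f z * \<theta>22 z - \<theta>12 z"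
  have "\<forall>w\<in>?R. \<exists>h. kholo_at h w \<and> (\<forall>\<^sub>F z in nhds w. ?D z * h z = ?N z)"
  proof
    fix w assume "w \<in> ?R"
    then obtain i where w: "w = const_term (a i)" by blast
    obtain h where "kholo_at h (const_term (a i))"
      "\<forall>\<^sub>F z in nhds (const_term (a i)). ?D z * h z = ?N z"
      by (rule local_preimage[OF f]) blast
    thus "\<exists>h. kholo_at h w \<and> (\<forall>\<^sub>F z in nhds w. ?D z * h z = ?N z)" unfolding w by blast
  qed
  from bchoice[OF this] obtain G where G: "\<And>w. w \<in> ?R \<Longrightarrow> kholo_at (G w) w"
    "\<And>w. w \<in> ?R \<Longrightarrow> \<forall>\<^sub>F z in nhds w. ?D z * G w z = ?N z" by blast
  \<comment> \<open>At a node \<open>?D\<close> is not a unit and \<open>inverse\<close> would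
    return its default value 0, so the value is taken from the local solution.\<close>
  define g where "g z = (if z \<in> ?R then G z z else ?N z * inverse (?D z))" for z
  have unit: "const_term (?D z) \<noteq> 0" if "cmod z < 1" "z \<notin> ?R" for z
    using that interpolant_const_term(3)[OF f that(1)] by (rule interpolant_unit)
  have eq: "?D z * g z = ?N z" if z: "cmod z < 1" for z
  proof (cases "z \<in> ?R")
    case True
    thus ?thesis using eventually_nhds_x_imp_x[OF G(2)[OF True]] by (simp add: g_def)
  next
    case False
    have "?D z * (?N z * inverse (?D z)) = ?N z * (?D z * inverse (?D z))" by (simp only: mult_ac)
    thus ?thesis using False kcoeff_inverse(2)[OF unit[OF z False]] by (simp add: g_def)
  qed
  have holo: "kholo_at g w" if w: "w \<in> ball 0 1" for w
  proof (cases "w \<in> ?R")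
    case True
    have "\<forall>\<^sub>F z in nhds w. z \<noteq> w \<longrightarrow> z \<notin> ?R"
      using eventually_not_node[of w] by (simp add: eventually_at_filter)
    with G(2)[OF True] eventually_disk[OF w] have "\<forall>\<^sub>F z in nhds w. G w z = g z"
    proof eventually_elim
      case (elim z)
      show ?case
      proof (cases "z = w")
        case False
        with elim(3) have "z \<notin> ?R" by simp
        hence "const_term (?D z) \<noteq> 0" by (rule unit[OF elim(2)])
        thus ?thesis
          by (rule mult_unit_cancel) (simp add: elim(1) eq[OF elim(2)])
      qed (use True in \<open>simp add: g_def\<close>)
    qed
    with G(1)[OF True] show ?thesis by (rule kholo_at_cong)
  next
    case False
    have "open (ball 0 1 - ?R)" by (intro open_Diff finite_imp_closed) auto
    hence "\<forall>\<^sub>F z in nhds w. z \<in> ball 0 1 - ?R" using w False by (intro eventually_nhds_in_open) auto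
    hence "\<forall>\<^sub>F z in nhds w. ?N z * inverse (?D z) = g z" by eventually_elim (simp add: g_def)
    moreover have "kholo_at (\<lambda>z. ?N z * inverse (?D z)) w"
      using w False unit[of w] kschurD(2)[OF f(1) w]
      by (intro kholo_at_mult kholo_at_inverse kholo_at_diff kholo_at_\<theta>) auto
    ultimately show ?thesis using kholo_at_cong by blast
  qed
  have off: "cmod (const_term (g z)) \<le> 1" if z: "cmod z < 1" "z \<notin> ?R" for z
  proof -
    have "row1 z 1 (- const_term (f z)) * const_term (g z) = - row2 z 1 (- const_term (f z))"
      using arg_cong[OF eq[OF z(1)], of const_term] by (simp add: const_term_row[OF z(1), symmetric])
    hence "cmod (row1 z 1 (- const_term (f z))) * cmod (const_term (g z)) = cmod (row2 z 1 (- const_term (f z)))"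
      by (metis norm_minus_cancel norm_mult)
    also have "\<dots> \<le> cmod (row1 z 1 (- const_term (f z))) * 1"
      using interpolant_const_term(3)[OF f z(1)] by simp
    finally have "cmod (row1 z 1 (- const_term (f z))) * cmod (const_term (g z)) \<le> cmod (row1 z 1 (- const_term (f z))) * 1" .
    moreover have "row1 z 1 (- const_term (f z)) \<noteq> 0"
      using unit[OF z] by (simp add: const_term_row[OF z(1), symmetric])
    ultimately show ?thesis by (metis mult_le_cancel_left_pos zero_less_norm_iff)
  qed
  \<comment> \<open>At a node the bound is inherited by continuity from a punctured
    neighbourhood.\<close>
  have le: "cmod (const_term (g w)) \<le> 1" if w: "w \<in> ball 0 1" for w
  proof (rule tendsto_upperbound)
    show "((\<lambda>z. cmod (const_term (g z))) \<longlongrightarrow> cmod (const_term (g w))) (at w)"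
      using kholo_at_const_term_isCont[OF holo[OF w]] by (auto simp: isCont_def intro: tendsto_norm)
    have "\<forall>\<^sub>F z in at w. cmod z < 1"
      using eventually_disk[OF w] by (simp add: eventually_at_filter eventually_mono)
    thus "\<forall>\<^sub>F z in at w. cmod (const_term (g z)) \<le> 1"
      using eventually_not_node[of w] by eventually_elim (rule off)
  qed simp
  let ?g = "restrict g (ball 0 1)"
  have gs: "?g \<in> kschur"
    by (rule kschurI) (auto intro!: kholo_at_restrict holo le)
  moreover have "lift ?g = f"
  proof (rule extensionalityI)
    show "lift ?g \<in> extensional (ball 0 1)" by (simp add: lift_def)
    show "f \<in> extensional (ball 0 1)" using f(1) by (rule kschurD)
    fix z :: complex assume z: "z \<in> ball 0 1"
    hence "lift ?g z = f z \<longleftrightarrow> ?D z * ?g z = ?N z"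
      using le[OF z] by (intro lift_eq_iff) auto
    thus "lift ?g z = f z" using eq[of z] z by simp
  qed
  ultimately show ?thesis by (rule that)
qed

theorem bij_betw_lift: "bij_betw lift kschur {f \<in> kschur. \<forall>i. kevaluate f (a i) = b i}"
  unfolding bij_betw_def
proof (intro conjI inj_on_lift equalityI subsetI)
  show "f \<in> {f \<in> kschur. \<forall>i. kevaluate f (a i) = b i}" if "f \<in> lift ` kschur" for f
    using that lift_kschur lift_interpolates by auto
  show "f \<in> lift ` kschur" if "f \<in> {f \<in> kschur. \<forall>i. kevaluate f (a i) = b i}" for f
    using that lift_surj[of f] by (metis (mono_tags, lifting) image_eqI mem_Collect_eq)
qed

end

section \<open>Matrices over the ring\<close>

lemma matrix_inv_right:
  fixes M :: "'a::semiring_1 ^ 'n ^ 'n"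
  assumes "invertible M"
  shows "M ** matrix_inv M = mat 1" "matrix_inv M ** M = mat 1"
  using someI_ex[OF assms[unfolded invertible_def]] unfolding matrix_inv_def by auto

lemma matrix_inv_eqI:
  fixes M N :: "'a::semiring_1 ^ 'n ^ 'n"
  assumes "M ** N = mat 1" "N ** M = mat 1"
  shows "matrix_inv M = N"
proof -
  have "invertible M" using assms by (auto simp: invertible_def)
  from matrix_inv_right[OF this] assms show ?thesis
    by (metis matrix_mul_assoc matrix_mul_lid matrix_mul_rid)
qed

lemma matrix_inv_diagonal:
  fixes d e :: "'n::finite \<Rightarrow> 'a::comm_ring_1"
  assumes "\<And>i. d i * e i = 1"
  shows "matrix_inv (\<chi> i j. if i = j then d i else 0) = (\<chi> i j. if i = j then e i else 0)"
proof -
  have *: "(\<chi> i j. if i = j then x i else 0) ** (\<chi> i j. if i = j then y i else 0) = mat 1"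
    if "\<And>i. x i * y i = 1" for x y :: "'n \<Rightarrow> 'a"
    using that by (simp add: matrix_matrix_mult_def mat_def vec_eq_iff if_distrib[of "\<lambda>x. x * _"] cong: if_cong)
  show ?thesis using assms by (intro matrix_inv_eqI *) (auto simp: mult.commute)
qed

lemma kadjoint_mult: "kadjoint (M ** N) = kadjoint N ** kadjoint M"
  by (simp add: kadjoint_def matrix_matrix_mult_def vec_eq_iff kstar_sum kstar_mult mult.commute)

lemma kadjoint_mat_1: "kadjoint (mat 1) = mat 1"
  by (simp add: kadjoint_def mat_def vec_eq_iff)

lemma invertible_kadjoint:
  fixes G :: "kondratiev ^ 'n ^ 'n"
  assumes "invertible G"
  shows "invertible (kadjoint G)"
  using matrix_inv_right[OF assms] unfolding invertible_def
  by (metis kadjoint_mult kadjoint_mat_1)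

lemma strictly_positive_invertible: "strictly_positive P \<Longrightarrow> invertible P"
  unfolding strictly_positive_def by (auto intro: invertible_mult invertible_kadjoint)

text \<open>Constant terms respect products and conjugation, so those of
  \<open>G ** kadjoint G\<close> again form a Gram matrix, and the form is a sum of squares.\<close>

lemma strictly_positive_const_term:
  fixes P :: "kondratiev ^ 'n ^ 'n"
  assumes "strictly_positive P"
  shows "0 \<le> Re (\<Sum>i\<in>UNIV. \<Sum>j\<in>UNIV. u i * cnj (u j) * const_term (P $ i $ j))"
proof -
  obtain G :: "kondratiev ^ 'n ^ 'n" where G: "P = G ** kadjoint G" using assms unfolding strictly_positive_def by blast
  define s where "s k = (\<Sum>i\<in>UNIV. u i * const_term (G $ i $ k))" for k
  have P: "const_term (P $ i $ j) = (\<Sum>k\<in>UNIV. const_term (G $ i $ k) * cnj (const_term (G $ j $ k)))" for i j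
    by (simp add: G matrix_matrix_mult_def kadjoint_def)
  have "(\<Sum>i\<in>UNIV. \<Sum>j\<in>UNIV. u i * cnj (u j) * const_term (P $ i $ j)) =
    (\<Sum>i\<in>UNIV. \<Sum>j\<in>UNIV. \<Sum>k\<in>UNIV. u i * const_term (G $ i $ k) * cnj (u j * const_term (G $ j $ k)))"
    by (simp add: P sum_distrib_left mult_ac)
  also have "\<dots> = (\<Sum>i\<in>UNIV. \<Sum>k\<in>UNIV. \<Sum>j\<in>UNIV. u i * const_term (G $ i $ k) * cnj (u j * const_term (G $ j $ k)))"
    by (intro sum.cong refl sum.swap)
  also have "\<dots> = (\<Sum>k\<in>UNIV. \<Sum>i\<in>UNIV. \<Sum>j\<in>UNIV. u i * const_term (G $ i $ k) * cnj (u j * const_term (G $ j $ k)))"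
    by (rule sum.swap)
  also have "\<dots> = (\<Sum>k\<in>UNIV. s k * cnj (s k))"
    unfolding s_def cnj_sum sum_product ..
  also have "\<dots> = (\<Sum>k\<in>UNIV. complex_of_real ((cmod (s k))\<^sup>2))" by (simp only: complex_norm_square)
  finally show ?thesis by (simp add: sum_nonneg)
qed

text \<open>Since \<open>inverse\<close> is total with value 0 on non-units, the first conjunct
  records that the inverse in the transform is a genuine one. \<open>mat c\<close> stands for the
  scalar matrix \<open>c I\<close>.\<close>

theorem theorem5p3:
  fixes a b :: "'n::finite \<Rightarrow> kondratiev"
    and P A :: "kondratiev ^ 'n ^ 'n"
    and C :: "kondratiev ^ 'n ^ 2"
    and J :: "kondratiev ^ 2 ^ 2"
    and \<Theta> :: "complex \<Rightarrow> kondratiev ^ 2 ^ 2"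
  assumes a_disk: "\<And>i. const_term (a i) \<in> ball 0 1"
    and b_disk: "\<And>i. const_term (b i) \<in> ball 0 1"
    and P: "P = (\<chi> i j. (1 - b i * kstar (b j)) * inverse (1 - a i * kstar (a j)))"
    and A: "A = (\<chi> i j. if i = j then kstar (a i) else 0)"
    and C: "C = vector [\<chi> j. 1, \<chi> j. kstar (b j)]"
    and J: "J = vector [vector [1, 0], vector [0, - 1]]"
    and P_pos: "strictly_positive P"
    and \<Theta>: "\<And>z. z \<in> ball 0 1 \<Longrightarrow>
      \<Theta> z = mat 1 - mat (kconst (1 - z)) ** C ** matrix_inv (mat 1 - mat (kconst z) ** A)
        ** matrix_inv P ** matrix_inv (mat 1 - kadjoint A) ** kadjoint C ** J"
  shows "(\<forall>g\<in>kschur. \<forall>z\<in>ball 0 1. (\<Theta> z $ 2 $ 1 * g z + \<Theta> z $ 2 $ 2) dvd 1) \<and>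
    bij_betw (lft \<Theta>) kschur {f \<in> kschur. \<forall>i. kevaluate f (a i) = b i}"
proof -
  define Y where "Y = (\<chi> i j. if i = j then inverse (1 - a i) else 0)"
  \<comment> \<open>The part of the formula for \<open>\<Theta>\<close> that does not depend on
    \<open>z\<close>; its two columns are the \<open>v1\<close> and \<open>v2\<close> of the
    locale.\<close>
  define V where "V = matrix_inv P ** Y ** kadjoint C ** J"
  define Q0 where "Q0 i j = const_term (matrix_inv P $ i $ j)" for i j
  have a: "cmod (const_term (a i)) < 1" for i using a_disk[of i] by simp
  note inv = matrix_inv_right[OF strictly_positive_invertible[OF P_pos]]
  have nz: "1 - z * cnj (const_term (a j)) \<noteq> 0" if "cmod z < 1" for z j
  proof
    assume "1 - z * cnj (const_term (a j)) = 0"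
    hence "cmod z * cmod (const_term (a j)) = 1" by (metis complex_mod_cnj norm_mult norm_one right_minus_eq)
    moreover have "cmod z * cmod (const_term (a j)) < 1 * 1" using that a by (intro mult_strict_mono') auto
    ultimately show False by simp
  qed
  have one_minus_a: "(1 - a i) * inverse (1 - a i) = 1" for i
    using a[of i] by (intro kcoeff_inverse(2)) auto
  have P_entry: "P $ i $ j = (1 - b i * kstar (b j)) * inverse (1 - a i * kstar (a j))" for i j
    by (simp add: P)
  have P0: "const_term (P $ i $ j) =
      (1 - const_term (b i) * cnj (const_term (b j))) / (1 - const_term (a i) * cnj (const_term (a j)))" for i j
    using nz[OF a, of i j] by (simp add: P_entry const_term_inverse divide_inverse)
  have mat_1: "const_term (mat 1 $ i $ j) = (if i = j then 1 else 0)" for i j :: 'n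
    by (simp add: mat_def)
  interpret scalar_pick "\<lambda>i. const_term (a i)" "\<lambda>i. const_term (b i)" "\<lambda>i j. const_term (P $ i $ j)" Q0
  proof
    show "(\<Sum>k\<in>UNIV. Q0 i k * const_term (P $ k $ j)) = (if i = j then 1 else 0)" for i j
      using arg_cong[OF inv(2), of "\<lambda>M. const_term (M $ i $ j)"] unfolding mat_1
      by (simp add: matrix_matrix_mult_def Q0_def)
    show "(\<Sum>k\<in>UNIV. const_term (P $ i $ k) * Q0 k j) = (if i = j then 1 else 0)" for i j
      using arg_cong[OF inv(1), of "\<lambda>M. const_term (M $ i $ j)"] unfolding mat_1
      by (simp add: matrix_matrix_mult_def Q0_def)
  qed (use a P0 strictly_positive_const_term[OF P_pos] in auto)
  have C_entries: "C $ 1 $ j = 1" "C $ 2 $ j = kstar (b j)" for j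
    by (simp_all add: C)
  have CJ: "(kadjoint C ** J) $ i $ 1 = 1" "(kadjoint C ** J) $ i $ 2 = - b i" for i
    by (simp_all add: matrix_matrix_mult_def kadjoint_def sum_2 C_entries J)
  have YM: "(Y ** M) $ i $ l = inverse (1 - a i) * M $ i $ l" for M :: "kondratiev ^ 2 ^ 'n" and i l
    by (simp add: Y_def matrix_matrix_mult_def if_distrib[of "\<lambda>x. x * _"] cong: if_cong)
  \<comment> \<open>Multiplying by \<open>P\<close> removes its inverse, so the locale equations for
    the columns follow without any formula for the entries of \<open>matrix_inv P\<close>.\<close>
  have "P ** V = Y ** (kadjoint C ** J)"
    unfolding V_def by (metis inv(1) matrix_mul_assoc matrix_mul_lid)
  hence PV: "(\<Sum>j\<in>UNIV. P $ i $ j * V $ j $ l) = inverse (1 - a i) * (kadjoint C ** J) $ i $ l" for i l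
    by (simp add: YM vec_eq_iff matrix_matrix_mult_def[of P])
  interpret ring_pick a b "\<lambda>i j. const_term (P $ i $ j)" Q0 "\<lambda>j. V $ j $ 1" "\<lambda>j. V $ j $ 2"
  proof
    show "(\<Sum>j\<in>UNIV. (1 - b i * kstar (b j)) * inverse (1 - a i * kstar (a j)) * V $ j $ 1) = inverse (1 - a i)" for i
      using PV[of i 1] by (simp add: P_entry CJ)
    show "(\<Sum>j\<in>UNIV. (1 - b i * kstar (b j)) * inverse (1 - a i * kstar (a j)) * V $ j $ 2) = - b i * inverse (1 - a i)" for i
      using PV[of i 2] by (simp add: P_entry CJ mult.commute)
  qed
  have Y: "matrix_inv (mat 1 - kadjoint A) = Y"
  proof -
    have "mat 1 - kadjoint A = (\<chi> i j. if i = j then 1 - a i else 0)"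
      by (auto simp: vec_eq_iff mat_def kadjoint_def A)
    thus ?thesis unfolding Y_def by (simp add: matrix_inv_diagonal[OF one_minus_a])
  qed
  have entry: "\<Theta> z $ k $ l = (if k = l then 1 else 0) - kconst (1 - z) * (\<Sum>j\<in>UNIV. C $ k $ j * res z j * V $ j $ l)"
    if z: "z \<in> ball 0 1" for z k l
  proof -
    have z': "cmod z < 1" using z by simp
    have "mat 1 - mat (kconst z) ** A = (\<chi> i j. if i = j then 1 - kconst z * kstar (a i) else 0)"
      by (auto simp: vec_eq_iff mat_def matrix_matrix_mult_def A if_distrib[of "\<lambda>x. x * _"] cong: if_cong)
    moreover have "(1 - kconst z * kstar (a i)) * res z i = 1" for i
      using res_inverse[OF z'] by (simp add: mult.commute)
    ultimately have X: "matrix_inv (mat 1 - mat (kconst z) ** A) = (\<chi> i j. if i = j then res z i else 0)"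
      by (simp add: matrix_inv_diagonal)
    have "\<Theta> z = mat 1 - (mat (kconst (1 - z)) ** (C ** (\<chi> i j. if i = j then res z i else 0))) ** V"
      unfolding \<Theta>[OF z] X Y V_def by (simp only: matrix_mul_assoc)
    thus ?thesis
      by (simp add: matrix_matrix_mult_def mat_def sum_distrib_left mult.assoc
          if_distrib[of "\<lambda>x. x * _"] if_distrib[of "\<lambda>x. _ * x"] cong: if_cong)
  qed
  have entries: "\<Theta> z $ 1 $ 1 = \<theta>11 z" "\<Theta> z $ 1 $ 2 = \<theta>12 z" "\<Theta> z $ 2 $ 1 = \<theta>21 z" "\<Theta> z $ 2 $ 2 = \<theta>22 z"
    if "z \<in> ball 0 1" for z
    unfolding entry[OF that] \<theta>11_def \<theta>12_def \<theta>21_def \<theta>22_def by (simp_all add: C_entries)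
  have lft: "lft \<Theta> = lift"
    by (intro ext) (simp add: lft_def lift_def entries cong: restrict_cong)
  show ?thesis
  proof (intro conjI ballI)
    fix g and z :: complex assume g: "g \<in> kschur" and z: "z \<in> ball 0 1"
    have "const_term (\<theta>21 z * g z + \<theta>22 z) \<noteq> 0"
      using kschurD(3)[OF g z] z by (intro denominator_const_term) auto
    thus "(\<Theta> z $ 2 $ 1 * g z + \<Theta> z $ 2 $ 2) dvd 1"
      by (simp only: entries[OF z] unit_iff_const_term not_False_eq_True)
  qed (simp only: lft bij_betw_lift)
qed

end
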